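(* Let $\mathscr{G}_{\mathcal{X}}$ be a dynamic Bayesian graph over a finite non-empty set of random variables $\mathcal{X}$ and let $\pi_0(\mathscr{G}_{\mathcal{X}})$ be its formigram. Then for every $\varepsilon\ge0$, $$d_B\bigl(\mathrm{dgm}(S_\varepsilon\pi_0(\mathscr{G}_{\mathcal{X}})),\ \mathrm{dgm}(\pi_0(\mathscr{G}_{\mathcal{X}}))\bigr)\le\varepsilon .$$
   Context: **Dynamic Bayesian network (DBN).** There is a finite non-empty set $\mathcal{X}$ of random variables, each with a finite state space, and a copy $\mathcal{X}^{(k)}=\{X^{(k)}:X\in\mathcal{X}\}$ for each time slice $k=0,1,2,\dots$, representing the state of the system at time $k\Delta t$, where $\Delta t>0$ is fixed. The intra-slice directed edges form a fixed directed acyclic graph $G$ on $\mathcal{X}$, the same for every slice; there may also be inter-slice edges from slice $k-1$ to slice $k$. Each $X^{(k)}$ has a conditional probability table (CPT) giving its distribution conditional on each joint configuration of its parents; CPTs may vary with $k$. **Edge strength.** For probability mass functions $p,p'$ on the same finite set $S$, $d_V(p,p')=\frac12\sum_{x\in S}|p(x)-p'(x)|$. For a stochastic matrix $P$ with rows $p_1,\dots,p_n$, the upper diameter is $d^+(P)=\max_{i\ne j}d_V(p_i,p_j)$ (equal to $0$ if $n=1$). For a directed edge $Y\to X$ of $G$ and slice $k$, the edge strength is $\delta^{(k)}_{YX}=\max_{\mathbf{x}}d^+(P^{(k)}_{X|\mathbf{x}})$, where $\mathbf{x}$ ranges over joint configurations of the parents of $X^{(k)}$ other than $Y^{(k)}$,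 and $P^{(k)}_{X|\mathbf{x}}$ is the sub-table of the CPT of $X^{(k)}$ consisting of the rows (indexed by the states of $Y^{(k)}$) in which the other parents have configuration $\mathbf{x}$. **Dynamic Bayesian graph (DBG).** Given a threshold $\eta\in\mathbb{R}$, for each $k\ge0$ let $E^{[k]}$ be the set of all self-loops $\{X,X\}$, $X\in\mathcal{X}$, together with all undirected pairs $\{Y,X\}$ such that $Y\to X$ is an edge of $G$ and $\delta^{(k)}_{YX}>\eta$. The variable $X^{(k)}$ is identified with the node $X$ for all $k$. The DBG $\mathscr{G}_{\mathcal{X}}=(\mathcal{X}_{\to}^{(\cdot)},E_\eta(\cdot))$ has vertex set $\mathcal{X}_{\to}^{(t)}=\mathcal{X}$ for all $t\in\mathbb{R}_+=[0,\infty)$, and edge sets $E_\eta(t)=E^{[k]}$ for $k\Delta t<t<(k+1)\Delta t$, $k\ge 0$; $E_\eta(k\Delta t)=E^{[k-1]}\cup E^{[k]}$ for $k\ge1$ (maximum convention at transition times); $E_\eta(0)=E^{[0]}$. For $t<0$ the vertex and edge sets are empty. **Formigrams.** A sub-partition of a finite set $X$ is a partition of a subset $X'\subseteq X$ (its underlying set); $\mathcal{P}^{\mathrm{sub}}(X)$ is the set of all sub-partitions, and $P\le Q$ means that every block of $P$ is contained in a (necessarily unique) block of $Q$; this defines the canonical map $P\to Q$ of sets of blocks. A formigram over $X$ is a function $\theta:\mathbb{R}\to\mathcal{P}^{\mathrm{sub}}(X)$ such that: (i) the set $\mathrm{crit}(\theta)$ of points where $\theta$ is not locally constant is locally finite;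 (ii) for each $x\in X$ the set of $t$ for which $x$ lies in a block of $\theta(t)$ is a non-empty closed interval; (iii) for all $c\in\mathbb{R}$ and all small $\varepsilon>0$, $\theta(c-\varepsilon)\le\theta(c)\ge\theta(c+\varepsilon)$. The formigram $\pi_0(\mathscr{G}_{\mathcal{X}})$ of a DBG is defined by letting $\pi_0(\mathscr{G}_{\mathcal{X}})(t)$ be the partition of the vertex set of $\mathscr{G}_{\mathcal{X}}(t)$ into path-connected components of the graph $\mathscr{G}_{\mathcal{X}}(t)$ (the empty partition for $t<0$). **Smoothing of formigrams.** A sub-partition corresponds to an equivalence relation on its underlying set. For a family $\{P_i\}$ of sub-partitions of $X$ with corresponding relations $\sim_i\subseteq X\times X$, the finest common coarsening $\bigvee_iP_i$ is the sub-partition corresponding to the smallest symmetric transitive relation on $X$ containing all $\sim_i$ (its underlying set is the union of the underlying sets). For $\varepsilon\ge0$, $(S_\varepsilon\theta)(t)=\bigvee_{s\in[t-\varepsilon,t+\varepsilon]}\theta(s)$ for $t\in\mathbb{R}$; it is again a formigram. **Barcode of a formigram.** Fix a field $\mathbb{F}$. Let $\theta$ be a formigram. Choose $C=\{c_i\}_{i\in\mathbb{Z}}\supseteq\mathrm{crit}(\theta)$, strictly increasing, with $c_i\to\pm\infty$ as $i\to\pm\infty$, and $s_i\in(c_i,c_{i+1})$ for each $i$; put $K=\{\dots<c_i<s_i<c_{i+1}<\dots\}$. Applying the free $\mathbb{F}$-vector space functor to the canonical maps $\theta(c_i)\leftarrow\theta(s_i)\rightarrow\theta(c_{i+1})$ yields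 a zigzag module of finite-dimensional vector spaces indexed by $K$, which decomposes uniquely (up to reordering) as a direct sum of interval modules, each supported on a set of consecutive elements of $K$. Here an interval module is $\mathbb{F}$ on its support with identity maps inside, and zero elsewhere. The barcode $\mathrm{dgm}(\theta)$ is the multiset of real intervals obtained from these supports by the rule $[c_i,c_j]_K\mapsto[c_i,c_j]$, $[c_i,s_j]_K\mapsto[c_i,c_{j+1})$, $[s_i,c_j]_K\mapsto(c_i,c_j]$, $[s_i,s_j]_K\mapsto(c_i,c_{j+1})$, $(-\infty,\infty)_K\mapsto(-\infty,\infty)$, $(-\infty,c_i]_K\mapsto(-\infty,c_i]$, $(-\infty,s_i]_K\mapsto(-\infty,c_{i+1})$, $[c_i,\infty)_K\mapsto[c_i,\infty)$, $[s_i,\infty)_K\mapsto(c_i,\infty)$. The result does not depend on the choice of $K$. **Bottleneck distance.** For multisets $A,B$ of real intervals, $d_B(A,B)$ is the infimum of $r\ge0$ such that there is a partial matching between $A$ and $B$ in which matched intervals with endpoints $(b,d)$ and $(b',d')$ (in $[-\infty,\infty]$) satisfy $|b-b'|\le r$ and $|d-d'|\le r$ (with equal infinite endpoints at distance $0$, and an infinite endpoint at distance $\infty$ from any other value), and every unmatched interval has length at most $2r$. *)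

theory Defs
  imports
    "HOL-Analysis.Analysis"
    "HOL-Probability.Probability_Mass_Function"
    "HOL-Library.Disjoint_Sets"
begin

section \<open>Dynamic Bayesian networks\<close>

text \<open>
  The node \<open>(k, X)\<close> is the copy of the variable \<open>X\<close> in slice \<open>k\<close>. The set \<open>dbn_inter N k\<close> holds the
  inter-slice edges from slice \<open>k - 1\<close> to slice \<open>k\<close>; its value at \<open>k = 0\<close> is never used.
  A configuration of a set of nodes is an element of the dependent product \<open>Pi\<^sub>E\<close> of their state
  spaces, and \<open>dbn_cpt N k X x\<close> is the row of the CPT of \<open>(k, X)\<close> for the parent configuration \<open>x\<close>.
\<close>

record ('v, 's) dbn =
  dbn_vars :: "'v set"
  dbn_states :: "'v \<Rightarrow> 's set"
  dbn_intra :: "('v \<times> 'v) set"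
  dbn_inter :: "nat \<Rightarrow> ('v \<times> 'v) set"
  dbn_cpt :: "nat \<Rightarrow> 'v \<Rightarrow> (nat \<times> 'v \<Rightarrow> 's) \<Rightarrow> 's pmf"

definition dbn_parents :: "('v, 's) dbn \<Rightarrow> nat \<Rightarrow> 'v \<Rightarrow> (nat \<times> 'v) set" where
  "dbn_parents N k X =
     {(k, Y) | Y. (Y, X) \<in> dbn_intra N} \<union>
     (if k = 0 then {} else {(k - 1, Y) | Y. (Y, X) \<in> dbn_inter N k})"

definition configs :: "('v, 's) dbn \<Rightarrow> (nat \<times> 'v) set \<Rightarrow> (nat \<times> 'v \<Rightarrow> 's) set" where
  "configs N A = Pi\<^sub>E A (\<lambda>(j, Z). dbn_states N Z)"

definition is_dbn :: "('v, 's) dbn \<Rightarrow> bool" where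
  "is_dbn N \<longleftrightarrow>
     finite (dbn_vars N) \<and> dbn_vars N \<noteq> {} \<and>
     (\<forall>X\<in>dbn_vars N. finite (dbn_states N X) \<and> dbn_states N X \<noteq> {}) \<and>
     dbn_intra N \<subseteq> dbn_vars N \<times> dbn_vars N \<and> acyclic (dbn_intra N) \<and>
     (\<forall>k\<ge>1. dbn_inter N k \<subseteq> dbn_vars N \<times> dbn_vars N) \<and>
     (\<forall>k. \<forall>X\<in>dbn_vars N. \<forall>x\<in>configs N (dbn_parents N k X).
        set_pmf (dbn_cpt N k X x) \<subseteq> dbn_states N X)"


section \<open>Edge strength\<close>

definition d_V :: "'s set \<Rightarrow> ('s \<Rightarrow> real) \<Rightarrow> ('s \<Rightarrow> real) \<Rightarrow> real" where
  "d_V S p p' = (1/2) * (\<Sum>x\<in>S. \<bar>p x - p' x\<bar>)"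

text \<open>A stochastic matrix is given by its rows \<open>P i\<close>, \<open>i \<in> I\<close>, which are mass functions on \<open>S\<close>.\<close>

definition upper_diameter :: "'s set \<Rightarrow> 'i set \<Rightarrow> ('i \<Rightarrow> 's \<Rightarrow> real) \<Rightarrow> real" where
  "upper_diameter S I P =
     (if card I \<le> 1 then 0 else Max {d_V S (P i) (P j) | i j. i \<in> I \<and> j \<in> I \<and> i \<noteq> j})"

definition edge_strength :: "('v, 's) dbn \<Rightarrow> nat \<Rightarrow> 'v \<Rightarrow> 'v \<Rightarrow> real" where
  "edge_strength N k Y X =
     Max ((\<lambda>x. upper_diameter (dbn_states N X) (dbn_states N Y)
                 (\<lambda>y. pmf (dbn_cpt N k X (x((k, Y) := y)))))
          ` configs N (dbn_parents N k X - {(k, Y)}))"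


section \<open>Dynamic Bayesian graphs\<close>

text \<open>
  An undirected edge is the set of its end points. A dynamic graph assigns to every time a vertex
  set and an edge set.
\<close>

type_synonym 'v dynamic_graph = "real \<Rightarrow> 'v set \<times> 'v set set"

definition slice_edges :: "('v, 's) dbn \<Rightarrow> real \<Rightarrow> nat \<Rightarrow> 'v set set" where
  "slice_edges N \<eta> k =
     {{X, X} | X. X \<in> dbn_vars N} \<union>
     {{Y, X} | Y X. (Y, X) \<in> dbn_intra N \<and> edge_strength N k Y X > \<eta>}"

definition dbg_edges :: "('v, 's) dbn \<Rightarrow> real \<Rightarrow> real \<Rightarrow> real \<Rightarrow> 'v set set" where
  "dbg_edges N \<eta> \<Delta> t =
     (if t < 0 then {}
      else let k = nat \<lfloor>t / \<Delta>\<rfloor> in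
        if k \<ge> 1 \<and> t = real k * \<Delta> then slice_edges N \<eta> (k - 1) \<union> slice_edges N \<eta> k
        else slice_edges N \<eta> k)"

definition dbg :: "('v, 's) dbn \<Rightarrow> real \<Rightarrow> real \<Rightarrow> 'v dynamic_graph" where
  "dbg N \<eta> \<Delta> t = (if t < 0 then {} else dbn_vars N, dbg_edges N \<eta> \<Delta> t)"


section \<open>Formigrams\<close>

text \<open>A sub-partition is represented by its set of blocks.\<close>

definition sub_partition :: "'v set \<Rightarrow> 'v set set \<Rightarrow> bool" where
  "sub_partition X P \<longleftrightarrow> (\<exists>X'\<subseteq>X. partition_on X' P)"

definition coarsened_by :: "'v set set \<Rightarrow> 'v set set \<Rightarrow> bool" where
  "coarsened_by P Q \<longleftrightarrow> (\<forall>B\<in>P. \<exists>C\<in>Q. B \<subseteq> C)"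

definition canonical_map :: "'v set set \<Rightarrow> 'v set \<Rightarrow> 'v set" where
  "canonical_map Q B = (THE C. C \<in> Q \<and> B \<subseteq> C)"

definition crit :: "(real \<Rightarrow> 'a) \<Rightarrow> real set" where
  "crit \<theta> = {t. \<not> (\<forall>\<^sub>F s in nhds t. \<theta> s = \<theta> t)}"

definition formigram :: "'v set \<Rightarrow> (real \<Rightarrow> 'v set set) \<Rightarrow> bool" where
  "formigram X \<theta> \<longleftrightarrow>
     (\<forall>t. sub_partition X (\<theta> t)) \<and>
     (\<forall>a b. finite (crit \<theta> \<inter> {a..b})) \<and>
     (\<forall>x\<in>X. {t. x \<in> \<Union>(\<theta> t)} \<noteq> {} \<and> is_interval {t. x \<in> \<Union>(\<theta> t)} \<and> closed {t. x \<in> \<Union>(\<theta> t)}) \<and>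
     (\<forall>c. \<forall>\<^sub>F e in at_right 0. coarsened_by (\<theta> (c - e)) (\<theta> c) \<and> coarsened_by (\<theta> (c + e)) (\<theta> c))"

definition connectivity :: "'v set \<times> 'v set set \<Rightarrow> ('v \<times> 'v) set" where
  "connectivity = (\<lambda>(V, E). {(x, y). x \<in> V \<and> y \<in> V \<and> (x, y) \<in> {(a, b). {a, b} \<in> E}\<^sup>*})"

definition pi0 :: "'v dynamic_graph \<Rightarrow> real \<Rightarrow> 'v set set" where
  "pi0 g t = fst (g t) // connectivity (g t)"


section \<open>Smoothing\<close>

definition block_rel :: "'v set set \<Rightarrow> ('v \<times> 'v) set" where
  "block_rel P = {(x, y). \<exists>B\<in>P. x \<in> B \<and> y \<in> B}"

definition generated_rel :: "'v set set set \<Rightarrow> ('v \<times> 'v) set" where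
  "generated_rel \<P> = \<Inter> {R. sym R \<and> trans R \<and> (\<forall>P\<in>\<P>. block_rel P \<subseteq> R)}"

definition common_coarsening :: "'v set set set \<Rightarrow> 'v set set" where
  "common_coarsening \<P> = Field (generated_rel \<P>) // generated_rel \<P>"

definition smoothing :: "real \<Rightarrow> (real \<Rightarrow> 'v set set) \<Rightarrow> real \<Rightarrow> 'v set set" where
  "smoothing \<epsilon> \<theta> t = common_coarsening (\<theta> ` {t - \<epsilon>..t + \<epsilon>})"


section \<open>Zigzag modules\<close>

text \<open>
  The poset \<open>K = {\<dots> < c i < s i < c (i + 1) < \<dots>}\<close> is indexed by the integers: position \<open>2 * i\<close> is
  \<open>c i\<close> and position \<open>2 * i + 1\<close> is \<open>s i\<close>. A zigzag module over a field \<open>'f\<close> has at position \<open>k\<close> the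
  space \<open>zspace V k\<close> of \<open>'f\<close>-valued functions (with pointwise operations), and maps
  \<open>zmap V k l\<close> from each odd position \<open>k\<close> to the even positions \<open>l = k - 1\<close> and \<open>l = k + 1\<close>; the values
  of \<open>zmap\<close> at other indices are irrelevant.
\<close>

record ('a, 'f) zigzag =
  zspace :: "int \<Rightarrow> ('a \<Rightarrow> 'f) set"
  zmap :: "int \<Rightarrow> int \<Rightarrow> ('a \<Rightarrow> 'f) \<Rightarrow> ('a \<Rightarrow> 'f)"

definition zigzag_arrow :: "int \<Rightarrow> int \<Rightarrow> bool" where
  "zigzag_arrow k l \<longleftrightarrow> odd k \<and> (l = k - 1 \<or> l = k + 1)"

definition linear_between ::
    "('a \<Rightarrow> 'f::field) set \<Rightarrow> ('b \<Rightarrow> 'f) set \<Rightarrow> (('a \<Rightarrow> 'f) \<Rightarrow> ('b \<Rightarrow> 'f)) \<Rightarrow> bool" where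
  "linear_between V W f \<longleftrightarrow>
     f ` V \<subseteq> W \<and>
     (\<forall>x\<in>V. \<forall>y\<in>V. f (\<lambda>a. x a + y a) = (\<lambda>b. f x b + f y b)) \<and>
     (\<forall>r. \<forall>x\<in>V. f (\<lambda>a. r * x a) = (\<lambda>b. r * f x b))"

definition zigzag_iso :: "('a, 'f::field) zigzag \<Rightarrow> ('b, 'f) zigzag \<Rightarrow> bool" where
  "zigzag_iso V W \<longleftrightarrow>
     (\<exists>\<phi>. (\<forall>k. linear_between (zspace V k) (zspace W k) (\<phi> k) \<and>
               bij_betw (\<phi> k) (zspace V k) (zspace W k)) \<and>
          (\<forall>k l. zigzag_arrow k l \<longrightarrow>
             (\<forall>x\<in>zspace V k. \<phi> l (zmap V k l x) = zmap W k l (\<phi> k x))))"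

definition free_space :: "'a set \<Rightarrow> ('a \<Rightarrow> 'f::field) set" where
  "free_space A = {x. finite {a. x a \<noteq> 0} \<and> {a. x a \<noteq> 0} \<subseteq> A}"

definition free_map :: "('a \<Rightarrow> 'b) \<Rightarrow> ('a \<Rightarrow> 'f::field) \<Rightarrow> ('b \<Rightarrow> 'f)" where
  "free_map g x = (\<lambda>b. \<Sum>a | x a \<noteq> 0 \<and> g a = b. x a)"

definition int_interval :: "int set \<Rightarrow> bool" where
  "int_interval J \<longleftrightarrow> J \<noteq> {} \<and> (\<forall>a\<in>J. \<forall>b\<in>J. {a..b} \<subseteq> J)"

text \<open>
  Possibly infinite multisets, with finite multiplicities, are represented by their multiplicity
  functions; \<open>(a, n)\<close> with \<open>n < M a\<close> is the \<open>n\<close>-th copy of \<open>a\<close>.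
\<close>

definition copies :: "('a \<Rightarrow> nat) \<Rightarrow> ('a \<times> nat) set" where
  "copies M = {(a, n). n < M a}"

text \<open>
  The direct sum of the interval modules supported on the members of \<open>M\<close>. The copy \<open>(J, n)\<close>
  contributes one coordinate at exactly the positions in \<open>J\<close>. A map from position \<open>k\<close> to position
  \<open>l\<close> keeps the coordinates of those \<open>J\<close> that also contain \<open>l\<close> and sends the others to zero.
\<close>

definition interval_sum :: "(int set \<Rightarrow> nat) \<Rightarrow> (int set \<times> nat, 'f::field) zigzag" where
  "interval_sum M =
     \<lparr> zspace = (\<lambda>k. free_space {(J, n) \<in> copies M. k \<in> J}),
       zmap = (\<lambda>k l x. \<lambda>(J, n). if l \<in> J then x (J, n) else 0) \<rparr>"


section \<open>Barcodes\<close>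

definition knots :: "(real \<Rightarrow> 'v set set) \<Rightarrow> (int \<Rightarrow> real) \<Rightarrow> (int \<Rightarrow> real) \<Rightarrow> bool" where
  "knots \<theta> c s \<longleftrightarrow>
     crit \<theta> \<subseteq> range c \<and> strict_mono c \<and>
     filterlim c at_top at_top \<and> filterlim c at_bot at_bot \<and>
     (\<forall>i. c i < s i \<and> s i < c (i + 1))"

definition knot :: "(int \<Rightarrow> real) \<Rightarrow> (int \<Rightarrow> real) \<Rightarrow> int \<Rightarrow> real" where
  "knot c s k = (if even k then c (k div 2) else s (k div 2))"

definition formigram_zigzag ::
    "(real \<Rightarrow> 'v set set) \<Rightarrow> (int \<Rightarrow> real) \<Rightarrow> (int \<Rightarrow> real) \<Rightarrow> ('v set, 'f::field) zigzag" where
  "formigram_zigzag \<theta> c s =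
     \<lparr> zspace = (\<lambda>k. free_space (\<theta> (knot c s k))),
       zmap = (\<lambda>k l. free_map (canonical_map (\<theta> (knot c s l)))) \<rparr>"

text \<open>
  The real interval attached to a set \<open>J\<close> of consecutive positions. A least position \<open>2 * i\<close>
  (that is, \<open>c i\<close>) gives the closed lower end \<open>c i\<close>, and \<open>2 * i + 1\<close> (that is, \<open>s i\<close>) the open lower
  end \<open>c i\<close>. A greatest position \<open>2 * j\<close> gives the closed upper end \<open>c j\<close>, and \<open>2 * j + 1\<close> the open
  upper end \<open>c (j + 1)\<close>.
\<close>

definition lower_ray :: "(int \<Rightarrow> real) \<Rightarrow> int set \<Rightarrow> real set" where
  "lower_ray c J =
     (if \<not> bdd_below J then UNIV
      else if even (Inf J) then {c (Inf J div 2)..} else {c (Inf J div 2)<..})"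

definition upper_ray :: "(int \<Rightarrow> real) \<Rightarrow> int set \<Rightarrow> real set" where
  "upper_ray c J =
     (if \<not> bdd_above J then UNIV
      else if even (Sup J) then {..c (Sup J div 2)} else {..<c (Sup J div 2 + 1)})"

definition real_interval :: "(int \<Rightarrow> real) \<Rightarrow> int set \<Rightarrow> real set" where
  "real_interval c J = lower_ray c J \<inter> upper_ray c J"

text \<open>
  \<open>D\<close> is obtained from some choice of \<open>K\<close> and some decomposition \<open>M\<close> of the zigzag module over
  \<open>'f\<close>. The last conjunct takes the image of the multiset \<open>M\<close> under \<open>real_interval c\<close>; the sum has
  at most one summand, because \<open>real_interval c\<close> is injective on sets of consecutive positions.
\<close>

definition is_barcode :: "'f::field itself \<Rightarrow> (real \<Rightarrow> 'v set set) \<Rightarrow> (real set \<Rightarrow> nat) \<Rightarrow> bool" where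
  "is_barcode _ \<theta> D \<longleftrightarrow>
     (\<exists>c s M. knots \<theta> c s \<and> (\<forall>J. M J > 0 \<longrightarrow> int_interval J) \<and>
        zigzag_iso (formigram_zigzag \<theta> c s :: ('v set, 'f) zigzag) (interval_sum M) \<and>
        D = (\<lambda>R. \<Sum>J | int_interval J \<and> real_interval c J = R. M J))"

text \<open>For a formigram, the barcode exists and depends neither on the decomposition nor on \<open>K\<close>.\<close>

definition dgm :: "'f::field itself \<Rightarrow> (real \<Rightarrow> 'v set set) \<Rightarrow> real set \<Rightarrow> nat" where
  "dgm F \<theta> = (THE D. is_barcode F \<theta> D)"


section \<open>Bottleneck distance\<close>

definition left_end :: "real set \<Rightarrow> ereal" where
  "left_end I = Inf (ereal ` I)"

definition right_end :: "real set \<Rightarrow> ereal" where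
  "right_end I = Sup (ereal ` I)"

definition end_dist :: "ereal \<Rightarrow> ereal \<Rightarrow> ereal" where
  "end_dist a b = (if a = b then 0 else \<bar>a - b\<bar>)"

definition partial_matching :: "'a set \<Rightarrow> 'b set \<Rightarrow> ('a \<times> 'b) set \<Rightarrow> bool" where
  "partial_matching A B m \<longleftrightarrow> m \<subseteq> A \<times> B \<and> single_valued m \<and> single_valued (m\<inverse>)"

definition r_matching ::
    "real \<Rightarrow> (real set \<Rightarrow> nat) \<Rightarrow> (real set \<Rightarrow> nat) \<Rightarrow> ((real set \<times> nat) \<times> (real set \<times> nat)) set \<Rightarrow> bool" where
  "r_matching r A B m \<longleftrightarrow>
     partial_matching (copies A) (copies B) m \<and>
     (\<forall>((I, i), (J, j))\<in>m. end_dist (left_end I) (left_end J) \<le> ereal r \<and>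
                           end_dist (right_end I) (right_end J) \<le> ereal r) \<and>
     (\<forall>(I, i)\<in>copies A - Domain m. right_end I - left_end I \<le> ereal (2 * r)) \<and>
     (\<forall>(J, j)\<in>copies B - Range m. right_end J - left_end J \<le> ereal (2 * r))"

definition bottleneck_dist :: "(real set \<Rightarrow> nat) \<Rightarrow> (real set \<Rightarrow> nat) \<Rightarrow> ereal" where
  "bottleneck_dist A B = Inf {ereal r | r. 0 \<le> r \<and> (\<exists>m. r_matching r A B m)}"


section \<open>The components of a dynamic Bayesian graph form a formigram\<close>

lemma dbg_edges_between:
  assumes "real k * \<Delta> < t" "t < (real k + 1) * \<Delta>" "0 < \<Delta>"
  shows "dbg_edges N \<eta> \<Delta> t = slice_edges N \<eta> k"
proof -
  have t: "0 < t" using assms by (meson le_less_trans less_imp_le mult_nonneg_nonneg of_nat_0_le_iff)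
  have "\<lfloor>t / \<Delta>\<rfloor> = int k"
    using assms by (intro floor_unique) (auto simp: field_simps)
  then show ?thesis using assms t by (simp add: dbg_edges_def)
qed

lemma dbg_edges_at:
  assumes "0 < \<Delta>"
  shows "dbg_edges N \<eta> \<Delta> (real k * \<Delta>) =
    (if k = 0 then slice_edges N \<eta> 0 else slice_edges N \<eta> (k - 1) \<union> slice_edges N \<eta> k)"
  using assms by (auto simp: dbg_edges_def Let_def not_less mult_less_0_iff)

lemma slice_exists:
  fixes t \<Delta> :: real
  assumes "0 < \<Delta>" "0 \<le> t"
  obtains k where "t = real k * \<Delta>" | k where "real k * \<Delta> < t" "t < (real k + 1) * \<Delta>"
proof -
  define k where "k = nat \<lfloor>t / \<Delta>\<rfloor>"
  have "real k = of_int \<lfloor>t / \<Delta>\<rfloor>" using assms by (simp add: k_def)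
  then have "real k \<le> t / \<Delta>" "t / \<Delta> < real k + 1" by linarith+
  then have "real k * \<Delta> \<le> t" "t < (real k + 1) * \<Delta>" using assms by (auto simp: field_simps)
  then show ?thesis using that(1)[of k] that(2)[of k] by (cases "t = real k * \<Delta>") auto
qed

lemma connectivity_mono:
  "V \<subseteq> V' \<Longrightarrow> E \<subseteq> E' \<Longrightarrow> connectivity (V, E) \<subseteq> connectivity (V', E')"
proof -
  assume *: "V \<subseteq> V'" "E \<subseteq> E'"
  have "{(a, b). {a, b} \<in> E}\<^sup>* \<subseteq> {(a, b). {a, b} \<in> E'}\<^sup>*"
    using * by (intro rtrancl_mono) auto
  then show ?thesis using * unfolding connectivity_def by auto
qed

lemma coarsened_components:
  "V \<subseteq> V' \<Longrightarrow> E \<subseteq> E' \<Longrightarrow> coarsened_by (V // connectivity (V, E)) (V' // connectivity (V', E'))"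
  using connectivity_mono[of V V' E E'] unfolding coarsened_by_def quotient_def by blast

lemma equiv_connectivity: "equiv V (connectivity (V, E))"
proof (rule equivI)
  have "sym ({(a, b). {a, b} \<in> E}\<^sup>*)"
    by (intro sym_rtrancl symI) (auto simp: insert_commute)
  then show "sym (connectivity (V, E))"
    unfolding connectivity_def sym_def by auto
  show "trans (connectivity (V, E))"
    unfolding connectivity_def trans_def by (auto intro: rtrancl_trans)
qed (auto simp: connectivity_def refl_on_def)

lemma pi0_dbg_mono:
  assumes "s < 0 \<or> 0 \<le> t \<and> dbg_edges N \<eta> \<Delta> s \<subseteq> dbg_edges N \<eta> \<Delta> t"
  shows "coarsened_by (pi0 (dbg N \<eta> \<Delta>) s) (pi0 (dbg N \<eta> \<Delta>) t)"
proof (cases "s < 0")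
  case True
  then show ?thesis by (simp add: pi0_def dbg_def coarsened_by_def)
next
  case False
  then have "s \<ge> 0" "t \<ge> 0" "dbg_edges N \<eta> \<Delta> s \<subseteq> dbg_edges N \<eta> \<Delta> t" using assms by auto
  then show ?thesis unfolding pi0_def dbg_def by (auto intro: coarsened_components)
qed

lemma pi0_dbg_locally_constant:
  assumes "0 < \<Delta>" "t \<notin> range (\<lambda>k. real k * \<Delta>)"
  shows "\<forall>\<^sub>F s in nhds t. pi0 (dbg N \<eta> \<Delta>) s = pi0 (dbg N \<eta> \<Delta>) t"
proof (cases "t < 0")
  case True
  then have "\<forall>\<^sub>F s in nhds t. s < 0" by (intro eventually_nhds_in_open[of "{..<0}", simplified]) auto
  then show ?thesis by (rule eventually_mono) (use True in \<open>simp add: pi0_def dbg_def\<close>)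
next
  case False
  then obtain k where k: "real k * \<Delta> < t" "t < (real k + 1) * \<Delta>"
    using assms slice_exists[of \<Delta> t] by (metis not_less rangeI)
  then have "\<forall>\<^sub>F s in nhds t. s \<in> {real k * \<Delta><..<(real k + 1) * \<Delta>}"
    by (intro eventually_nhds_in_open) auto
  then show ?thesis
  proof eventually_elim
    case (elim s)
    have "0 \<le> real k * \<Delta>" using assms by simp
    then have "0 < s" "0 < t" using k elim by auto
    then show ?case using dbg_edges_between[of k \<Delta> s N \<eta>] dbg_edges_between[of k \<Delta> t N \<eta>] k elim assms
      by (simp add: pi0_def dbg_def)
  qed
qed

lemma pi0_dbg_formigram:
  assumes "0 < \<Delta>"
  shows "formigram (dbn_vars N) (pi0 (dbg N \<eta> \<Delta>))"
proof -
  let ?\<theta> = "pi0 (dbg N \<eta> \<Delta>)"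
  have part: "partition_on (if t < 0 then {} else dbn_vars N) (?\<theta> t)" for t
    using partition_on_quotient[OF equiv_connectivity] by (auto simp: pi0_def dbg_def partition_on_empty)
  have U: "\<Union>(?\<theta> t) = (if t < 0 then {} else dbn_vars N)" for t
    using part[of t] by (simp add: partition_on_def)
  have sub: "sub_partition (dbn_vars N) (?\<theta> t)" for t
    using part[of t] unfolding sub_partition_def by (metis empty_subsetI order_refl)
  have fin: "finite (crit ?\<theta> \<inter> {a..b})" for a b
  proof (rule finite_subset)
    show "crit ?\<theta> \<inter> {a..b} \<subseteq> (\<lambda>k. real k * \<Delta>) ` {..nat \<lceil>b / \<Delta>\<rceil>}"
    proof
      fix t assume t: "t \<in> crit ?\<theta> \<inter> {a..b}"
      then obtain k where k: "t = real k * \<Delta>"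
        using pi0_dbg_locally_constant[OF assms] unfolding crit_def by blast
      then have "real k \<le> b / \<Delta>" using t assms by (simp add: field_simps)
      then have "k \<le> nat \<lceil>b / \<Delta>\<rceil>" by linarith
      then show "t \<in> (\<lambda>k. real k * \<Delta>) ` {..nat \<lceil>b / \<Delta>\<rceil>}" using k by auto
    qed
  qed simp
  have int: "{t. x \<in> \<Union>(?\<theta> t)} = {0..}" if "x \<in> dbn_vars N" for x
    using that U by auto
  have small: "\<forall>\<^sub>F e in at_right 0. coarsened_by (?\<theta> (c - e)) (?\<theta> c) \<and> coarsened_by (?\<theta> (c + e)) (?\<theta> c)"
    for c
  proof (cases "c \<in> range (\<lambda>k. real k * \<Delta>)")
    case True
    then obtain k where k: "c = real k * \<Delta>" by auto
    then have c: "0 \<le> c" using assms by simp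
    have "\<forall>\<^sub>F e in at_right 0. e \<in> {0<..<\<Delta>}" using assms eventually_at_right_real by blast
    then show ?thesis
    proof eventually_elim
      case (elim e)
      have "dbg_edges N \<eta> \<Delta> (c + e) = slice_edges N \<eta> k"
        using elim k assms by (intro dbg_edges_between) (auto simp: algebra_simps)
      then have "coarsened_by (?\<theta> (c + e)) (?\<theta> c)"
        using dbg_edges_at[OF assms, of N \<eta> k] k c by (intro pi0_dbg_mono) auto
      moreover have "coarsened_by (?\<theta> (c - e)) (?\<theta> c)"
      proof (cases k)
        case 0
        then show ?thesis using k elim by (intro pi0_dbg_mono) auto
      next
        case (Suc j)
        have "dbg_edges N \<eta> \<Delta> (c - e) = slice_edges N \<eta> j"
          using elim k assms Suc by (intro dbg_edges_between) (auto simp: algebra_simps)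
        then show ?thesis
          using dbg_edges_at[OF assms, of N \<eta> k] k c Suc by (intro pi0_dbg_mono) auto
      qed
      ultimately show ?case by blast
    qed
  next
    case False
    have refl: "coarsened_by P P" for P :: "'a set set" by (auto simp: coarsened_by_def)
    have ev: "\<forall>\<^sub>F s in nhds c. ?\<theta> s = ?\<theta> c" using pi0_dbg_locally_constant[OF assms False] .
    have "((\<lambda>e. c - e) \<longlongrightarrow> c - 0) (at_right 0)" "((\<lambda>e. c + e) \<longlongrightarrow> c + 0) (at_right 0)"
      by (intro tendsto_intros)+
    then have "\<forall>\<^sub>F e in at_right 0. ?\<theta> (c - e) = ?\<theta> c" "\<forall>\<^sub>F e in at_right 0. ?\<theta> (c + e) = ?\<theta> c"
      using ev by (auto simp: filterlim_iff)
    then show ?thesis by eventually_elim (simp add: refl)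
  qed
  show ?thesis
    unfolding formigram_def using sub fin small int by (auto simp: is_interval_ci)
qed

end

theory Submission
  imports Defs "HOL-Library.Function_Algebras"
begin

text \<open>
  The chain spaces of a formigram are replaced by their duals. The dual of the free space on the blocks of
  \<open>\<theta> t\<close> is the space of functions on the vertex set that are constant on every block, and the dual of a
  canonical map is an inclusion. A zigzag of maps between different spaces thus becomes a zigzag of
  subspaces \<open>D\<^sub>0, D\<^sub>1, \<dots>\<close> of one space. A decomposition into interval modules becomes a family of
  functions, each with an interval as its lifetime, such that at every time the functions alive form a
  basis of the subspace belonging to that time.
  
  \<^bold>\<open>Bars exist.\<close> At every position \<open>b\<close> choose a basis of \<open>D\<^sub>b\<close> modulo \<open>D\<^bsub>b-1\<^esub> \<inter> D\<^sub>b\<close> that is adapted to the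
  descending chain \<open>D\<^sub>b \<supseteq> D\<^sub>b \<inter> D\<^bsub>b+1\<^esub> \<supseteq> \<dots>\<close>, and let each chosen function live from \<open>b\<close> until it first
  leaves the sequence. Then the functions that are alive throughout \<open>m, \<dots>, j\<close> form a basis of
  \<open>D\<^sub>m \<inter> \<dots> \<inter> D\<^sub>j\<close>; this is \<open>zigzag_basis\<close>. The choice at \<open>b\<close> looks ahead along the whole future, so
  infinitely many positions need no limit argument.
  
  \<^bold>\<open>Smoothing shrinks or shifts lifetimes.\<close> A function is constant on the blocks of a common coarsening
  if and only if it is constant on the blocks of all the partitions. The space of the smoothing at time
  \<open>t\<close> is therefore the intersection of the spaces over the window \<open>[t - \<epsilon>, t + \<epsilon>]\<close>, and its basis consists
  of the functions whose lifetime contains the part of the window after time 0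
  (\<open>smoothing_after\<close>, \<open>bars_basis\<close>). Hence the smoothing has the same functions as bars, and a bar with
  lifetime \<open>I\<close> now lives at the times whose window lies in \<open>I\<close>. Either both ends move by at most \<open>\<epsilon>\<close>, or
  nothing is left and \<open>I\<close> had length at most \<open>2 \<epsilon>\<close> (\<open>smoothed_interval_ends\<close>, \<open>smoothed_interval_empty\<close>).
  Matching every surviving bar with its origin gives the bound.
  
  \<^bold>\<open>Barcodes are unique.\<close> The barcode is given by a definite description, so all decompositions, for all
  choices of knots, have to yield the same multiset. The number of bars that contain \<open>[a, b]\<close> can be
  read off from the sections of the module over \<open>[a, b]\<close> (\<open>card_bars_over_interval_le\<close>), and a multiset of
  intervals in which every point is covered finitely often is determined by these numbers
  (\<open>interval_multiset_determined_by_counts\<close>). Sections are defined over the real line by a local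
  condition that does not mention knots, which settles independence of the knots at the same time.
\<close>

section \<open>Bases adapted to a zigzag of subspaces\<close>

text \<open>
  The functions on an infinite vertex type form a space of infinite dimension, so finiteness is tied to
  the span of a finite set \<open>G\<close>.
\<close>

lemma (in vector_space) dim_less_if_psubset:
  assumes "subspace A" "A \<subset> A'" "A' \<subseteq> span G" "finite G"
  shows "dim A < dim A'"
proof -
  obtain C where C: "C \<subseteq> A" "independent C" "A \<subseteq> span C" "card C = dim A"
    using basis_exists by blast
  obtain C' where C': "C' \<subseteq> A'" "independent C'" "A' \<subseteq> span C'" "card C' = dim A'"
    using basis_exists by blast
  have "span C = A" using C(1,3) assms(1) by (simp add: span_subspace)
  then obtain x where x: "x \<in> A'" "x \<notin> span C" using assms(2) by blast
  have "C \<subseteq> span G" "C' \<subseteq> span G" using C(1) C'(1) assms(2,3) by auto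
  then have fin: "finite C" "finite C'"
    using independent_span_bound[OF assms(4)] C(2) C'(2) by auto
  have "independent (insert x C)" using independent_insertI[OF x(2) C(2)] .
  moreover have "insert x C \<subseteq> span C'" using x(1) C(1) C'(3) assms(2) by auto
  ultimately have "card (insert x C) \<le> card C'"
    using independent_span_bound[OF fin(2)] by blast
  moreover have "x \<notin> C" using x(2) span_base by blast
  ultimately show ?thesis using fin(1) C(4) C'(4) by simp
qed

text \<open>
  Linear independence modulo \<open>A\<close> is expressed by the possibility to add \<open>B\<close> to any independent subset
  of \<open>A\<close>. For the proof, take a member \<open>Q\<close> of least dimension among the members of the chain that are not
  contained in \<open>A\<close>. A vector of \<open>Q\<close> outside \<open>A\<close> lies in every member not contained in \<open>A\<close>, so it can be
  put into \<open>B\<close>, and \<open>A\<close> can be enlarged by it.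
\<close>

lemma (in vector_space) relative_basis_adapted_to_chain:
  assumes "finite G" "subspace A" "A \<subseteq> span G"
    and "\<And>Q. Q \<in> \<Q> \<Longrightarrow> subspace Q \<and> Q \<subseteq> span G"
    and "\<And>Q Q'. Q \<in> \<Q> \<Longrightarrow> Q' \<in> \<Q> \<Longrightarrow> Q \<subseteq> Q' \<or> Q' \<subseteq> Q"
  shows "\<exists>B. B \<subseteq> \<Union>\<Q> \<and>
             (\<forall>S. independent S \<and> S \<subseteq> A \<longrightarrow> independent (S \<union> B) \<and> S \<inter> B = {}) \<and>
             (\<forall>Q\<in>\<Q>. Q \<subseteq> span (A \<union> (B \<inter> Q)))"
  using assms(2,3)
proof (induction "card G - dim A" arbitrary: A rule: less_induct)
  case (less A)
  show ?case
  proof (cases "\<forall>Q\<in>\<Q>. Q \<subseteq> A")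
    case True
    then show ?thesis using span_superset[of A] by (intro exI[of _ "{}"]) auto
  next
    case False
    let ?P = "\<lambda>Q. Q \<in> \<Q> \<and> \<not> Q \<subseteq> A"
    obtain Q where Q: "?P Q" and min: "\<And>Q'. ?P Q' \<Longrightarrow> dim Q \<le> dim Q'"
      using False ex_has_least_nat[of ?P _ dim] by metis
    have least: "Q \<subseteq> Q'" if "?P Q'" for Q'
    proof (rule ccontr)
      assume "\<not> Q \<subseteq> Q'"
      then have "Q' \<subset> Q" using assms(5)[of Q Q'] that Q by blast
      then have "dim Q' < dim Q" using dim_less_if_psubset[of Q' Q G] that Q assms(1,4) by blast
      then show False using min[OF that] by simp
    qed
    obtain x where x: "x \<in> Q" "x \<notin> A" using Q by blast
    let ?A = "span (insert x A)"
    have A: "span A = A" using less.prems(1) by simp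
    have sub: "insert x A \<subseteq> span G" using less.prems x Q assms(4) by blast
    have A_sub: "?A \<subseteq> span G" using span_minimal[OF sub] by simp
    have psub: "A \<subset> ?A"
      using x span_superset[of "insert x A"] by auto
    have "dim A < dim ?A" using dim_less_if_psubset[OF less.prems(1) psub A_sub assms(1)] .
    moreover have "dim ?A \<le> card G" using dim_le_card[OF A_sub assms(1)] .
    ultimately obtain B where B: "B \<subseteq> \<Union>\<Q>"
      "\<And>S. independent S \<Longrightarrow> S \<subseteq> ?A \<Longrightarrow> independent (S \<union> B) \<and> S \<inter> B = {}"
      "\<And>Q. Q \<in> \<Q> \<Longrightarrow> Q \<subseteq> span (?A \<union> (B \<inter> Q))"
      using less.hyps[of ?A] A_sub by (metis diff_less_mono2 order_less_le_trans subspace_span)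
    have ind: "independent (S \<union> insert x B) \<and> S \<inter> insert x B = {}"
      if S: "independent S" "S \<subseteq> A" for S
    proof -
      have "x \<notin> span S" using x A span_mono[OF S(2)] by blast
      then have "independent (insert x S)" using S(1) by (simp add: independent_insertI)
      moreover have "insert x S \<subseteq> ?A" using S(2) span_superset[of "insert x A"] by blast
      ultimately have "independent (insert x S \<union> B) \<and> insert x S \<inter> B = {}" by (rule B(2))
      then show ?thesis using x S(2) by auto
    qed
    have spn: "R \<subseteq> span (A \<union> (insert x B \<inter> R))" if R: "R \<in> \<Q>" for R
    proof (cases "R \<subseteq> A")
      case True
      then show ?thesis using span_superset[of "A \<union> (insert x B \<inter> R)"] by blast
    next
      case False
      then have xR: "x \<in> R" using least[of R] R x by blast
      let ?T = "A \<union> (insert x B \<inter> R)"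
      have "?A \<union> (B \<inter> R) \<subseteq> span ?T"
        using xR span_mono[of "insert x A" ?T] span_superset[of ?T] by auto
      then have "span (?A \<union> (B \<inter> R)) \<subseteq> span ?T" by (simp add: span_minimal)
      then show ?thesis using B(3)[OF R] by blast
    qed
    show ?thesis
      using B(1) Q x(1) ind spn by (intro exI[of _ "insert x B"]) auto
  qed
qed

text \<open>
  A pair \<open>(b, g)\<close> is a vector \<open>g\<close> born at position \<open>b\<close>. With \<open>P m j = D m \<inter> \<dots> \<inter> D j\<close> the vectors born at
  \<open>b\<close> that survive until \<open>j\<close> form a basis of \<open>P b j\<close> modulo \<open>P (b - 1) j\<close>, because
  \<open>P (b - 1) j\<close> is the intersection of \<open>P b j\<close> with the space \<open>D (b - 1) \<inter> D b\<close>, modulo which \<open>B b\<close> was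
  chosen. Summing over \<open>b \<le> m\<close> gives the basis of \<open>P m j\<close>. The second conclusion says that no vector is
  born that was there one step earlier.
\<close>

lemma (in vector_space) zigzag_basis:
  fixes D :: "nat \<Rightarrow> 'b set"
  assumes G: "finite G" and D: "\<And>n. subspace (D n)" "\<And>n. D n \<subseteq> span G"
  obtains B where
    "\<And>b. B b \<subseteq> D b"
    "\<And>b. B (Suc b) \<inter> D b = {}"
    "\<And>m j. m \<le> j \<Longrightarrow>
       inj_on snd {(b, g). b \<le> m \<and> g \<in> B b \<and> (\<forall>n\<in>{b..j}. g \<in> D n)} \<and>
       independent (snd ` {(b, g). b \<le> m \<and> g \<in> B b \<and> (\<forall>n\<in>{b..j}. g \<in> D n)}) \<and>
       span (snd ` {(b, g). b \<le> m \<and> g \<in> B b \<and> (\<forall>n\<in>{b..j}. g \<in> D n)}) = (\<Inter>n\<in>{m..j}. D n)"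
proof -
  define P where "P m j = (\<Inter>n\<in>{m..j}. D n)" for m j
  define A where "A b = (case b of 0 \<Rightarrow> {0} | Suc a \<Rightarrow> D a \<inter> D b)" for b
  have P: "subspace (P m j)" for m j unfolding P_def using D(1) by (intro subspace_Int)
  have A: "subspace (A b)" "A b \<subseteq> span G" for b
    using D span_zero by (auto simp: A_def subspace_inter split: nat.split)
  define R where "R b C \<longleftrightarrow> C \<subseteq> \<Union>{P b j | j. b \<le> j} \<and>
          (\<forall>S. independent S \<and> S \<subseteq> A b \<longrightarrow> independent (S \<union> C) \<and> S \<inter> C = {}) \<and>
          (\<forall>Q\<in>{P b j | j. b \<le> j}. Q \<subseteq> span (A b \<union> (C \<inter> Q)))" for b C
  have "\<forall>b. \<exists>C. R b C" unfolding R_def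
  proof (intro allI relative_basis_adapted_to_chain[OF G A])
    fix b
    show "subspace Q \<and> Q \<subseteq> span G" if "Q \<in> {P b j | j. b \<le> j}" for Q
    proof -
      obtain j where "Q = P b j" "b \<le> j" using \<open>Q \<in> _\<close> by blast
      then have "Q \<subseteq> D b" by (auto simp: P_def)
      then show ?thesis using P \<open>Q = P b j\<close> D(2) by blast
    qed
    show "Q \<subseteq> Q' \<or> Q' \<subseteq> Q" if Q: "Q \<in> {P b j | j. b \<le> j}" "Q' \<in> {P b j | j. b \<le> j}" for Q Q'
    proof -
      obtain j j' where "Q = P b j" "Q' = P b j'" using Q by blast
      moreover have "P b y \<subseteq> P b x" if "x \<le> y" for x y
        using that by (auto simp: P_def)
      ultimately show ?thesis using nat_le_linear[of j j'] by metis
    qed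
  qed
  then obtain B where R: "\<And>b. R b (B b)" by metis
  have B: "B b \<subseteq> \<Union>{P b j | j. b \<le> j}"
    "independent S \<Longrightarrow> S \<subseteq> A b \<Longrightarrow> independent (S \<union> B b) \<and> S \<inter> B b = {}"
    "b \<le> j \<Longrightarrow> P b j \<subseteq> span (A b \<union> (B b \<inter> P b j))" for b S j
    using R[of b] unfolding R_def by blast+
  have BD: "B b \<subseteq> D b" for b using B(1)[of b] by (force simp: P_def)
  have new: "B (Suc b) \<inter> D b = {}" for b
  proof (rule ccontr)
    assume "B (Suc b) \<inter> D b \<noteq> {}"
    then obtain g where g: "g \<in> B (Suc b)" "g \<in> A (Suc b)" using BD by (auto simp: A_def)
    have "independent (B (Suc b))" using B(2)[OF independent_empty, of "Suc b"] by simp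
    then have "g \<noteq> 0" using g dependent_zero by blast
    then have "{g} \<inter> B (Suc b) = {}" using B(2)[of "{g}"] g by auto
    then show False using g by simp
  qed
  define T where "T m j = {(b, g). b \<le> m \<and> g \<in> B b \<and> (\<forall>n\<in>{b..j}. g \<in> D n)}" for m j
  have main: "inj_on snd (T m j) \<and> independent (snd ` T m j) \<and> span (snd ` T m j) = P m j"
    if "m \<le> j" for m j
    using that
  proof (induction m)
    case 0
    have T: "T 0 j = {0} \<times> (B 0 \<inter> P 0 j)" by (auto simp: T_def P_def)
    have "P 0 j \<subseteq> span (insert 0 (B 0 \<inter> P 0 j))" using B(3)[of 0 j] by (simp add: A_def)
    moreover have "independent (B 0)" using B(2)[OF independent_empty, of 0] by simp
    ultimately show ?case
      using independent_mono[of "B 0" "B 0 \<inter> P 0 j"] span_minimal[OF _ P, of "B 0 \<inter> P 0 j" 0 j]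
      by (auto simp: T inj_on_def)
  next
    case (Suc m)
    let ?S = "snd ` T m j" and ?C = "B (Suc m) \<inter> P (Suc m) j"
    have T: "T (Suc m) j = T m j \<union> {Suc m} \<times> ?C"
      by (auto simp: T_def P_def le_Suc_eq)
    have IH: "inj_on snd (T m j)" "independent ?S" "span ?S = P m j"
      using Suc by auto
    have Pm: "P m j = D m \<inter> P (Suc m) j"
      using Suc.prems unfolding P_def by (auto simp: Ball_def le_eq_less_or_eq Suc_le_eq)
    have PD: "P (Suc m) j \<subseteq> D (Suc m)" using Suc.prems by (auto simp: P_def)
    have S_sub: "?S \<subseteq> P m j" using span_superset[of ?S] IH(3) by simp
    then have "?S \<subseteq> A (Suc m)" using Pm PD by (auto simp: A_def)
    then have *: "independent (?S \<union> B (Suc m))" "?S \<inter> B (Suc m) = {}"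
      using B(2)[OF IH(2)] by auto
    have "inj_on snd (T (Suc m) j)"
      unfolding T using IH(1) *(2) by (intro inj_on_Un[THEN iffD2]) (auto simp: inj_on_def)
    moreover have "independent (snd ` T (Suc m) j)"
      unfolding T by (rule independent_mono[OF *(1)]) auto
    moreover have "span (snd ` T (Suc m) j) = P (Suc m) j"
    proof (rule span_subspace[OF _ _ P])
      show "snd ` T (Suc m) j \<subseteq> P (Suc m) j" using S_sub Pm unfolding T by auto
      show "P (Suc m) j \<subseteq> span (snd ` T (Suc m) j)"
      proof
        fix q assume q: "q \<in> P (Suc m) j"
        then have "q \<in> span (A (Suc m) \<union> ?C)" using B(3) Suc.prems by blast
        \<comment> \<open>Split off the vectors born at \<open>Suc m\<close>; what remains lies in \<open>P m j\<close>.\<close>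
        then obtain a w where aw: "q = a + w" "a \<in> span (A (Suc m))" "w \<in> span ?C"
          unfolding span_Un by blast
        have "span (A (Suc m)) = A (Suc m)" using A(1) by (simp only: span_eq_iff)
        then have "a \<in> A (Suc m)" using aw(2) by (simp only:)
        then have a: "a \<in> D m" by (simp add: A_def)
        have "w \<in> P (Suc m) j" using aw(3) span_minimal[OF _ P, of ?C "Suc m" j] by blast
        then have "a \<in> P (Suc m) j" using aw(1) q subspace_diff[OF P, of q "Suc m" j w] by simp
        then have "a \<in> span ?S" using a Pm IH(3) by blast
        moreover have "span ?S \<subseteq> span (snd ` T (Suc m) j)" "span ?C \<subseteq> span (snd ` T (Suc m) j)"
          by (rule span_mono; force simp: T)+
        ultimately show "q \<in> span (snd ` T (Suc m) j)" using aw(1,3) span_add by blast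
      qed
    qed
    ultimately show ?case by blast
  qed
  show ?thesis
    using that[of B, OF BD new] main unfolding T_def P_def by blast
qed

section \<open>Free spaces and multisets of intervals\<close>

definition fscale :: "'f::field \<Rightarrow> ('a \<Rightarrow> 'f) \<Rightarrow> 'a \<Rightarrow> 'f" where
  "fscale r x = (\<lambda>a. r * x a)"

interpretation fs: vector_space fscale
  by unfold_locales (auto simp: fscale_def fun_eq_iff algebra_simps)

text \<open>
  Rewriting sums of functions pointwise by default would hide them from the lemmas on vector spaces.
\<close>

declare plus_fun_apply [simp del] zero_fun_apply [simp del]

lemma fscale_apply: "fscale r x a = r * x a"
  by (simp add: fscale_def)

lemmas pointwise = fun_eq_iff plus_fun_apply zero_fun_apply fscale_apply

lemma sum_fun_apply: "(\<Sum>i\<in>I. f i) a = (\<Sum>i\<in>I. f i a)"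
  by (induction I rule: infinite_finite_induct) (auto simp: pointwise)

lemma mem_free_space: "finite S \<Longrightarrow> x \<in> free_space S \<longleftrightarrow> (\<forall>a. a \<notin> S \<longrightarrow> x a = 0)"
  unfolding free_space_def by (auto intro: finite_subset[of "{a. x a \<noteq> 0}" S])

lemma free_spaceD: "x \<in> free_space S \<Longrightarrow> a \<notin> S \<Longrightarrow> x a = 0"
  unfolding free_space_def by auto

lemma free_space_mono: "S \<subseteq> T \<Longrightarrow> free_space S \<subseteq> free_space T"
  unfolding free_space_def by auto

lemma free_space_empty: "free_space {} = {\<lambda>_. 0}"
  unfolding free_space_def by auto

lemma linear_between_iff:
  "linear_between V W f \<longleftrightarrow>
     f ` V \<subseteq> W \<and> (\<forall>x\<in>V. \<forall>y\<in>V. f (x + y) = f x + f y) \<and> (\<forall>r. \<forall>x\<in>V. f (fscale r x) = fscale r (f x))"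
  by (simp add: linear_between_def plus_fun_def fscale_def)

lemma subspace_free_space: "fs.subspace (free_space S :: ('a \<Rightarrow> 'f::field) set)"
proof (rule fs.subspaceI)
  fix x y :: "'a \<Rightarrow> 'f" assume xy: "x \<in> free_space S" "y \<in> free_space S"
  have "{a. x a + y a \<noteq> 0} \<subseteq> {a. x a \<noteq> 0} \<union> {a. y a \<noteq> 0}" by auto
  then show "x + y \<in> free_space S"
    using xy unfolding free_space_def mem_Collect_eq plus_fun_apply
    by (meson Un_least finite_Un finite_subset subset_trans)
next
  fix c and x :: "'a \<Rightarrow> 'f" assume "x \<in> free_space S"
  then show "fscale c x \<in> free_space S"
    unfolding free_space_def by (auto simp: pointwise)
qed (simp add: free_space_def pointwise)

lemma linear_between_sum:
  assumes f: "linear_between V W f" and V: "fs.subspace V"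
    and "\<And>i. i \<in> I \<Longrightarrow> x i \<in> V"
  shows "f (\<Sum>i\<in>I. x i) = (\<Sum>i\<in>I. f (x i))"
proof -
  have "f (fscale 0 0) = fscale 0 (f 0)"
    using f fs.subspace_0[OF V] unfolding linear_between_iff by blast
  then have 0: "f 0 = 0" by simp
  show ?thesis
    using assms(3)
  proof (induction I rule: infinite_finite_induct)
    case (insert i I)
    then have "f (x i + (\<Sum>i\<in>I. x i)) = f (x i) + f (\<Sum>i\<in>I. x i)"
      using f fs.subspace_sum[OF V, of I x] unfolding linear_between_iff by blast
    then show ?case using insert by simp
  qed (simp_all add: 0)
qed

lemma linear_between_compose:
  "linear_between U V f \<Longrightarrow> linear_between V W g \<Longrightarrow> linear_between U W (\<lambda>x. g (f x))"
  unfolding linear_between_iff by (auto simp: image_subset_iff)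

lemma linear_between_subspace:
  "linear_between V W f \<Longrightarrow> U \<subseteq> V \<Longrightarrow> linear_between U W f"
  unfolding linear_between_iff by (meson image_mono subset_iff subset_trans)

lemma linear_between_inverse:
  assumes "linear_between V W f" "bij_betw f V W" "fs.subspace V"
  shows "linear_between W V (the_inv_into V f)"
proof -
  have inj: "inj_on f V" and im: "f ` V = W" using assms(2) by (auto simp: bij_betw_def)
  have "the_inv_into V f (f x + f y) = x + y" if "x \<in> V" "y \<in> V" for x y
    using assms(1,3) that the_inv_into_f_f[OF inj, of "x + y"] fs.subspace_add
    unfolding linear_between_iff by metis
  moreover have "the_inv_into V f (fscale r (f x)) = fscale r x" if "x \<in> V" for x r
    using assms(1,3) that the_inv_into_f_f[OF inj, of "fscale r x"] fs.subspace_scale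
    unfolding linear_between_iff by metis
  ultimately show ?thesis
    unfolding linear_between_iff im[symmetric] by (auto simp: the_inv_into_f_f[OF inj])
qed

lemma linear_between_restrict:
  assumes "T \<subseteq> U"
  shows "linear_between (free_space U :: ('i \<Rightarrow> 'f::field) set) (free_space T) (\<lambda>x i. if i \<in> T then x i else 0)"
proof -
  have "(\<lambda>i. if i \<in> T then x i else 0) \<in> free_space T" if "x \<in> free_space U" for x :: "'i \<Rightarrow> 'f"
    using that unfolding free_space_def
    by (auto intro: finite_subset[of _ "{a. x a \<noteq> 0}"])
  then show ?thesis unfolding linear_between_iff by (auto simp: pointwise)
qed

text \<open>
  Maps are only known to be linear on the given subspaces, so the dimension count goes through the
  images of the standard basis.
\<close>

lemma card_le_if_injective_linear:
  fixes h :: "('a \<Rightarrow> 'f::field) \<Rightarrow> ('b \<Rightarrow> 'f)"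
  assumes fin: "finite S" "finite T" and h: "linear_between (free_space S) (free_space T) h"
    and ker: "\<And>x. x \<in> free_space S \<Longrightarrow> h x = 0 \<Longrightarrow> x = 0"
  shows "card S \<le> card T"
proof -
  define e :: "'a \<Rightarrow> 'a \<Rightarrow> 'f" where "e a = (\<lambda>c. if c = a then 1 else 0)" for a
  define d :: "'b \<Rightarrow> 'b \<Rightarrow> 'f" where "d a = (\<lambda>c. if c = a then 1 else 0)" for a
  have e: "e a \<in> free_space S" if "a \<in> S" for a
    using that fin by (auto simp: mem_free_space e_def)
  have comb: "u a = 0" if u: "(\<Sum>a\<in>S. fscale (u a) (h (e a))) = 0" and a: "a \<in> S" for u a
  proof -
    have e': "fscale (u a) (e a) \<in> free_space S" if "a \<in> S" for a
      using that e fs.subspace_scale[OF subspace_free_space] by blast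
    have "h (\<Sum>a\<in>S. fscale (u a) (e a)) = (\<Sum>a\<in>S. h (fscale (u a) (e a)))"
      by (rule linear_between_sum[OF h subspace_free_space e'])
    also have "\<dots> = 0" using u e h by (simp add: linear_between_iff)
    finally have "h (\<Sum>a\<in>S. fscale (u a) (e a)) = 0" .
    moreover have "(\<Sum>a\<in>S. fscale (u a) (e a)) \<in> free_space S"
      by (intro fs.subspace_sum subspace_free_space e')
    ultimately have "(\<Sum>a\<in>S. fscale (u a) (e a)) = 0" by (intro ker)
    then have "(\<Sum>c\<in>S. fscale (u c) (e c)) a = 0" by (simp only: zero_fun_apply)
    moreover have "(\<Sum>c\<in>S. fscale (u c) (e c)) a = (\<Sum>c\<in>S. if c = a then u c else 0)"
      by (simp only: sum_fun_apply) (rule sum.cong, auto simp: e_def fscale_apply)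
    ultimately show ?thesis using a fin by simp
  qed
  have inj: "inj_on (\<lambda>a. h (e a)) S"
  proof (rule inj_onI)
    fix a c assume ac: "a \<in> S" "c \<in> S" "h (e a) = h (e c)"
    show "a = c"
    proof (rule ccontr)
      assume "a \<noteq> c"
      define u where "u x = (if x = a then 1 else if x = c then -1 else 0 :: 'f)" for x
      have "(\<Sum>x\<in>S. fscale (u x) (h (e x))) = (\<Sum>x\<in>{a, c}. fscale (u x) (h (e x)))"
        using ac fin by (intro sum.mono_neutral_right) (auto simp: u_def)
      also have "\<dots> = 0" using \<open>a \<noteq> c\<close> ac(3) by (simp add: u_def pointwise)
      finally show False using comb[of u a] ac(1) by (simp add: u_def)
    qed
  qed
  have "fs.independent ((\<lambda>a. h (e a)) ` S)"
  proof (rule fs.independent_if_scalars_zero)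
    fix f :: "('b \<Rightarrow> 'f) \<Rightarrow> 'f" and x
    assume "(\<Sum>x\<in>(\<lambda>a. h (e a)) ` S. fscale (f x) x) = 0" "x \<in> (\<lambda>a. h (e a)) ` S"
    then show "f x = 0" using comb[of "\<lambda>a. f (h (e a))"] by (auto simp: sum.reindex[OF inj])
  qed (use fin in simp)
  moreover have "(\<lambda>a. h (e a)) ` S \<subseteq> fs.span (d ` T)"
  proof
    fix y assume "y \<in> (\<lambda>a. h (e a)) ` S"
    then have "y \<in> free_space T" using e h by (auto simp: linear_between_iff)
    then have "y = (\<Sum>c\<in>T. fscale (y c) (d c))"
      using fin(2) by (auto simp: pointwise sum_fun_apply d_def mem_free_space if_distrib cong: if_cong)
    moreover have "(\<Sum>c\<in>T. fscale (y c) (d c)) \<in> fs.span (d ` T)"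
      by (intro fs.span_sum fs.span_scale fs.span_base) auto
    ultimately show "y \<in> fs.span (d ` T)" by simp
  qed
  ultimately have "card ((\<lambda>a. h (e a)) ` S) \<le> card (d ` T)"
    using fs.independent_span_bound fin by blast
  then show ?thesis using card_image[OF inj] card_image_le[OF fin(2), of d] by linarith
qed

lemma free_space_reindex:
  fixes \<gamma> :: "'b \<Rightarrow> 'a" and A B
  defines "\<rho> \<equiv> \<lambda>(x :: 'a \<Rightarrow> 'f::field) b. if b \<in> B then x (\<gamma> b) else 0"
  assumes bij: "bij_betw \<gamma> B A" and fin: "finite A"
  shows "linear_between (free_space A) (free_space B) \<rho>"
    and "bij_betw \<rho> (free_space A) (free_space B)"
proof -
  have finB: "finite B" using bij fin bij_betw_finite by blast
  have inv: "the_inv_into B \<gamma> (\<gamma> b) = b" "\<gamma> b \<in> A" if "b \<in> B" for b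
    using bij that by (auto simp: bij_betw_def the_inv_into_f_f)
  have inv': "\<gamma> (the_inv_into B \<gamma> a) = a" "the_inv_into B \<gamma> a \<in> B" if "a \<in> A" for a
    using bij that by (auto simp: bij_betw_def f_the_inv_into_f the_inv_into_into)
  show "linear_between (free_space A) (free_space B) \<rho>"
    unfolding linear_between_iff \<rho>_def using finB by (auto simp: mem_free_space pointwise)
  show "bij_betw \<rho> (free_space A) (free_space B)"
  proof (rule bij_betw_byWitness[where f' = "\<lambda>y a. if a \<in> A then y (the_inv_into B \<gamma> a) else 0"])
    show "\<forall>x\<in>free_space A. (\<lambda>a. if a \<in> A then \<rho> x (the_inv_into B \<gamma> a) else 0) = x"
      using inv' fin by (auto simp: \<rho>_def fun_eq_iff mem_free_space)
    show "\<forall>y\<in>free_space B. \<rho> (\<lambda>a. if a \<in> A then y (the_inv_into B \<gamma> a) else 0) = y"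
      using inv finB by (auto simp: \<rho>_def fun_eq_iff mem_free_space)
  qed (use fin finB in \<open>auto simp: \<rho>_def mem_free_space\<close>)
qed

text \<open>
  Passing from a family of sets to the multiset of its members loses the index; a bijection with the
  copies recovers it.
\<close>

lemma family_bij_copies:
  assumes "\<And>R. finite {i \<in> S. f i = R}"
  obtains \<beta> where "bij_betw \<beta> S (copies (\<lambda>R. card {i \<in> S. f i = R}))"
    "\<And>i. i \<in> S \<Longrightarrow> fst (\<beta> i) = f i"
proof -
  have "\<exists>h. bij_betw h {i \<in> S. f i = R} {0..<card {i \<in> S. f i = R}}" for R
    using ex_bij_betw_finite_nat[OF assms] .
  then obtain h where h: "\<And>R. bij_betw (h R) {i \<in> S. f i = R} {0..<card {i \<in> S. f i = R}}"
    by metis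
  have "bij_betw (\<lambda>i. (f i, h (f i) i)) S (copies (\<lambda>R. card {i \<in> S. f i = R}))"
  proof (rule bij_betw_imageI)
    show "inj_on (\<lambda>i. (f i, h (f i) i)) S"
      using h by (auto simp: inj_on_def bij_betw_def)
    show "(\<lambda>i. (f i, h (f i) i)) ` S = copies (\<lambda>R. card {i \<in> S. f i = R})"
    proof (intro equalityI subsetI)
      fix p assume "p \<in> (\<lambda>i. (f i, h (f i) i)) ` S"
      then obtain i where i: "i \<in> S" "p = (f i, h (f i) i)" by blast
      then have "h (f i) i \<in> {0..<card {j \<in> S. f j = f i}}"
        using bij_betw_apply[OF h[of "f i"], of i] by simp
      then show "p \<in> copies (\<lambda>R. card {i \<in> S. f i = R})" using i by (simp add: copies_def)
    next
      fix p assume "p \<in> copies (\<lambda>R. card {i \<in> S. f i = R})"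
      then obtain R n where p: "p = (R, n)" "n < card {i \<in> S. f i = R}" by (auto simp: copies_def)
      then have "n \<in> h R ` {i \<in> S. f i = R}" using h[of R] by (simp add: bij_betw_def)
      then show "p \<in> (\<lambda>i. (f i, h (f i) i)) ` S" using p by auto
    qed
  qed
  then show ?thesis using that by auto
qed

lemma card_copies_sum:
  assumes "finite T" "\<And>R. D R > 0 \<Longrightarrow> x \<in> R \<Longrightarrow> y \<in> R \<Longrightarrow> R \<in> T"
  shows "card {p \<in> copies D. x \<in> fst p \<and> y \<in> fst p} = (\<Sum>R | R \<in> T \<and> x \<in> R \<and> y \<in> R. D R)"
proof -
  have "{p \<in> copies D. x \<in> fst p \<and> y \<in> fst p} = (SIGMA R:{R \<in> T. x \<in> R \<and> y \<in> R}. {..<D R})"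
    using assms(2) by (force simp: copies_def)
  then show ?thesis using assms(1) by simp
qed

text \<open>
  Among the intervals whose multiplicities differ, take a maximal one, \<open>R\<close>. Only finitely many
  intervals matter near a point of \<open>R\<close>, so there is \<open>[a, b] \<subseteq> R\<close> that is contained in just those of them
  that contain \<open>R\<close>. Their total multiplicity agrees, and so do the single multiplicities
  of all but \<open>R\<close>.
\<close>

lemma interval_multiset_determined_by_counts:
  fixes D D' :: "real set \<Rightarrow> nat"
  assumes ivl: "\<And>R. D R > 0 \<or> D' R > 0 \<Longrightarrow> R \<noteq> {} \<and> is_interval R"
    and fin: "\<And>t. finite {p \<in> copies D. t \<in> fst p}" "\<And>t. finite {p \<in> copies D'. t \<in> fst p}"
    and eq: "\<And>a b. a \<le> b \<Longrightarrow> card {p \<in> copies D. a \<in> fst p \<and> b \<in> fst p} =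
                                  card {p \<in> copies D'. a \<in> fst p \<and> b \<in> fst p}"
  shows "D = D'"
proof (rule ccontr)
  assume "D \<noteq> D'"
  then obtain R0 where R0: "D R0 \<noteq> D' R0" by blast
  then have "D R0 > 0 \<or> D' R0 > 0" by linarith
  then have "R0 \<noteq> {}" using ivl by simp
  then obtain t where t: "t \<in> R0" by (meson ex_in_conv)
  define T where "T = {R. t \<in> R \<and> (D R > 0 \<or> D' R > 0)}"
  have "T \<subseteq> fst ` {p \<in> copies D. t \<in> fst p} \<union> fst ` {p \<in> copies D'. t \<in> fst p}"
  proof
    fix R assume "R \<in> T"
    then have "(R, 0) \<in> {p \<in> copies D. t \<in> fst p} \<union> {p \<in> copies D'. t \<in> fst p}"
      by (auto simp: T_def copies_def)
    then show "R \<in> fst ` {p \<in> copies D. t \<in> fst p} \<union> fst ` {p \<in> copies D'. t \<in> fst p}"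
      unfolding image_Un[symmetric] by (rule image_eqI[rotated]) simp
  qed
  then have T: "finite T" using fin by (meson finite_UnI finite_imageI finite_subset)
  let ?W = "{R \<in> T. D R \<noteq> D' R}"
  have "R0 \<in> ?W" using R0 t \<open>D R0 > 0 \<or> D' R0 > 0\<close> by (simp add: T_def)
  then obtain R where R: "R \<in> T" "D R \<noteq> D' R" and max: "\<And>J. J \<in> ?W \<Longrightarrow> R \<subseteq> J \<Longrightarrow> R = J"
    using finite_has_maximal[of ?W] T by auto
  \<comment> \<open>Finitely many points of \<open>R\<close> suffice to tell the members of \<open>T\<close> that contain \<open>R\<close> from the others.\<close>
  obtain pt where pt: "\<And>J. \<not> R \<subseteq> J \<Longrightarrow> pt J \<in> R - J"
    by (metis DiffI subsetI)
  define F where "F = insert t (pt ` {J \<in> T. \<not> R \<subseteq> J})"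
  define a b where "a = Min F" and "b = Max F"
  have "t \<in> R" using R(1) by (simp add: T_def)
  then have F: "finite F" "F \<noteq> {}" "F \<subseteq> R" "t \<in> F" using T pt by (auto simp: F_def)
  then have ab: "a \<in> R" "b \<in> R" "a \<le> t" "t \<le> b"
    unfolding a_def b_def using Min_in[of F] Max_in[of F] by (auto simp: subset_iff)
  have between: "c \<in> J" if "J \<in> T \<or> D J > 0 \<or> D' J > 0" "a \<in> J" "b \<in> J" "a \<le> c" "c \<le> b" for J c
    using that ivl[of J] unfolding is_interval_1 T_def by blast
  have T_ab: "R' \<in> T" if "D R' > 0 \<or> D' R' > 0" "a \<in> R'" "b \<in> R'" for R'
    using between[of R' t] that ab by (auto simp: T_def)
  have ab_iff: "{J \<in> T. a \<in> J \<and> b \<in> J} = {J \<in> T. R \<subseteq> J}"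
  proof (intro Collect_cong conj_cong refl iffI)
    fix J assume J: "J \<in> T" "a \<in> J \<and> b \<in> J"
    show "R \<subseteq> J"
    proof (rule ccontr)
      assume n: "\<not> R \<subseteq> J"
      then have "pt J \<in> F" using J(1) by (simp add: F_def)
      then have "a \<le> pt J" "pt J \<le> b" using F(1) by (simp_all add: a_def b_def)
      then have "pt J \<in> J" using between J by blast
      then show False using pt[OF n] by blast
    qed
  next
    fix J assume "R \<subseteq> J"
    then show "a \<in> J \<and> b \<in> J" using ab by auto
  qed
  have "card {p \<in> copies D. a \<in> fst p \<and> b \<in> fst p} = (\<Sum>J | J \<in> T \<and> a \<in> J \<and> b \<in> J. D J)"
    using T_ab by (intro card_copies_sum T) simp
  moreover have "card {p \<in> copies D'. a \<in> fst p \<and> b \<in> fst p} = (\<Sum>J | J \<in> T \<and> a \<in> J \<and> b \<in> J. D' J)"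
    using T_ab by (intro card_copies_sum T) simp
  ultimately have total: "(\<Sum>J | J \<in> T \<and> R \<subseteq> J. D J) = (\<Sum>J | J \<in> T \<and> R \<subseteq> J. D' J)"
    using eq[of a b] ab unfolding ab_iff by linarith
  have rest: "(\<Sum>J\<in>{J \<in> T. R \<subseteq> J} - {R}. D J) = (\<Sum>J\<in>{J \<in> T. R \<subseteq> J} - {R}. D' J)"
  proof (rule sum.cong[OF refl])
    fix J assume "J \<in> {J \<in> T. R \<subseteq> J} - {R}"
    then show "D J = D' J" using max[of J] by blast
  qed
  have "finite {J \<in> T. R \<subseteq> J}" "R \<in> {J \<in> T. R \<subseteq> J}" using T R(1) by auto
  then have "D R = D' R"
    using total rest sum.remove[of "{J \<in> T. R \<subseteq> J}" R D] sum.remove[of "{J \<in> T. R \<subseteq> J}" R D']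
    by linarith
  then show False using R(2) by simp
qed

section \<open>Positions of real times among the knots\<close>

locale knot_sequence =
  fixes c :: "int \<Rightarrow> real"
  assumes mono: "strict_mono c"
    and top: "filterlim c at_top at_top"
    and bot: "filterlim c at_bot at_bot"

text \<open>
  The position in \<open>K\<close> that represents the time \<open>t\<close>: the knot \<open>c i\<close> itself has position \<open>2 i\<close>, and all
  times strictly between \<open>c i\<close> and \<open>c (i + 1)\<close> share the position \<open>2 i + 1\<close> of the sample \<open>s i\<close>.
\<close>

definition pos :: "(int \<Rightarrow> real) \<Rightarrow> real \<Rightarrow> int" where
  "pos c t = (let i = THE i. c i \<le> t \<and> t < c (i + 1) in if t = c i then 2 * i else 2 * i + 1)"

lemma pos_shift: "pos (\<lambda>i. c i + d) t = pos c (t - d)"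
proof -
  have "(c i + d \<le> t \<and> t < c (i + 1) + d) = (c i \<le> t - d \<and> t - d < c (i + 1))" for i by auto
  then have "(THE i. c i + d \<le> t \<and> t < c (i + 1) + d) = (THE i. c i \<le> t - d \<and> t - d < c (i + 1))"
    by presburger
  then show ?thesis unfolding pos_def Let_def by auto
qed

lemma knot_even: "knot c s (2 * i) = c i" and knot_odd: "knot c s (2 * i + 1) = s i"
  by (simp_all add: knot_def)

context knot_sequence
begin

lemma cell_unique: "\<exists>!i. c i \<le> t \<and> t < c (i + 1)"
proof -
  have "\<forall>\<^sub>F i in at_bot. c i \<le> t" using bot by (simp add: filterlim_at_bot)
  then obtain n where n: "c n \<le> t" by (auto simp: eventually_at_bot_linorder)
  have "\<forall>\<^sub>F i in at_top. c i > t" using top by (simp add: filterlim_at_top_dense)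
  then obtain m where m: "\<And>i. i \<ge> m \<Longrightarrow> c i > t" by (auto simp: eventually_at_top_linorder)
  have "\<exists>i. c i \<le> t \<and> t < c (i + 1)"
  proof (rule ccontr)
    assume none: "\<not> ?thesis"
    have "c i \<le> t" if "n \<le> i" for i
      using that
    proof (induction i rule: int_ge_induct)
      case (step i)
      then show ?case using none by (meson not_le)
    qed (rule n)
    from this[of "max n m"] m[of "max n m"] show False by simp
  qed
  moreover have "i = j" if "c i \<le> t \<and> t < c (i + 1)" "c j \<le> t \<and> t < c (j + 1)" for i j
  proof -
    have "c i < c (j + 1)" "c j < c (i + 1)" using that by auto
    then have "i < j + 1" "j < i + 1" using mono by (simp_all add: strict_mono_less)
    then show ?thesis by simp
  qed
  ultimately show ?thesis by blast
qed

lemma even_le_pos: "2 * i \<le> pos c t \<longleftrightarrow> c i \<le> t"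
  and odd_le_pos: "2 * i + 1 \<le> pos c t \<longleftrightarrow> c i < t"
proof -
  define j where "j = (THE i. c i \<le> t \<and> t < c (i + 1))"
  have j: "c j \<le> t" "t < c (j + 1)" using theI'[OF cell_unique[of t]] by (auto simp: j_def)
  have p: "pos c t = (if t = c j then 2 * j else 2 * j + 1)" by (simp add: pos_def Let_def j_def)
  have le: "c i \<le> t \<longleftrightarrow> i \<le> j"
  proof
    assume "c i \<le> t"
    then have "c i < c (j + 1)" using j by simp
    then show "i \<le> j" using mono by (simp add: strict_mono_less)
  next
    assume "i \<le> j"
    then have "c i \<le> c j" using mono by (simp add: strict_mono_less_eq)
    then show "c i \<le> t" using j by simp
  qed
  then show "2 * i \<le> pos c t \<longleftrightarrow> c i \<le> t" unfolding p by auto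
  show "2 * i + 1 \<le> pos c t \<longleftrightarrow> c i < t"
  proof (cases "t = c j")
    case True
    then show ?thesis using mono p by (simp add: strict_mono_less) linarith
  next
    case False
    then have "c i < t \<longleftrightarrow> c i \<le> t" using le[of ] j mono by (auto simp: strict_mono_less le_less strict_mono_eq)
    then show ?thesis using le p False by auto
  qed
qed

lemma le_pos_iff: "k \<le> pos c t \<longleftrightarrow> (if even k then c (k div 2) \<le> t else c (k div 2) < t)"
  using even_le_pos[of "k div 2" t] odd_le_pos[of "k div 2" t] by auto

lemma pos_mono: "t \<le> u \<Longrightarrow> pos c t \<le> pos c u"
  using le_pos_iff[of "pos c t" t] le_pos_iff[of "pos c t" u] by (auto split: if_splits)

lemma pos_refine:
  assumes "knot_sequence c'" "range c \<subseteq> range c'" "pos c' t = pos c' u"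
  shows "pos c t = pos c u"
proof -
  interpret c': knot_sequence c' by fact
  have "k \<le> pos c t \<longleftrightarrow> k \<le> pos c u" for k
  proof -
    obtain j where j: "c (k div 2) = c' j" using assms(2) by auto
    show ?thesis
      unfolding le_pos_iff j using c'.even_le_pos[of j] c'.odd_le_pos[of j] assms(3) by metis
  qed
  then show ?thesis by (meson order_antisym order_refl)
qed

text \<open>
  Arrows of the zigzag are the passages to a limit: times near \<open>t\<close> have the position of \<open>t\<close> or the
  source of an arrow into it.
\<close>

lemma eventually_pos:
  "\<forall>\<^sub>F s in nhds t. pos c s = pos c t \<or> zigzag_arrow (pos c s) (pos c t)"
proof (cases "even (pos c t)")
  case True
  then obtain i where i: "pos c t = 2 * i" by blast
  then have t: "c i = t" using even_le_pos[of i t] odd_le_pos[of i t] by auto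
  have "c (i - 1) < t" "t < c (i + 1)" using t mono by (auto simp: strict_mono_less)
  then have "\<forall>\<^sub>F s in nhds t. s \<in> {c (i - 1)<..<c (i + 1)}"
    by (intro eventually_nhds_in_open) auto
  then show ?thesis
  proof eventually_elim
    case (elim s)
    then have "2 * (i - 1) + 1 \<le> pos c s" "\<not> 2 * (i + 1) \<le> pos c s"
      unfolding even_le_pos odd_le_pos by auto
    then have "pos c s = 2 * i - 1 \<or> pos c s = 2 * i \<or> pos c s = 2 * i + 1" by auto
    then show ?case using i by (auto simp: zigzag_arrow_def)
  qed
next
  case False
  then obtain i where i: "pos c t = 2 * i + 1" by (metis oddE)
  then have "c i < t" "\<not> c (i + 1) \<le> t" using odd_le_pos[of i t] even_le_pos[of "i + 1" t] by auto
  then have "\<forall>\<^sub>F s in nhds t. s \<in> {c i<..<c (i + 1)}"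
    by (intro eventually_nhds_in_open) auto
  then show ?thesis
  proof eventually_elim
    case (elim s)
    then have "2 * i + 1 \<le> pos c s" "\<not> 2 * (i + 1) \<le> pos c s"
      unfolding even_le_pos odd_le_pos by auto
    then show ?case using i by auto
  qed
qed

text \<open>
  The case distinction between open and closed ends in the definition of the barcode disappears when
  it is read through \<^const>\<open>pos\<close>.
\<close>

lemma real_interval_eq:
  assumes "int_interval J"
  shows "real_interval c J = {t. pos c t \<in> J}"
proof -
  have lower: "t \<in> lower_ray c J \<longleftrightarrow> (\<exists>j\<in>J. j \<le> pos c t)" for t
  proof (cases "bdd_below J")
    case True
    obtain x where x: "x \<in> J" "x < Inf J + 1"
      using cInf_lessD[of J "Inf J + 1"] assms by (auto simp: int_interval_def)
    then have "x = Inf J" using cInf_lower[OF _ True, of x] by linarith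
    then have "Inf J \<in> J" using x by simp
    then have "(\<exists>j\<in>J. j \<le> pos c t) \<longleftrightarrow> Inf J \<le> pos c t" using cInf_lower[OF _ True] by (meson order_trans)
    then show ?thesis using True by (simp add: lower_ray_def le_pos_iff)
  next
    case False
    then show ?thesis by (auto simp: lower_ray_def bdd_below_def) (meson linear)
  qed
  have upper: "t \<in> upper_ray c J \<longleftrightarrow> (\<exists>j\<in>J. pos c t \<le> j)" for t
  proof (cases "bdd_above J")
    case True
    obtain x where x: "x \<in> J" "Sup J - 1 < x"
      using less_cSupE[of "Sup J - 1" J] assms by (auto simp: int_interval_def)
    then have "x = Sup J" using cSup_upper[OF _ True, of x] by linarith
    then have "Sup J \<in> J" using x by simp
    then have "(\<exists>j\<in>J. pos c t \<le> j) \<longleftrightarrow> pos c t \<le> Sup J"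
      using cSup_upper[OF _ True] by (meson order_trans)
    then have "(\<exists>j\<in>J. pos c t \<le> j) \<longleftrightarrow> \<not> Sup J + 1 \<le> pos c t" by linarith
    moreover have "(Sup J + 1) div 2 = (if even (Sup J) then Sup J div 2 else Sup J div 2 + 1)" by auto
    ultimately show ?thesis using True by (auto simp: upper_ray_def le_pos_iff)
  next
    case False
    then show ?thesis by (auto simp: upper_ray_def bdd_above_def) (meson linear)
  qed
  have "(\<exists>j\<in>J. j \<le> p) \<and> (\<exists>j\<in>J. p \<le> j) \<longleftrightarrow> p \<in> J" for p
    using assms unfolding int_interval_def by (meson atLeastAtMost_iff order_refl subsetD)
  then show ?thesis
    unfolding real_interval_def using lower upper by blast
qed

end

locale knots_with_samples = knot_sequence +
  fixes s :: "int \<Rightarrow> real"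
  assumes sample: "c i < s i" "s i < c (i + 1)"
begin

lemma pos_knot [simp]: "pos c (knot c s k) = k"
proof (cases "even k")
  case True
  then obtain i where k: "k = 2 * i" by blast
  then show ?thesis using even_le_pos[of i "c i"] odd_le_pos[of i "c i"] by (simp add: knot_even)
next
  case False
  then obtain i where k: "k = 2 * i + 1" by (metis oddE)
  have "2 * i + 1 \<le> pos c (s i)" "\<not> 2 * (i + 1) \<le> pos c (s i)"
    unfolding even_le_pos odd_le_pos using sample[of i] by auto
  then show ?thesis unfolding k knot_odd by simp
qed

lemma knot_mono: "k \<le> l \<Longrightarrow> knot c s k \<le> knot c s l"
  using pos_mono[of "knot c s l" "knot c s k"] by (metis nle_le order_antisym pos_knot)

lemma inj_on_real_interval: "inj_on (real_interval c) {J. int_interval J}"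
proof (rule inj_onI)
  fix I J assume "I \<in> {J. int_interval J}" "J \<in> {J. int_interval J}" "real_interval c I = real_interval c J"
  then have "{t. pos c t \<in> I} = {t. pos c t \<in> J}" by (simp add: real_interval_eq)
  then have "k \<in> I \<longleftrightarrow> k \<in> J" for k using pos_knot[of k] by (metis mem_Collect_eq)
  then show "I = J" by blast
qed

text \<open>
  Converse to \<open>eventually_pos\<close>: the source of every arrow is the position of times arbitrarily close to
  its target, so local statements about real times yield statements about arrows.
\<close>

lemma exists_near_knot:
  assumes "zigzag_arrow k l" "\<forall>\<^sub>F t in nhds (knot c s l). Q t"
  shows "\<exists>t. pos c t = k \<and> Q t"
proof -
  obtain i where k: "k = 2 * i + 1" using assms(1) by (auto simp: zigzag_arrow_def elim: oddE)
  have less: "c i < c (i + 1)" using mono by (simp add: strict_mono_less)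
  have pos: "pos c t = k" if "c i < t" "t < c (i + 1)" for t
    using that odd_le_pos[of i t] even_le_pos[of "i + 1" t] k by auto
  consider "l = 2 * i" | "l = 2 * (i + 1)" using assms(1) k by (auto simp: zigzag_arrow_def)
  then show ?thesis
  proof cases
    case 1
    then have "\<forall>\<^sub>F t in at_right (c i). Q t"
      using assms(2) knot_even[of c s i] by (simp add: eventually_nhds_conv_at eventually_at_split)
    moreover have "\<forall>\<^sub>F t in at_right (c i). t \<in> {c i<..<c (i + 1)}"
      using less by (rule eventually_at_right_real)
    ultimately have "\<forall>\<^sub>F t in at_right (c i). pos c t = k \<and> Q t"
      by eventually_elim (use pos in auto)
    then show ?thesis by (rule eventually_happens'[rotated]) simp
  next
    case 2
    then have "\<forall>\<^sub>F t in at_left (c (i + 1)). Q t"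
      using assms(2) knot_even[of c s "i + 1"] by (simp add: eventually_nhds_conv_at eventually_at_split)
    moreover have "\<forall>\<^sub>F t in at_left (c (i + 1)). t \<in> {c i<..<c (i + 1)}"
      using less by (rule eventually_at_left_real)
    ultimately have "\<forall>\<^sub>F t in at_left (c (i + 1)). pos c t = k \<and> Q t"
      by eventually_elim (use pos in auto)
    then show ?thesis by (rule eventually_happens'[rotated]) simp
  qed
qed

lemma locally_constant_eq_knot:
  assumes "crit \<theta> \<subseteq> range c"
  shows "\<theta> (knot c s (pos c t)) = \<theta> t"
proof (cases "even (pos c t)")
  case True
  then obtain i where i: "pos c t = 2 * i" by blast
  then have "c i = t" using even_le_pos[of i t] odd_le_pos[of i t] by auto
  then show ?thesis using i by (simp add: knot_even)
next
  case False
  then obtain i where i: "pos c t = 2 * i + 1" by (metis oddE)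
  then have t: "t \<in> {c i<..<c (i + 1)}" using odd_le_pos[of i t] even_le_pos[of "i + 1" t] by auto
  have "\<theta> t = \<theta> (s i)"
  proof (rule connected_local_const[OF _ t])
    show "\<forall>u\<in>{c i<..<c (i + 1)}. \<forall>\<^sub>F v in at u within {c i<..<c (i + 1)}. \<theta> u = \<theta> v"
    proof
      fix u assume u: "u \<in> {c i<..<c (i + 1)}"
      have "u \<notin> range c"
      proof
        assume "u \<in> range c"
        then obtain j where "u = c j" by blast
        then have "i < j" "j < i + 1" using u mono by (auto simp: strict_mono_less)
        then show False by simp
      qed
      then have "u \<notin> crit \<theta>" using assms by blast
      then have "\<forall>\<^sub>F v in nhds u. \<theta> u = \<theta> v" unfolding crit_def by (auto elim: eventually_mono)
      then show "\<forall>\<^sub>F v in at u within {c i<..<c (i + 1)}. \<theta> u = \<theta> v"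
        using at_within_le_nhds by (rule filter_leD[rotated])
    qed
  qed (use sample in auto)
  then show ?thesis using i by (simp add: knot_odd)
qed

end

section \<open>Decompositions over the real line\<close>

text \<open>
  The local features of a formigram on which the uniqueness of its barcode rests. The comparison of nearby
  partitions makes the canonical maps towards \<open>\<theta> t\<close> well-defined.
\<close>

definition upper_partitions :: "(real \<Rightarrow> 'v set set) \<Rightarrow> bool" where
  "upper_partitions \<theta> \<longleftrightarrow>
     (\<forall>t. finite (\<theta> t) \<and> partition_on (\<Union>(\<theta> t)) (\<theta> t)) \<and>
     (\<forall>t. \<forall>\<^sub>F s in nhds t. coarsened_by (\<theta> s) (\<theta> t))"

lemma canonical_map_eq:
  assumes "partition_on X Q" "C \<in> Q" "B \<subseteq> C" "B \<noteq> {}"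
  shows "canonical_map Q B = C"
  unfolding canonical_map_def
proof (rule the_equality)
  fix C' assume "C' \<in> Q \<and> B \<subseteq> C'"
  then have "C' \<inter> C \<noteq> {}" using assms(3,4) by blast
  then show "C' = C" using assms(1,2) \<open>C' \<in> Q \<and> B \<subseteq> C'\<close> by (meson disjointD partition_onD2)
qed (use assms in blast)

lemma canonical_map:
  assumes "partition_on X Q" "partition_on Y P" "coarsened_by P Q" "B \<in> P"
  shows "canonical_map Q B \<in> Q" "B \<subseteq> canonical_map Q B"
proof -
  obtain C where "C \<in> Q" "B \<subseteq> C" using assms(3,4) by (auto simp: coarsened_by_def)
  moreover have "B \<noteq> {}" using assms(2,4) by (auto simp: partition_on_def)
  ultimately show "canonical_map Q B \<in> Q" "B \<subseteq> canonical_map Q B"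
    using canonical_map_eq[OF assms(1)] by auto
qed

lemma free_map_sum:
  assumes "finite P" "x \<in> free_space P"
  shows "free_map g x b = (\<Sum>a | a \<in> P \<and> g a = b. x a)"
  unfolding free_map_def using assms by (intro sum.mono_neutral_left) (auto simp: mem_free_space)

lemma free_map_mem:
  assumes "finite P" "finite Q" "x \<in> free_space P" "\<And>a. a \<in> P \<Longrightarrow> g a \<in> Q"
  shows "free_map g x \<in> free_space Q"
  using assms(4) unfolding mem_free_space[OF assms(2)] free_map_sum[OF assms(1,3)]
  by (auto intro!: sum.neutral)

lemma free_map_canonical_self:
  assumes "finite P" "partition_on X P" "x \<in> free_space P"
  shows "free_map (canonical_map P) x = x"
proof
  fix C
  have "canonical_map P a = a" if "a \<in> P" for a
    using that assms(2) by (intro canonical_map_eq[OF assms(2)]) (auto simp: partition_on_def)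
  then have "{a. a \<in> P \<and> canonical_map P a = C} = (if C \<in> P then {C} else {})" by auto
  then show "free_map (canonical_map P) x C = x C"
    using assms by (auto simp: free_map_sum mem_free_space)
qed

text \<open>
  A barcode decomposition without knots. The indices in \<open>A t\<close> are the bars alive at time \<open>t\<close>, and \<open>\<phi> t\<close>
  gives the coordinates of a chain with respect to them. Naturality is required near every time only:
  passing from a nearby time to \<open>t\<close>, the coordinates of the bars that are still alive do not change.
\<close>

definition decomposes ::
    "(real \<Rightarrow> 'v set set) \<Rightarrow> (real \<Rightarrow> 'i set) \<Rightarrow> (real \<Rightarrow> ('v set \<Rightarrow> 'f::field) \<Rightarrow> 'i \<Rightarrow> 'f) \<Rightarrow> bool" where
  "decomposes \<theta> A \<phi> \<longleftrightarrow>
     (\<forall>t. finite (A t) \<and> linear_between (free_space (\<theta> t)) (free_space (A t)) (\<phi> t) \<and>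
          bij_betw (\<phi> t) (free_space (\<theta> t)) (free_space (A t))) \<and>
     (\<forall>i t u v. t \<le> u \<longrightarrow> u \<le> v \<longrightarrow> i \<in> A t \<longrightarrow> i \<in> A v \<longrightarrow> i \<in> A u) \<and>
     (\<forall>t. \<forall>\<^sub>F s in nhds t. \<forall>x\<in>free_space (\<theta> s).
        \<phi> t (free_map (canonical_map (\<theta> t)) x) = (\<lambda>i. if i \<in> A t then \<phi> s x i else 0))"

lemma eventually_within_Icc:
  fixes t :: real
  assumes "\<forall>\<^sub>F s in nhds t. P s"
  shows "\<forall>\<^sub>F s in at t within {a..b}. s \<in> {a..b} \<and> P s"
  using assms by (auto simp: eventually_at_filter elim: eventually_mono)

text \<open>
  A section over \<open>[a, b]\<close> assigns to each time a chain such that near each time the chains are carried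
  to each other by the canonical maps. In the coordinates of any decomposition this says that, near a
  time at which a bar is alive, the coordinate of that bar is constant; it counts as zero where the
  bar is not alive.
\<close>

lemma section_in_coordinates:
  fixes \<theta> :: "real \<Rightarrow> 'v set set" and v :: "real \<Rightarrow> 'v set \<Rightarrow> 'f::field"
  assumes \<theta>: "upper_partitions \<theta>" and dec: "decomposes \<theta> A \<phi>"
    and v: "\<And>t. t \<in> {a..b} \<Longrightarrow> v t \<in> free_space (\<theta> t)" and t: "t \<in> {a..b}"
  shows "(\<forall>\<^sub>F s in at t within {a..b}. free_map (canonical_map (\<theta> t)) (v s) = v t) \<longleftrightarrow>
         (\<forall>\<^sub>F s in at t within {a..b}. \<forall>i\<in>A t. \<phi> s (v s) i = \<phi> t (v t) i)"
proof -
  have bij: "bij_betw (\<phi> t) (free_space (\<theta> t)) (free_space (A t))"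
    using dec by (simp add: decomposes_def)
  then have "\<phi> t (v t) \<in> free_space (A t)" using v[OF t] by (auto simp: bij_betw_def)
  then have out: "\<phi> t (v t) i = 0" if "i \<notin> A t" for i using that free_spaceD by metis
  have "\<forall>\<^sub>F s in nhds t. coarsened_by (\<theta> s) (\<theta> t) \<and> (\<forall>x\<in>free_space (\<theta> s).
        \<phi> t (free_map (canonical_map (\<theta> t)) x) = (\<lambda>i. if i \<in> A t then \<phi> s x i else 0))"
    using \<theta> dec by (simp add: upper_partitions_def decomposes_def eventually_conj_iff)
  then have "\<forall>\<^sub>F s in at t within {a..b}.
     free_map (canonical_map (\<theta> t)) (v s) = v t \<longleftrightarrow> (\<forall>i\<in>A t. \<phi> s (v s) i = \<phi> t (v t) i)"
  proof (rule eventually_within_Icc[THEN eventually_mono])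
    fix s assume s: "s \<in> {a..b} \<and> coarsened_by (\<theta> s) (\<theta> t) \<and> (\<forall>x\<in>free_space (\<theta> s).
        \<phi> t (free_map (canonical_map (\<theta> t)) x) = (\<lambda>i. if i \<in> A t then \<phi> s x i else 0))"
    let ?w = "free_map (canonical_map (\<theta> t)) (v s)"
    have "?w \<in> free_space (\<theta> t)"
      using \<theta> s v[of s] canonical_map(1)[of _ "\<theta> t" _ "\<theta> s"]
      by (intro free_map_mem[of "\<theta> s"]) (auto simp: upper_partitions_def)
    then have "?w = v t \<longleftrightarrow> \<phi> t ?w = \<phi> t (v t)"
      using bij v[OF t] by (auto simp: bij_betw_def inj_on_def)
    also have "\<dots> \<longleftrightarrow> (\<lambda>i. if i \<in> A t then \<phi> s (v s) i else 0) = \<phi> t (v t)"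
      using s v[of s] by simp
    also have "\<dots> \<longleftrightarrow> (\<forall>i\<in>A t. \<phi> s (v s) i = \<phi> t (v t) i)"
      using out by (auto simp: fun_eq_iff)
    finally show "?w = v t \<longleftrightarrow> (\<forall>i\<in>A t. \<phi> s (v s) i = \<phi> t (v t) i)" .
  qed
  then show ?thesis by (rule eventually_subst)
qed

lemma section_coordinate_constant:
  fixes w :: "real \<Rightarrow> 'i \<Rightarrow> 'f::field"
  assumes "a \<le> b" "\<And>t. t \<in> {a..b} \<Longrightarrow> i \<in> A t"
    and "\<And>t. t \<in> {a..b} \<Longrightarrow> \<forall>\<^sub>F s in at t within {a..b}. \<forall>i\<in>A t. w s i = w t i"
  shows "w a i = w b i"
proof (rule connected_local_const[of "{a..b}"])
  show "\<forall>t\<in>{a..b}. \<forall>\<^sub>F s in at t within {a..b}. w t i = w s i"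
  proof
    fix t assume t: "t \<in> {a..b}"
    show "\<forall>\<^sub>F s in at t within {a..b}. w t i = w s i"
      using assms(3)[OF t] by eventually_elim (use assms(2)[OF t] in auto)
  qed
qed (use assms(1) in auto)

text \<open>
  Every vector of coordinates on the bars of \<open>A\<close> that contain \<open>[a, b]\<close> extends to a section that is
  constant on \<open>[a, b]\<close>. Read the coordinates of that section on the bars of \<open>A'\<close> that contain
  \<open>[a, b]\<close>. This map is injective: if these coordinates vanish, the section is the sum of one
  that vanishes at \<open>a\<close> and one that vanishes at \<open>b\<close>, as a bar that misses a point of \<open>[a, b]\<close> misses
  \<open>a\<close> or \<open>b\<close>; and the coordinates of such sections on the bars of \<open>A\<close> containing \<open>[a, b]\<close> are constant, hence zero.
\<close>

lemma card_bars_over_interval_le: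
  fixes \<theta> :: "real \<Rightarrow> 'v set set" and A :: "real \<Rightarrow> 'i set" and A' :: "real \<Rightarrow> 'j set"
    and \<phi> :: "real \<Rightarrow> ('v set \<Rightarrow> 'f::field) \<Rightarrow> 'i \<Rightarrow> 'f" and \<phi>' :: "real \<Rightarrow> ('v set \<Rightarrow> 'f) \<Rightarrow> 'j \<Rightarrow> 'f"
  assumes \<theta>: "upper_partitions \<theta>" and dec: "decomposes \<theta> A \<phi>" and dec': "decomposes \<theta> A' \<phi>'"
    and ab: "a \<le> b"
  shows "card (A a \<inter> A b) \<le> card (A' a \<inter> A' b)"
proof -
  define inv where "inv t = the_inv_into (free_space (\<theta> t)) (\<phi> t)" for t
  define inv' where "inv' t = the_inv_into (free_space (\<theta> t)) (\<phi>' t)" for t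
  let ?S = "A a \<inter> A b" and ?S' = "A' a \<inter> A' b"
  have fin: "finite (A t)" "finite (A' t)"
    and lin: "linear_between (free_space (\<theta> t)) (free_space (A t)) (\<phi> t)"
             "linear_between (free_space (\<theta> t)) (free_space (A' t)) (\<phi>' t)"
    and bij: "bij_betw (\<phi> t) (free_space (\<theta> t)) (free_space (A t))"
             "bij_betw (\<phi>' t) (free_space (\<theta> t)) (free_space (A' t))" for t
    using dec dec' by (simp_all add: decomposes_def)
  have conv: "i \<in> A t" if "i \<in> ?S" "t \<in> {a..b}" for i t
    using dec that unfolding decomposes_def by (meson Int_iff atLeastAtMost_iff)
  have conv': "i \<in> A' t" if "i \<in> ?S'" "t \<in> {a..b}" for i t
    using dec' that unfolding decomposes_def by (meson Int_iff atLeastAtMost_iff)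
  have inv: "inv t y \<in> free_space (\<theta> t)" "\<phi> t (inv t y) = y" if "y \<in> free_space (A t)" for t y
    using that bij(1)[of t] f_the_inv_into_f_bij_betw[OF bij(1)[of t], of y]
    unfolding inv_def bij_betw_def by (auto intro: the_inv_into_into)
  have inv': "inv' t y \<in> free_space (\<theta> t)" "\<phi>' t (inv' t y) = y" if "y \<in> free_space (A' t)" for t y
    using that bij(2)[of t] f_the_inv_into_f_bij_betw[OF bij(2)[of t], of y]
    unfolding inv'_def bij_betw_def by (auto intro: the_inv_into_into)
  have inv_eq: "inv' t (\<phi>' t x) = x" if "x \<in> free_space (\<theta> t)" for t x
    using that bij(2)[of t] by (simp add: inv'_def bij_betw_def the_inv_into_f_f)
  have zero: "\<phi> t 0 = 0" "\<phi>' t 0 = 0" for t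
    using linear_between_sum[OF lin(1) subspace_free_space, of "{}"]
      linear_between_sum[OF lin(2) subspace_free_space, of "{}"] by auto
  define h where "h x = (\<lambda>j. if j \<in> ?S' then \<phi>' a (inv a x) j else 0)" for x
  have "linear_between (free_space ?S) (free_space (\<theta> a)) (inv a)"
    unfolding inv_def
    by (rule linear_between_subspace[OF linear_between_inverse[OF lin(1) bij(1) subspace_free_space]])
      (simp add: free_space_mono)
  then have "linear_between (free_space ?S) (free_space (A' a)) (\<lambda>x. \<phi>' a (inv a x))"
    using lin(2) by (rule linear_between_compose)
  then have h: "linear_between (free_space ?S) (free_space ?S') h"
    unfolding h_def by (rule linear_between_compose[OF _ linear_between_restrict]) simp
  have ker: "x = 0" if x: "x \<in> free_space ?S" and hx: "h x = 0" for x
  proof -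
    have x_mem: "x \<in> free_space (A t)" if "t \<in> {a..b}" for t
      using x free_space_mono[of ?S "A t"] conv that by blast
    define v where "v t = inv t x" for t
    have v: "v t \<in> free_space (\<theta> t)" "\<phi> t (v t) = x" if "t \<in> {a..b}" for t
      using inv x_mem that by (auto simp: v_def)
    define w where "w t = \<phi>' t (v t)" for t
    have w_mem: "w t \<in> free_space (A' t)" if "t \<in> {a..b}" for t
      using v(1) that bij(2)[of t] by (auto simp: w_def bij_betw_def)
    have w_sec: "\<forall>\<^sub>F s in at t within {a..b}. \<forall>j\<in>A' t. w s j = w t j" if t: "t \<in> {a..b}" for t
    proof -
      have "\<forall>\<^sub>F s in at t within {a..b}. \<forall>i\<in>A t. \<phi> s (v s) i = \<phi> t (v t) i"
        using eventually_within_Icc[of "\<lambda>_. True" t a b] by (rule eventually_mono) (use v t in auto)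
      then show ?thesis
        using section_in_coordinates[OF \<theta> dec, of a b v t] section_in_coordinates[OF \<theta> dec', of a b v t] v t
        by (simp add: w_def)
    qed
    \<comment> \<open>Keep the coordinates of the bars that contain \<open>a\<close>: this is again a section.\<close>
    define y where "y t = (\<lambda>j. if j \<in> A' a then w t j else 0)" for t
    define u where "u t = inv' t (y t)" for t
    have y_mem: "y t \<in> free_space (A' t)" if "t \<in> {a..b}" for t
      using w_mem[OF that] fin by (auto simp: y_def mem_free_space)
    have u: "u t \<in> free_space (\<theta> t)" "\<phi>' t (u t) = y t" if "t \<in> {a..b}" for t
      using inv' y_mem that by (auto simp: u_def)
    have y_sec: "\<forall>\<^sub>F s in at t within {a..b}. \<forall>j\<in>A' t. y s j = y t j" if t: "t \<in> {a..b}" for t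
      using w_sec[OF t] by eventually_elim (auto simp: y_def)
    have u_sec: "\<forall>\<^sub>F s in at t within {a..b}. \<forall>i\<in>A t. \<phi> s (u s) i = \<phi> t (u t) i" if t: "t \<in> {a..b}" for t
    proof -
      have "\<forall>\<^sub>F s in at t within {a..b}. s \<in> {a..b} \<and> (\<forall>j\<in>A' t. y s j = y t j)"
        using y_sec[OF t] by (simp add: eventually_at_filter)
      then have "\<forall>\<^sub>F s in at t within {a..b}. \<forall>j\<in>A' t. \<phi>' s (u s) j = \<phi>' t (u t) j"
        by (rule eventually_mono) (use u t in auto)
      then show ?thesis
        using section_in_coordinates[OF \<theta> dec, of a b u t] section_in_coordinates[OF \<theta> dec', of a b u t] u t
        by simp
    qed
    have a_in: "a \<in> {a..b}" and b_in: "b \<in> {a..b}" using ab by auto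
    have "y a = w a" using w_mem[OF a_in] fin by (auto simp: y_def mem_free_space)
    then have "u a = v a" using inv_eq[OF v(1)[OF a_in]] by (simp add: u_def w_def)
    then have ua: "\<phi> a (u a) = x" using v(2)[OF a_in] by simp
    have "y b j = 0" for j
    proof (cases "j \<in> ?S'")
      case True
      have "w a j = w b j" using section_coordinate_constant[OF ab _ w_sec, of j] conv'[OF True] by blast
      moreover have "w a j = 0" using fun_cong[OF hx, of j] True by (simp add: h_def w_def v_def zero_fun_apply)
      ultimately show ?thesis by (simp add: y_def)
    next
      case False
      then show ?thesis using w_mem[OF b_in] fin by (auto simp: y_def mem_free_space)
    qed
    then have "\<phi>' b (u b) = \<phi>' b 0" using u(2)[OF b_in] zero by (auto simp: pointwise)
    then have "u b = 0"
      using bij(2)[of b] u(1)[OF b_in] fs.subspace_0[OF subspace_free_space, of "\<theta> b"]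
      by (auto simp: bij_betw_def inj_on_def)
    then have ub: "\<phi> b (u b) = 0" using zero by simp
    show ?thesis
    proof
      fix i
      show "x i = 0 i"
      proof (cases "i \<in> ?S")
        case True
        have "\<phi> a (u a) i = \<phi> b (u b) i"
          using section_coordinate_constant[OF ab _ u_sec, of i] conv[OF True] by blast
        then show ?thesis using ua ub by simp
      next
        case False
        then show ?thesis using x free_spaceD by (metis zero_fun_apply)
      qed
    qed
  qed
  show ?thesis
    using card_le_if_injective_linear[OF _ _ h] ker fin by simp
qed

lemma finite_if_free_space_iso:
  assumes "finite P" "linear_between (free_space P) (free_space A) f"
    "bij_betw f (free_space P) (free_space A :: ('i \<Rightarrow> 'f::field) set)"
  shows "finite A"
proof (rule ccontr)
  assume "infinite A"
  then obtain S where S: "S \<subseteq> A" "finite S" "card S = Suc (card P)"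
    using infinite_arbitrarily_large by blast
  let ?g = "the_inv_into (free_space P) f"
  have g: "linear_between (free_space A) (free_space P) ?g"
    using linear_between_inverse[OF assms(2,3) subspace_free_space] .
  have "f 0 = 0" using linear_between_sum[OF assms(2) subspace_free_space, of "{}"] by auto
  have "card S \<le> card P"
  proof (rule card_le_if_injective_linear[OF S(2) assms(1)])
    show "linear_between (free_space S) (free_space P) ?g"
      using linear_between_subspace[OF g free_space_mono[OF S(1)]] .
    fix x assume x: "x \<in> free_space S" "?g x = 0"
    then have "x \<in> free_space A" using free_space_mono[OF S(1)] by blast
    then have "f (?g x) = x" by (intro f_the_inv_into_f_bij_betw[OF assms(3)])
    then show "x = 0" using x \<open>f 0 = 0\<close> by simp
  qed
  then show False using S(3) by simp
qed

section \<open>Existence and uniqueness of the barcode\<close>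

lemma knots_locale: "knots \<theta> c s \<Longrightarrow> knots_with_samples c s"
  by (simp add: knots_def knots_with_samples_def knots_with_samples_axioms_def knot_sequence_def)

text \<open>
  Every decomposition for particular knots is pulled back along \<^const>\<open>pos\<close> to the real line.
\<close>

lemma decomposes_if_is_barcode:
  fixes \<theta> :: "real \<Rightarrow> 'v set set" and D :: "real set \<Rightarrow> nat"
  assumes \<theta>: "upper_partitions \<theta>" and D: "is_barcode TYPE('f::field) \<theta> D"
  obtains A :: "real \<Rightarrow> (int set \<times> nat) set"
    and \<phi> :: "real \<Rightarrow> ('v set \<Rightarrow> 'f::field) \<Rightarrow> int set \<times> nat \<Rightarrow> 'f"
  where "decomposes \<theta> A \<phi>"
    "\<And>t. finite {p \<in> copies D. t \<in> fst p}"
    "\<And>t u. card {p \<in> copies D. t \<in> fst p \<and> u \<in> fst p} = card (A t \<inter> A u)"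
    "\<And>R. D R > 0 \<Longrightarrow> R \<noteq> {} \<and> is_interval R"
proof -
  obtain c s M where knots: "knots \<theta> c s" and M: "\<And>J. M J > 0 \<Longrightarrow> int_interval J"
    and iso: "zigzag_iso (formigram_zigzag \<theta> c s :: ('v set, 'f) zigzag) (interval_sum M)"
    and D_eq: "D = (\<lambda>R. \<Sum>J | int_interval J \<and> real_interval c J = R. M J)"
    using D unfolding is_barcode_def by blast
  interpret knots_with_samples c s using knots_locale[OF knots] .
  have "\<exists>\<psi>. (\<forall>k. linear_between (free_space (\<theta> (knot c s k)))
        (free_space {(J, n) \<in> copies M. k \<in> J} :: (_ \<Rightarrow> 'f) set) (\<psi> k) \<and>
        bij_betw (\<psi> k) (free_space (\<theta> (knot c s k))) (free_space {(J, n) \<in> copies M. k \<in> J})) \<and>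
      (\<forall>k l. zigzag_arrow k l \<longrightarrow> (\<forall>x\<in>free_space (\<theta> (knot c s k)).
        \<psi> l (free_map (canonical_map (\<theta> (knot c s l))) x) = (\<lambda>(J, n). if l \<in> J then \<psi> k x (J, n) else 0)))"
    using iso unfolding zigzag_iso_def formigram_zigzag_def interval_sum_def by simp
  then obtain \<psi> where \<psi>: "\<forall>k. linear_between (free_space (\<theta> (knot c s k)))
        (free_space {(J, n) \<in> copies M. k \<in> J} :: (_ \<Rightarrow> 'f) set) (\<psi> k) \<and>
        bij_betw (\<psi> k) (free_space (\<theta> (knot c s k))) (free_space {(J, n) \<in> copies M. k \<in> J})"
    and nat: "\<forall>k l. zigzag_arrow k l \<longrightarrow> (\<forall>x\<in>free_space (\<theta> (knot c s k)).
        \<psi> l (free_map (canonical_map (\<theta> (knot c s l))) x) = (\<lambda>(J, n). if l \<in> J then \<psi> k x (J, n) else 0))"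
    by (elim exE conjE) (rule that)
  have \<theta>_eq: "\<theta> (knot c s (pos c t)) = \<theta> t" for t
    using knots by (intro locally_constant_eq_knot) (simp add: knots_def)
  have \<theta>_fin: "finite (\<theta> t)" and \<theta>_part: "partition_on (\<Union>(\<theta> t)) (\<theta> t)" for t
    using \<theta> by (simp_all add: upper_partitions_def)
  define A where "A t = {(J, n) \<in> copies M. pos c t \<in> J}" for t
  define \<phi> where "\<phi> t = \<psi> (pos c t)" for t
  have lin: "linear_between (free_space (\<theta> t)) (free_space (A t)) (\<phi> t)"
    and bij: "bij_betw (\<phi> t) (free_space (\<theta> t)) (free_space (A t))" for t
    using spec[OF \<psi>, of "pos c t"] by (simp_all add: \<theta>_eq A_def \<phi>_def)
  have fin: "finite (A t)" for t
    using finite_if_free_space_iso[OF \<theta>_fin lin bij] .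
  have conv: "i \<in> A u" if le: "t \<le> u" "u \<le> v" and i: "i \<in> A t" "i \<in> A v" for i t u v
  proof -
    obtain J n where i: "i = (J, n)" "(J, n) \<in> copies M" "pos c t \<in> J" "pos c v \<in> J"
      using i by (auto simp: A_def)
    then have "int_interval J" using M[of J] by (auto simp: copies_def)
    then have "pos c u \<in> J" using i le pos_mono unfolding int_interval_def
      by (meson atLeastAtMost_iff subsetD)
    then show ?thesis using i by (simp add: A_def)
  qed
  have local: "\<forall>\<^sub>F u in nhds t. \<forall>x\<in>free_space (\<theta> u).
        \<phi> t (free_map (canonical_map (\<theta> t)) x) = (\<lambda>i. if i \<in> A t then \<phi> u x i else 0)" for t
    using eventually_pos[of t]
  proof eventually_elim
    case (elim u)
    show ?case
    proof
      fix x :: "'v set \<Rightarrow> 'f" assume x: "x \<in> free_space (\<theta> u)"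
      have \<phi>x: "\<phi> u x \<in> free_space (A u)" using lin[of u] x by (auto simp: linear_between_def)
      show "\<phi> t (free_map (canonical_map (\<theta> t)) x) = (\<lambda>i. if i \<in> A t then \<phi> u x i else 0)"
        using elim
      proof
        assume eq: "pos c u = pos c t"
        then have same: "\<theta> u = \<theta> t" "A u = A t" "\<phi> u = \<phi> t"
          using \<theta>_eq[of u] \<theta>_eq[of t] by (simp_all add: A_def \<phi>_def)
        have "free_map (canonical_map (\<theta> t)) x = x"
          using x same by (intro free_map_canonical_self[OF \<theta>_fin \<theta>_part]) simp
        then show ?thesis using same free_spaceD[OF \<phi>x] by auto
      next
        assume "zigzag_arrow (pos c u) (pos c t)"
        from nat[rule_format, OF this] have "\<phi> t (free_map (canonical_map (\<theta> t)) x) =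
            (\<lambda>(J, n). if pos c t \<in> J then \<phi> u x (J, n) else 0)"
          using x unfolding \<phi>_def by (simp add: \<theta>_eq)
        also have "\<dots> = (\<lambda>i. if i \<in> A t then \<phi> u x i else 0)"
          using free_spaceD[OF \<phi>x] by (auto simp: A_def fun_eq_iff)
        finally show ?thesis .
      qed
    qed
  qed
  have dec: "decomposes \<theta> A \<phi>"
    unfolding decomposes_def using lin bij fin conv local by blast
  have D_ivl: "D (real_interval c J) = M J" if "int_interval J" for J
  proof -
    have "{I. int_interval I \<and> real_interval c I = real_interval c J} = {J}"
      using that inj_on_real_interval by (auto simp: inj_on_def)
    then show ?thesis by (simp add: D_eq)
  qed
  have D_pos: "\<exists>J. int_interval J \<and> real_interval c J = R" if "D R > 0" for R
  proof (rule ccontr)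
    assume "\<not> ?thesis"
    then have "{J. int_interval J \<and> real_interval c J = R} = {}" by blast
    then have "D R = 0" unfolding D_eq by (simp only: sum.empty)
    then show False using that by simp
  qed
  let ?g = "\<lambda>(J, n). (real_interval c J, n :: nat)"
  have inj: "inj_on ?g (copies M)"
    using inj_on_real_interval M by (auto simp: inj_on_def copies_def)
  have img: "{p \<in> copies D. t \<in> fst p \<and> u \<in> fst p} = ?g ` (A t \<inter> A u)" for t u
  proof (intro equalityI subsetI)
    fix p assume "p \<in> {p \<in> copies D. t \<in> fst p \<and> u \<in> fst p}"
    then obtain R n where p: "p = (R, n)" "n < D R" "t \<in> R" "u \<in> R" by (auto simp: copies_def)
    then obtain J where J: "int_interval J" "real_interval c J = R" using D_pos[of R] by auto
    then have "(J, n) \<in> A t \<inter> A u"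
      using p D_ivl[OF J(1)] real_interval_eq[OF J(1)] by (auto simp: A_def copies_def)
    then show "p \<in> ?g ` (A t \<inter> A u)" using p J by force
  next
    fix p assume "p \<in> ?g ` (A t \<inter> A u)"
    then obtain J n where p: "p = (real_interval c J, n)" "n < M J" "pos c t \<in> J" "pos c u \<in> J"
      by (auto simp: A_def copies_def)
    then have J: "int_interval J" using M[of J] by simp
    then show "p \<in> {p \<in> copies D. t \<in> fst p \<and> u \<in> fst p}"
      using p D_ivl[OF J] real_interval_eq[OF J] by (auto simp: copies_def)
  qed
  have "card {p \<in> copies D. t \<in> fst p \<and> u \<in> fst p} = card (A t \<inter> A u)" for t u
    unfolding img by (rule card_image) (rule inj_on_subset[OF inj], auto simp: A_def)
  moreover have "finite {p \<in> copies D. t \<in> fst p}" for t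
    using img[of t t] fin[of t] by simp
  moreover have "R \<noteq> {} \<and> is_interval R" if "D R > 0" for R
  proof -
    obtain J where J: "int_interval J" "R = {t. pos c t \<in> J}"
      using D_pos[OF \<open>D R > 0\<close>] real_interval_eq by auto
    then obtain j where "j \<in> J" by (auto simp: int_interval_def)
    then have "knot c s j \<in> R" using J by simp
    moreover have "is_interval R"
      unfolding is_interval_1 J(2) using J(1) pos_mono unfolding int_interval_def
      by (auto, meson atLeastAtMost_iff subsetD)
    ultimately show ?thesis by blast
  qed
  ultimately show ?thesis using that[OF dec] by blast
qed

lemma barcode_unique:
  fixes \<theta> :: "real \<Rightarrow> 'v set set"
  assumes \<theta>: "upper_partitions \<theta>"
    and D: "is_barcode TYPE('f::field) \<theta> D" and D': "is_barcode TYPE('f) \<theta> D'"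
  shows "D = D'"
proof -
  obtain A :: "real \<Rightarrow> (int set \<times> nat) set" and \<phi> :: "real \<Rightarrow> ('v set \<Rightarrow> 'f) \<Rightarrow> _"
    where 1: "decomposes \<theta> A \<phi>" "\<And>t. finite {p \<in> copies D. t \<in> fst p}"
      "\<And>t u. card {p \<in> copies D. t \<in> fst p \<and> u \<in> fst p} = card (A t \<inter> A u)"
      "\<And>R. D R > 0 \<Longrightarrow> R \<noteq> {} \<and> is_interval R"
    by (rule decomposes_if_is_barcode[OF \<theta> D]) (rule that)
  obtain A' :: "real \<Rightarrow> (int set \<times> nat) set" and \<phi>' :: "real \<Rightarrow> ('v set \<Rightarrow> 'f) \<Rightarrow> _"
    where 2: "decomposes \<theta> A' \<phi>'" "\<And>t. finite {p \<in> copies D'. t \<in> fst p}"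
      "\<And>t u. card {p \<in> copies D'. t \<in> fst p \<and> u \<in> fst p} = card (A' t \<inter> A' u)"
      "\<And>R. D' R > 0 \<Longrightarrow> R \<noteq> {} \<and> is_interval R"
    by (rule decomposes_if_is_barcode[OF \<theta> D']) (rule that)
  show ?thesis
  proof (rule interval_multiset_determined_by_counts)
    fix a b :: real assume "a \<le> b"
    then show "card {p \<in> copies D. a \<in> fst p \<and> b \<in> fst p} = card {p \<in> copies D'. a \<in> fst p \<and> b \<in> fst p}"
      unfolding 1(3) 2(3)
      using card_bars_over_interval_le[OF \<theta> 1(1) 2(1)] card_bars_over_interval_le[OF \<theta> 2(1) 1(1)]
      by (intro order_antisym) auto
  qed (use 1(2,4) 2(2,4) in blast)+
qed

lemma dgm_eq:
  assumes "upper_partitions \<theta>" "is_barcode TYPE('f::field) \<theta> D"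
  shows "dgm TYPE('f) \<theta> = D"
  unfolding dgm_def using assms barcode_unique by (intro the_equality) blast+

lemma decomposes_convex:
  assumes "decomposes \<theta> A \<phi>" "t \<le> u" "u \<le> v" "i \<in> A t" "i \<in> A v"
  shows "i \<in> A u"
proof -
  have "\<forall>i t u v. t \<le> u \<longrightarrow> u \<le> v \<longrightarrow> i \<in> A t \<longrightarrow> i \<in> A v \<longrightarrow> i \<in> A u"
    using assms(1) by (simp add: decomposes_def)
  then show ?thesis using assms(2-5) by blast
qed

text \<open>
  Restriction to the knots and samples. The interval summand of a bar is supported on the
  positions at which the bar is alive, and copies of equal supports are numbered by a bijection.
\<close>

lemma is_barcode_if_decomposes:
  fixes \<theta> :: "real \<Rightarrow> 'v set set" and A :: "real \<Rightarrow> 'i set" and \<phi> :: "real \<Rightarrow> ('v set \<Rightarrow> 'f::field) \<Rightarrow> 'i \<Rightarrow> 'f"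
  assumes knots: "knots \<theta> c s" and dec: "decomposes \<theta> A \<phi>"
    and cell: "\<And>t u. pos c t = pos c u \<Longrightarrow> A t = A u \<and> \<phi> t = \<phi> u"
  shows "is_barcode TYPE('f) \<theta> (\<lambda>R. card {i \<in> (\<Union>t. A t). {t. i \<in> A t} = R})"
proof -
  interpret knots_with_samples c s using knots_locale[OF knots] .
  define A' where "A' k = A (knot c s k)" for k
  define \<phi>' where "\<phi>' k = \<phi> (knot c s k)" for k
  define S where "S = (\<Union>t. A t)"
  define f where "f i = {k. i \<in> A' k}" for i
  define M where "M J = card {i \<in> S. f i = J}" for J
  have A_pos: "A t = A' (pos c t)" and \<phi>_pos: "\<phi> t = \<phi>' (pos c t)" for t
    using cell[of "knot c s (pos c t)" t] by (simp_all add: A'_def \<phi>'_def)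
  have \<theta>_eq: "\<theta> (knot c s (pos c t)) = \<theta> t" for t
    using knots by (intro locally_constant_eq_knot) (simp add: knots_def)
  have fin: "finite (A' k)" and lin: "linear_between (free_space (\<theta> (knot c s k))) (free_space (A' k)) (\<phi>' k)"
    and bij: "bij_betw (\<phi>' k) (free_space (\<theta> (knot c s k))) (free_space (A' k))" for k
    using dec by (simp_all add: decomposes_def A'_def \<phi>'_def)
  have f_ne: "f i \<noteq> {}" if "i \<in> S" for i
    using that A_pos by (auto simp: S_def f_def)
  have A'_S: "A' k \<subseteq> S" for k by (auto simp: S_def A'_def)
  have f_ivl: "int_interval (f i)" if "i \<in> S" for i
    unfolding int_interval_def
  proof (intro conjI ballI subsetI f_ne[OF that])
    fix a b k assume "a \<in> f i" "b \<in> f i" "k \<in> {a..b}"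
    then show "k \<in> f i"
      using decomposes_convex[OF dec knot_mono[of a k] knot_mono[of k b]] by (simp add: f_def A'_def)
  qed
  have fib: "finite {i \<in> S. f i = J}" for J
  proof (cases "J = {}")
    case True
    then have "{i \<in> S. f i = J} = {}" using f_ne by blast
    then show ?thesis by (simp only: finite.emptyI)
  next
    case False
    then obtain k where "k \<in> J" by blast
    then have "{i \<in> S. f i = J} \<subseteq> A' k" by (auto simp: f_def)
    then show ?thesis using fin finite_subset by blast
  qed
  obtain \<beta> where \<beta>: "bij_betw \<beta> S (copies M)" "\<And>i. i \<in> S \<Longrightarrow> fst (\<beta> i) = f i"
    using family_bij_copies[of S f, OF fib] unfolding M_def by metis
  define \<gamma> where "\<gamma> = the_inv_into S \<beta>"
  have \<gamma>: "bij_betw \<gamma> (copies M) S" unfolding \<gamma>_def using \<beta>(1) by (rule bij_betw_the_inv_into)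
  have \<gamma>_mem: "\<gamma> p \<in> A' k \<longleftrightarrow> k \<in> fst p" if "p \<in> copies M" for p k
  proof -
    have "\<gamma> p \<in> S" using \<gamma> that by (auto simp: bij_betw_def)
    moreover have "\<beta> (\<gamma> p) = p" using that f_the_inv_into_f_bij_betw[OF \<beta>(1)] by (simp add: \<gamma>_def)
    ultimately have "fst p = f (\<gamma> p)" using \<beta>(2)[of "\<gamma> p"] by simp
    then show ?thesis by (simp add: f_def)
  qed
  define B where "B k = {(J, n) \<in> copies M. k \<in> J}" for k
  have \<gamma>_B: "bij_betw \<gamma> (B k) (A' k)" for k
  proof -
    have "\<gamma> ` B k = A' k"
    proof (intro equalityI subsetI)
      fix i assume "i \<in> A' k"
      then have "i \<in> \<gamma> ` copies M" using \<gamma> A'_S by (auto simp: bij_betw_def)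
      then obtain p where "p \<in> copies M" "i = \<gamma> p" by blast
      then show "i \<in> \<gamma> ` B k" using \<gamma>_mem[of p k] \<open>i \<in> A' k\<close> by (force simp: B_def)
    qed (auto simp: B_def \<gamma>_mem)
    moreover have "inj_on \<gamma> (B k)"
      using \<gamma> by (auto simp: bij_betw_def B_def intro: inj_on_subset)
    ultimately show ?thesis by (simp add: bij_betw_def)
  qed
  define \<rho> where "\<rho> k x = (\<lambda>b. if b \<in> B k then x (\<gamma> b) else (0 :: 'f))" for k x
  define \<psi> where "\<psi> k x = \<rho> k (\<phi>' k x)" for k x
  have \<psi>_lin: "linear_between (free_space (\<theta> (knot c s k))) (free_space (B k)) (\<psi> k)" for k
    unfolding \<psi>_def \<rho>_def using linear_between_compose[OF lin free_space_reindex(1)[OF \<gamma>_B fin]] .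
  have \<psi>_bij: "bij_betw (\<psi> k) (free_space (\<theta> (knot c s k))) (free_space (B k))" for k
    unfolding \<psi>_def \<rho>_def
    using bij_betw_trans[OF bij free_space_reindex(2)[OF \<gamma>_B fin]] by (simp add: o_def)
  have \<psi>_nat: "\<psi> l (free_map (canonical_map (\<theta> (knot c s l))) x) = (\<lambda>(J, n). if l \<in> J then \<psi> k x (J, n) else 0)"
    if arrow: "zigzag_arrow k l" and x: "x \<in> free_space (\<theta> (knot c s k))" for k l x
  proof -
    have "\<forall>\<^sub>F t in nhds (knot c s l). \<forall>x\<in>free_space (\<theta> t). \<phi>' l (free_map (canonical_map (\<theta> (knot c s l))) x) =
        (\<lambda>i. if i \<in> A' l then \<phi> t x i else 0)"
      using dec unfolding decomposes_def A'_def \<phi>'_def by blast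
    then obtain t where t: "pos c t = k" "\<forall>x\<in>free_space (\<theta> t).
        \<phi>' l (free_map (canonical_map (\<theta> (knot c s l))) x) = (\<lambda>i. if i \<in> A' l then \<phi> t x i else 0)"
      using exists_near_knot[OF arrow] by blast
    have same: "\<theta> t = \<theta> (knot c s k)" "\<phi> t = \<phi>' k" using \<theta>_eq[of t] \<phi>_pos t(1) by auto
    have *: "\<phi>' l (free_map (canonical_map (\<theta> (knot c s l))) x) = (\<lambda>i. if i \<in> A' l then \<phi>' k x i else 0)"
      using t(2) x unfolding same by simp
    have "\<phi>' k x \<in> free_space (A' k)" using lin[of k] x by (auto simp: linear_between_def)
    then have "\<phi>' k x i = 0" if "i \<notin> A' k" for i using that free_spaceD by metis
    then show ?thesis
      unfolding \<psi>_def \<rho>_def * by (auto simp: fun_eq_iff B_def \<gamma>_mem)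
  qed
  have iso: "zigzag_iso (formigram_zigzag \<theta> c s :: ('v set, 'f) zigzag) (interval_sum M)"
    unfolding zigzag_iso_def formigram_zigzag_def interval_sum_def
    using \<psi>_lin \<psi>_bij \<psi>_nat unfolding B_def by (intro exI[of _ \<psi>]) auto
  have supp: "int_interval J" if "M J > 0" for J
  proof -
    have "{i \<in> S. f i = J} \<noteq> {}" using that unfolding M_def by (metis card.empty less_irrefl)
    then show ?thesis using f_ivl by blast
  qed
  have "card {i \<in> S. {t. i \<in> A t} = R} = (\<Sum>J | int_interval J \<and> real_interval c J = R. M J)" for R
  proof -
    have life: "{t. i \<in> A t} = real_interval c (f i)" if "i \<in> S" for i
      unfolding real_interval_eq[OF f_ivl[OF that]] using A_pos by (auto simp: f_def)
    show ?thesis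
    proof (cases "\<exists>J. int_interval J \<and> real_interval c J = R")
      case True
      then obtain J where J: "int_interval J" "real_interval c J = R" by blast
      have uniq: "I = J" if "int_interval I" "real_interval c I = R" for I
        using that J inj_on_real_interval by (auto simp: inj_on_def)
      then have "{J. int_interval J \<and> real_interval c J = R} = {J}" using J by blast
      moreover have "{i \<in> S. {t. i \<in> A t} = R} = {i \<in> S. f i = J}"
      proof (rule Collect_cong, rule conj_cong[OF refl])
        fix i assume i: "i \<in> S"
        show "{t. i \<in> A t} = R \<longleftrightarrow> f i = J"
          unfolding life[OF i] using uniq[OF f_ivl[OF i]] J(2) by blast
      qed
      ultimately show ?thesis by (simp add: M_def)
    next
      case False
      then have "{i \<in> S. {t. i \<in> A t} = R} = {}" using life f_ivl by blast
      moreover have "{J. int_interval J \<and> real_interval c J = R} = {}" using False by blast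
      ultimately show ?thesis by (simp only: card.empty sum.empty)
    qed
  qed
  then show ?thesis
    unfolding is_barcode_def S_def[symmetric] using knots supp iso by blast
qed

section \<open>Functions constant on the blocks of a partition\<close>

text \<open>
  The dual of the free space on the blocks of \<open>P\<close>, realised inside the functions on the vertices.
  Functions vanish outside \<open>X\<close> so that the space has finite dimension.
\<close>

definition block_functions :: "'v set \<Rightarrow> 'v set set \<Rightarrow> ('v \<Rightarrow> 'f::field) set" where
  "block_functions X P = {g. (\<forall>x. x \<notin> X \<longrightarrow> g x = 0) \<and> (\<forall>B\<in>P. \<forall>x\<in>B. \<forall>y\<in>B. g x = g y)}"

definition block_value :: "('v \<Rightarrow> 'f) \<Rightarrow> 'v set \<Rightarrow> 'f" where
  "block_value g B = g (SOME x. x \<in> B)"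

text \<open>
  The pairing of a chain on the blocks of \<open>P\<close> with the functions of the bars in \<open>T\<close>. The first
  component of a bar is a label that tells apart equal functions with different lifetimes.
\<close>

definition bar_coordinates ::
    "'v set set \<Rightarrow> ('b \<times> ('v \<Rightarrow> 'f)) set \<Rightarrow> ('v set \<Rightarrow> 'f) \<Rightarrow> 'b \<times> ('v \<Rightarrow> 'f::field) \<Rightarrow> 'f" where
  "bar_coordinates P T x = (\<lambda>i. if i \<in> T then \<Sum>B\<in>P. x B * block_value (snd i) B else 0)"

lemma block_functionsI:
  "(\<And>x. x \<notin> X \<Longrightarrow> g x = 0) \<Longrightarrow> (\<And>B x y. B \<in> P \<Longrightarrow> x \<in> B \<Longrightarrow> y \<in> B \<Longrightarrow> g x = g y) \<Longrightarrow>
   g \<in> block_functions X P"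
  unfolding block_functions_def by blast

lemma block_functionsD:
  assumes "g \<in> block_functions X P"
  shows "x \<notin> X \<Longrightarrow> g x = 0" "B \<in> P \<Longrightarrow> x \<in> B \<Longrightarrow> y \<in> B \<Longrightarrow> g x = g y"
  using assms unfolding block_functions_def by blast+

lemma subspace_block_functions: "fs.subspace (block_functions X P :: ('v \<Rightarrow> 'f::field) set)"
proof (rule fs.subspaceI)
  fix g h :: "'v \<Rightarrow> 'f" assume gh: "g \<in> block_functions X P" "h \<in> block_functions X P"
  show "g + h \<in> block_functions X P"
  proof (rule block_functionsI)
    fix B x y assume "B \<in> P" "x \<in> B" "y \<in> B"
    then show "(g + h) x = (g + h) y"
      using block_functionsD(2)[OF gh(1)] block_functionsD(2)[OF gh(2)]
      unfolding plus_fun_apply by metis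
  qed (simp add: block_functionsD(1)[OF gh(1)] block_functionsD(1)[OF gh(2)] plus_fun_apply)
next
  fix r and g :: "'v \<Rightarrow> 'f" assume g: "g \<in> block_functions X P"
  show "fscale r g \<in> block_functions X P"
  proof (rule block_functionsI)
    fix B x y assume "B \<in> P" "x \<in> B" "y \<in> B"
    then show "fscale r g x = fscale r g y"
      using block_functionsD(2)[OF g] unfolding fscale_apply by metis
  qed (simp add: block_functionsD(1)[OF g] fscale_apply)
qed (simp add: block_functions_def zero_fun_apply)

lemma block_functions_antimono:
  assumes "coarsened_by P Q"
  shows "block_functions X Q \<subseteq> block_functions X P"
proof
  fix g assume g: "g \<in> block_functions X Q"
  show "g \<in> block_functions X P"
  proof (rule block_functionsI)
    fix B x y assume B: "B \<in> P" "x \<in> B" "y \<in> B"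
    then obtain C where "C \<in> Q" "B \<subseteq> C" using assms unfolding coarsened_by_def by blast
    then show "g x = g y" using B block_functionsD(2)[OF g, of C x y] by blast
  qed (rule block_functionsD(1)[OF g])
qed

lemma block_functions_spanned:
  assumes "finite X"
  obtains G :: "('v \<Rightarrow> 'f::field) set" where "finite G" "\<And>P. block_functions X P \<subseteq> fs.span G"
proof -
  define e :: "'v \<Rightarrow> 'v \<Rightarrow> 'f" where "e x = (\<lambda>y. if y = x then 1 else 0)" for x
  have "g \<in> fs.span (e ` X)" if "g \<in> block_functions X P" for g P
  proof -
    have "g = (\<Sum>x\<in>X. fscale (g x) (e x))"
      using that assms
      by (auto simp: pointwise sum_fun_apply e_def block_functions_def if_distrib cong: if_cong)
    also have "\<dots> \<in> fs.span (e ` X)" by (intro fs.span_sum fs.span_scale fs.span_base) auto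
    finally show ?thesis .
  qed
  then show ?thesis using that[of "e ` X"] assms by blast
qed

lemma block_value_eq:
  assumes "g \<in> block_functions X P" "B \<in> P" "x \<in> B"
  shows "block_value g B = g x"
  unfolding block_value_def using assms someI[of "\<lambda>x. x \<in> B" x]
  unfolding block_functions_def by blast

lemma block_value_linear:
  "block_value (g + h) B = block_value g B + block_value h B"
  "block_value (fscale r g) B = r * block_value g B"
  by (simp_all add: block_value_def pointwise)

lemma block_function_expansion:
  assumes fin: "finite P" and part: "partition_on X P" and g: "g \<in> block_functions X P"
  shows "g = (\<Sum>B\<in>P. fscale (block_value g B) (\<lambda>x. if x \<in> B then 1 else 0))"
proof
  fix x
  have "(\<Sum>B\<in>P. block_value g B * (if x \<in> B then 1 else 0)) = g x"
  proof (cases "x \<in> X")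
    case True
    then obtain C where C: "C \<in> P" "x \<in> C" using part by (auto simp: partition_on_def)
    have "x \<notin> B" if "B \<in> P" "B \<noteq> C" for B
      using that C part partition_onD2[OF part] by (meson disjoint_iff disjointD)
    then have "(\<Sum>B\<in>P. block_value g B * (if x \<in> B then 1 else 0)) = (\<Sum>B\<in>P. if B = C then block_value g C else 0)"
      using C by (intro sum.cong) auto
    then show ?thesis using C fin block_value_eq[OF g C] by simp
  next
    case False
    then have "x \<notin> B" if "B \<in> P" for B using that part by (auto simp: partition_on_def)
    then show ?thesis using False g by (simp add: block_functions_def)
  qed
  then show "g x = (\<Sum>B\<in>P. fscale (block_value g B) (\<lambda>x. if x \<in> B then 1 else 0)) x"
    by (simp add: sum_fun_apply fscale_apply)
qed

text \<open>
  A basis of the dual space is a system of coordinates: the pairing is injective because indicators of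
  blocks are combinations of the basis, and surjective because values prescribed on the basis extend
  to a linear form.
\<close>

lemma bar_coordinates_iso:
  fixes T :: "('b \<times> ('v \<Rightarrow> 'f::field)) set"
  assumes P: "finite P" "partition_on X P" and T: "finite T" "inj_on snd T"
    and ind: "fs.independent (snd ` T)" and spn: "fs.span (snd ` T) = block_functions X P"
  shows "linear_between (free_space P) (free_space T) (bar_coordinates P T)"
    and "bij_betw (bar_coordinates P T) (free_space P) (free_space T)"
proof -
  have mem: "bar_coordinates P T x \<in> free_space T" for x
    using T by (simp add: mem_free_space bar_coordinates_def)
  show lin: "linear_between (free_space P) (free_space T) (bar_coordinates P T)"
    unfolding linear_between_iff using mem
    by (auto simp: bar_coordinates_def pointwise sum.distrib sum_distrib_left algebra_simps)
  have g: "snd i \<in> block_functions X P" if "i \<in> T" for i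
    using that spn fs.span_base[of "snd i" "snd ` T"] by auto
  have "inj_on (bar_coordinates P T) (free_space P)"
  proof (rule inj_onI)
    fix x y assume xy: "x \<in> free_space P" "y \<in> free_space P" "bar_coordinates P T x = bar_coordinates P T y"
    let ?E = "{g. (\<Sum>B\<in>P. x B * block_value g B) = (\<Sum>B\<in>P. y B * block_value g B)}"
    have "fs.subspace ?E"
    proof (rule fs.subspaceI)
      fix r g assume "g \<in> ?E"
      then have "r * (\<Sum>B\<in>P. x B * block_value g B) = r * (\<Sum>B\<in>P. y B * block_value g B)" by simp
      then show "fscale r g \<in> ?E" by (simp add: block_value_linear sum_distrib_left mult.left_commute)
    qed (auto simp: block_value_linear distrib_left sum.distrib, simp add: block_value_def zero_fun_apply)
    moreover have "snd i \<in> ?E" if "i \<in> T" for i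
      using fun_cong[OF xy(3), of i] that by (simp add: bar_coordinates_def)
    ultimately have all: "block_functions X P \<subseteq> ?E" using fs.span_minimal[of "snd ` T" ?E] spn by blast
    show "x = y"
    proof
      fix B
      show "x B = y B"
      proof (cases "B \<in> P")
        case True
        let ?h = "\<lambda>z. if z \<in> B then 1 else (0 :: 'f)"
        have h: "?h \<in> block_functions X P"
        proof -
          have "?h z = 0" if "z \<notin> X" for z using that True P(2) by (auto simp: partition_on_def)
          moreover have "?h z = ?h w" if "C \<in> P" "z \<in> C" "w \<in> C" for C z w
            using that True partition_onD2[OF P(2)] by (metis disjointD disjoint_iff)
          ultimately show ?thesis unfolding block_functions_def by blast
        qed
        have "block_value ?h C = (if C = B then 1 else 0)" if C: "C \<in> P" for C
        proof -
          obtain z where z: "z \<in> C" using C partition_onD3[OF P(2)] by (metis ex_in_conv)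
          then have "block_value ?h C = ?h z" using block_value_eq[OF h C] by blast
          then show ?thesis using z C True partition_onD2[OF P(2)] by (metis disjointD disjoint_iff)
        qed
        then have "(\<Sum>C\<in>P. w C * block_value ?h C) = (\<Sum>C\<in>P. if C = B then w B else 0)"
          for w :: "'v set \<Rightarrow> 'f"
          by (intro sum.cong) auto
        then have "(\<Sum>C\<in>P. w C * block_value ?h C) = w B" for w :: "'v set \<Rightarrow> 'f"
          using True P(1) by simp
        then show ?thesis using h all by auto
      next
        case False
        then show ?thesis using xy(1,2) free_spaceD by metis
      qed
    qed
  qed
  moreover have "y \<in> bar_coordinates P T ` free_space P" if y: "y \<in> free_space T" for y
  proof -
    interpret pair: vector_space_pair fscale "(*) :: 'f \<Rightarrow> 'f \<Rightarrow> 'f"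
      by unfold_locales (auto simp: algebra_simps)
    \<comment> \<open>Extend the prescribed values on the basis to a linear form and evaluate it on the blocks.\<close>
    obtain L where L: "Vector_Spaces.linear fscale (*) L"
      "\<And>g. g \<in> snd ` T \<Longrightarrow> L g = y (the_inv_into T snd g)"
      using pair.linear_independent_extend[OF ind, of "\<lambda>g. y (the_inv_into T snd g)"] by blast
    interpret L: Vector_Spaces.linear fscale "(*)" L by (rule L(1))
    define x where "x B = (if B \<in> P then L (\<lambda>z. if z \<in> B then 1 else 0) else 0)" for B
    have coord: "bar_coordinates P T x i = y i" for i
    proof (cases "i \<in> T")
      case True
      have "L (snd i) = L (\<Sum>B\<in>P. fscale (block_value (snd i) B) (\<lambda>z. if z \<in> B then 1 else 0))"
        using block_function_expansion[OF P g[OF True]] by simp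
      also have "\<dots> = (\<Sum>B\<in>P. block_value (snd i) B * L (\<lambda>z. if z \<in> B then 1 else 0))"
        by (simp add: L.sum L.scale)
      also have "\<dots> = bar_coordinates P T x i"
        using True by (simp add: bar_coordinates_def x_def mult.commute)
      finally show ?thesis using L(2)[of "snd i"] True T(2) by (simp add: the_inv_into_f_f)
    next
      case False
      then show ?thesis using y free_spaceD[OF y] by (simp add: bar_coordinates_def)
    qed
    have "y = bar_coordinates P T x" using coord by (simp add: fun_eq_iff)
    moreover have "x \<in> free_space P" using P(1) by (simp add: mem_free_space x_def)
    ultimately show ?thesis by (rule image_eqI)
  qed
  ultimately show "bij_betw (bar_coordinates P T) (free_space P) (free_space T)"
    using mem by (auto simp: bij_betw_def)
qed

text \<open>
  Pairing is natural because a function that is constant on the coarser blocks takes the same value on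
  a block and on its image. A bar alive at the target must be alive at the source; otherwise
  its coordinate at the target could be non-zero although it should vanish.
\<close>

lemma bar_coordinates_natural:
  fixes T T' :: "('b \<times> ('v \<Rightarrow> 'f::field)) set"
  assumes P: "finite P" "partition_on Y P" and Q: "finite Q" "partition_on Z Q"
    and PQ: "coarsened_by P Q"
    and T': "\<And>i. i \<in> T' \<Longrightarrow> snd i \<in> block_functions X Q"
    and sub: "P = {} \<or> T' \<subseteq> T" and x: "x \<in> free_space P"
  shows "bar_coordinates Q T' (free_map (canonical_map Q) x) =
         (\<lambda>i. if i \<in> T' then bar_coordinates P T x i else 0)"
proof
  fix i
  show "bar_coordinates Q T' (free_map (canonical_map Q) x) i =
        (if i \<in> T' then bar_coordinates P T x i else 0)"
  proof (cases "i \<in> T'")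
    case True
    let ?g = "snd i"
    have val: "block_value ?g (canonical_map Q B) = block_value ?g B" if B: "B \<in> P" for B
    proof -
      obtain z where z: "z \<in> B" using B partition_onD3[OF P(2)] by (metis ex_in_conv)
      note c = canonical_map[OF Q(2) P(2) PQ B]
      have g: "?g \<in> block_functions X P" using T'[OF True] block_functions_antimono[OF PQ] by blast
      have "z \<in> canonical_map Q B" using c(2) z by blast
      then show ?thesis
        using block_value_eq[OF T'[OF True] c(1)] block_value_eq[OF g B z] by simp
    qed
    have "(\<Sum>C\<in>Q. free_map (canonical_map Q) x C * block_value ?g C) =
          (\<Sum>C\<in>Q. \<Sum>B | B \<in> P \<and> canonical_map Q B = C. x B * block_value ?g C)"
      by (simp add: free_map_sum[OF P(1) x] sum_distrib_right)
    also have "\<dots> = (\<Sum>C\<in>Q. \<Sum>B | B \<in> P \<and> canonical_map Q B = C. x B * block_value ?g B)"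
      by (intro sum.cong refl) (auto simp: val)
    also have "\<dots> = (\<Sum>B\<in>P. x B * block_value ?g B)"
      using P(1) Q(1) canonical_map(1)[OF Q(2) P(2) PQ] by (intro sum.group) auto
    also have "\<dots> = bar_coordinates P T x i" using sub True by (auto simp: bar_coordinates_def)
    finally show ?thesis using True by (simp add: bar_coordinates_def)
  qed (simp add: bar_coordinates_def)
qed

lemma generated_rel_sym_trans: "sym (generated_rel \<P>)" "trans (generated_rel \<P>)"
proof -
  show "sym (generated_rel \<P>)"
    unfolding generated_rel_def by (rule symI) (blast dest: symD)
  show "trans (generated_rel \<P>)"
    unfolding generated_rel_def by (rule transI) (blast dest: transD)
qed

lemma block_rel_generated: "P \<in> \<P> \<Longrightarrow> block_rel P \<subseteq> generated_rel \<P>"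
  unfolding generated_rel_def by blast

lemma generated_rel_least:
  "sym R \<Longrightarrow> trans R \<Longrightarrow> (\<And>P. P \<in> \<P> \<Longrightarrow> block_rel P \<subseteq> R) \<Longrightarrow> generated_rel \<P> \<subseteq> R"
  unfolding generated_rel_def by blast

lemma common_coarsening_mono:
  assumes "\<And>P. P \<in> \<P> \<Longrightarrow> \<exists>Q\<in>\<Q>. coarsened_by P Q"
  shows "coarsened_by (common_coarsening \<P>) (common_coarsening \<Q>)"
proof -
  have "generated_rel \<P> \<subseteq> generated_rel \<Q>"
  proof (rule generated_rel_least[OF generated_rel_sym_trans])
    fix P assume "P \<in> \<P>"
    then obtain Q where Q: "Q \<in> \<Q>" "coarsened_by P Q" using assms by blast
    have "block_rel P \<subseteq> block_rel Q"
    proof clarify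
      fix x y assume "(x, y) \<in> block_rel P"
      then obtain B where B: "B \<in> P" "x \<in> B" "y \<in> B" by (auto simp: block_rel_def)
      then obtain C where "C \<in> Q" "B \<subseteq> C" using Q(2) by (auto simp: coarsened_by_def)
      then show "(x, y) \<in> block_rel Q" using B by (auto simp: block_rel_def)
    qed
    then show "block_rel P \<subseteq> generated_rel \<Q>" using block_rel_generated[OF Q(1)] by blast
  qed
  note sub = this
  show ?thesis
    unfolding coarsened_by_def common_coarsening_def
  proof
    fix B assume "B \<in> Field (generated_rel \<P>) // generated_rel \<P>"
    then obtain x where x: "x \<in> Field (generated_rel \<P>)" "B = generated_rel \<P> `` {x}"
      by (rule quotientE)
    then have "generated_rel \<Q> `` {x} \<in> Field (generated_rel \<Q>) // generated_rel \<Q>"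
      using mono_Field[OF sub] by (blast intro: quotientI)
    moreover have "B \<subseteq> generated_rel \<Q> `` {x}" using x(2) sub by blast
    ultimately show "\<exists>C\<in>Field (generated_rel \<Q>) // generated_rel \<Q>. B \<subseteq> C" by blast
  qed
qed

lemma common_coarsening_empty:
  assumes "\<And>P. P \<in> \<P> \<Longrightarrow> P = {}"
  shows "common_coarsening \<P> = {}"
proof -
  have "generated_rel \<P> \<subseteq> {}"
    using assms by (intro generated_rel_least) (auto simp: block_rel_def sym_def trans_def)
  then show ?thesis by (simp add: common_coarsening_def)
qed

text \<open>
  The pairs on which a function takes equal values form an equivalence relation. Being constant on the blocks
  of the common coarsening thus means being constant on the blocks of each partition.
\<close>

lemma common_coarsening_partition:
  assumes "\<And>P. P \<in> \<P> \<Longrightarrow> P = {} \<or> partition_on X P" "P \<in> \<P>" "partition_on X P"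
  shows "partition_on X (common_coarsening \<P>)"
    and "block_functions X (common_coarsening \<P>) = (\<Inter>P\<in>\<P>. block_functions X P)"
proof -
  let ?R = "generated_rel \<P>"
  have "?R \<subseteq> X \<times> X"
    using assms(1) by (intro generated_rel_least) (auto simp: block_rel_def sym_def trans_def partition_on_def)
  moreover have "(x, x) \<in> ?R" if "x \<in> X" for x
    using block_rel_generated[OF assms(2)] assms(3) that by (auto simp: block_rel_def partition_on_def)
  ultimately have eqv: "equiv X ?R"
    using generated_rel_sym_trans by (intro equivI) (auto simp: refl_on_def)
  have Field: "Field ?R = X"
    using eqv \<open>?R \<subseteq> X \<times> X\<close> by (force simp: Field_def equiv_def refl_on_def)
  show "partition_on X (common_coarsening \<P>)"
    unfolding common_coarsening_def Field using eqv by (rule partition_on_quotient)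
  have blocks: "(\<forall>B\<in>X // ?R. \<forall>x\<in>B. \<forall>y\<in>B. g x = g y) \<longleftrightarrow> ?R \<subseteq> {(x, y). g x = g y}" for g :: "'a \<Rightarrow> 'c"
  proof
    assume *: "\<forall>B\<in>X // ?R. \<forall>x\<in>B. \<forall>y\<in>B. g x = g y"
    show "?R \<subseteq> {(x, y). g x = g y}"
    proof clarify
      fix x y assume xy: "(x, y) \<in> ?R"
      then have "x \<in> X" using \<open>?R \<subseteq> X \<times> X\<close> by blast
      then have "?R `` {x} \<in> X // ?R" "x \<in> ?R `` {x}" "y \<in> ?R `` {x}"
        using xy equiv_class_self[OF eqv] by (auto simp: quotientI)
      then show "g x = g y" using * by blast
    qed
  next
    assume "?R \<subseteq> {(x, y). g x = g y}"
    then show "\<forall>B\<in>X // ?R. \<forall>x\<in>B. \<forall>y\<in>B. g x = g y"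
      using quotient_eq_iff[OF eqv] by blast
  qed
  have least: "?R \<subseteq> {(x, y). g x = g y} \<longleftrightarrow> (\<forall>P\<in>\<P>. \<forall>B\<in>P. \<forall>x\<in>B. \<forall>y\<in>B. g x = g y)" for g :: "'a \<Rightarrow> 'c"
  proof
    assume "?R \<subseteq> {(x, y). g x = g y}"
    then show "\<forall>P\<in>\<P>. \<forall>B\<in>P. \<forall>x\<in>B. \<forall>y\<in>B. g x = g y"
      using block_rel_generated[of _ \<P>] unfolding block_rel_def by blast
  next
    assume "\<forall>P\<in>\<P>. \<forall>B\<in>P. \<forall>x\<in>B. \<forall>y\<in>B. g x = g y"
    then show "?R \<subseteq> {(x, y). g x = g y}"
      by (intro generated_rel_least) (auto simp: block_rel_def sym_def trans_def)
  qed
  show "block_functions X (common_coarsening \<P>) = (\<Inter>P\<in>\<P>. block_functions X P)"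
    unfolding block_functions_def common_coarsening_def Field set_eq_iff INT_iff mem_Collect_eq blocks least
    using assms(2) by blast
qed

lemma common_coarsening_single:
  assumes "partition_on X P"
  shows "common_coarsening {P} = P"
proof -
  have uniq: "B = C" if "B \<in> P" "C \<in> P" "y \<in> B" "y \<in> C" for B C y
    using that disjointD[OF partition_onD2[OF assms], of B C] by blast
  have "sym (block_rel P)" by (auto simp: block_rel_def sym_def)
  moreover have "trans (block_rel P)"
  proof (rule transI)
    fix x y z assume "(x, y) \<in> block_rel P" "(y, z) \<in> block_rel P"
    then obtain B C where "B \<in> P" "C \<in> P" "x \<in> B" "y \<in> B" "y \<in> C" "z \<in> C"
      unfolding block_rel_def by blast
    then show "(x, z) \<in> block_rel P" using uniq[of B C y] unfolding block_rel_def by blast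
  qed
  ultimately have gen: "generated_rel {P} = block_rel P"
    using block_rel_generated[of P "{P}"] generated_rel_least[of "block_rel P" "{P}"] by auto
  have cls: "block_rel P `` {x} = B" if "B \<in> P" "x \<in> B" for B x
    using that uniq[of B _ x] unfolding block_rel_def by blast
  have Field: "Field (block_rel P) = \<Union>P" by (auto simp: Field_def block_rel_def)
  show ?thesis
    unfolding common_coarsening_def gen Field
  proof (intro equalityI subsetI)
    fix B assume "B \<in> \<Union>P // block_rel P"
    then obtain x where "x \<in> \<Union>P" "B = block_rel P `` {x}" by (rule quotientE)
    then show "B \<in> P" using cls by auto
  next
    fix B assume B: "B \<in> P"
    then obtain x where x: "x \<in> B" using partition_onD3[OF assms] by (metis ex_in_conv)
    then show "B \<in> \<Union>P // block_rel P" using cls[OF B x] B quotientI[of x "\<Union>P" "block_rel P"] by auto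
  qed
qed

section \<open>Smoothing a family of partitions that starts at time zero\<close>

lemma knot_sequence_if_linear_bounds:
  assumes step: "\<And>i. c i < c (i + 1)" and d: "0 < d"
    and lower: "\<And>i. of_int i * d - e \<le> c i" and upper: "\<And>i. c i \<le> of_int i * d + e"
  shows "knot_sequence c"
proof
  show "strict_mono c"
  proof (rule strict_monoI)
    fix i j :: int assume "i < j"
    then show "c i < c j"
    proof (induction j rule: int_gr_induct)
      case base
      show ?case by (rule step)
    next
      case (step j)
      then show ?case using assms(1)[of j] by simp
    qed
  qed
  show "filterlim c at_top at_top"
    unfolding filterlim_at_top
  proof
    fix Z
    have "Z \<le> c i" if "\<lceil>(Z + e) / d\<rceil> \<le> i" for i
    proof -
      have "(Z + e) / d \<le> of_int i" using that by (simp add: ceiling_le_iff)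
      then have "Z + e \<le> of_int i * d" using d by (simp add: pos_divide_le_eq)
      then show ?thesis using lower[of i] by simp
    qed
    then show "\<forall>\<^sub>F i in at_top. Z \<le> c i" unfolding eventually_at_top_linorder by blast
  qed
  show "filterlim c at_bot at_bot"
    unfolding filterlim_at_bot
  proof
    fix Z
    have "c i \<le> Z" if "i \<le> \<lfloor>(Z - e) / d\<rfloor>" for i
    proof -
      have "of_int i \<le> (Z - e) / d" using that by (simp add: le_floor_iff)
      then have "of_int i * d \<le> Z - e" using d by (simp add: pos_le_divide_eq)
      then show ?thesis using upper[of i] by simp
    qed
    then show "\<forall>\<^sub>F i in at_bot. c i \<le> Z" unfolding eventually_at_bot_linorder by blast
  qed
qed

text \<open>
  On non-negative positions, \<open>n\<close> equals \<open>m\<close> or is the source of an arrow into \<open>m\<close>.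
\<close>

definition cell_adj :: "nat \<Rightarrow> nat \<Rightarrow> bool" where
  "cell_adj n m \<longleftrightarrow> n = m \<or> even m \<and> (n = m + 1 \<or> n + 1 = m)"

text \<open>
  The features of the components of a dynamic Bayesian graph that the stability result uses. Nothing
  is there before time 0, the vertex set is \<open>X\<close> from time 0 on, and changes happen at multiples of \<open>\<Delta>\<close>.
\<close>

locale grounded_partitions =
  fixes X :: "'v set" and \<theta> :: "real \<Rightarrow> 'v set set" and \<Delta> :: real
  assumes finite_X: "finite X" and \<Delta>_pos: "0 < \<Delta>"
    and neg: "t < 0 \<Longrightarrow> \<theta> t = {}"
    and part: "0 \<le> t \<Longrightarrow> partition_on X (\<theta> t)"
    and near: "\<forall>\<^sub>F s in nhds t. coarsened_by (\<theta> s) (\<theta> t)"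
    and crit: "crit \<theta> \<subseteq> range (\<lambda>i::int. of_int i * \<Delta>)"
begin

definition grid :: "int \<Rightarrow> real" where "grid i = of_int i * \<Delta>"
definition mid :: "int \<Rightarrow> real" where "mid i = (of_int i + 1 / 2) * \<Delta>"

lemma knot_sequence_shifted_grid: "knot_sequence (\<lambda>i. grid i + d)"
proof (rule knot_sequence_if_linear_bounds[where d = \<Delta> and e = "\<bar>d\<bar>"])
  show "grid i + d < grid (i + 1) + d" for i using \<Delta>_pos by (simp add: grid_def algebra_simps)
qed (use \<Delta>_pos in \<open>auto simp: grid_def\<close>)

sublocale grid: knots_with_samples grid mid
proof (intro knots_with_samples.intro knots_with_samples_axioms.intro)
  show "knot_sequence grid" using knot_sequence_shifted_grid[of 0] by simp
  show "grid i < mid i" "mid i < grid (i + 1)" for i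
    using \<Delta>_pos by (auto simp: grid_def mid_def algebra_simps)
qed

text \<open>
  Negative times are sent to position 0, the position of time 0. Replacing the start of a window by its
  cell therefore cuts off the part before time 0, where there is no partition to respect.
\<close>

definition cell :: "real \<Rightarrow> nat" where "cell t = nat (pos grid t)"

definition layer :: "nat \<Rightarrow> 'v set set" where "layer n = \<theta> (knot grid mid (int n))"

lemma pos_nonneg_iff: "0 \<le> pos grid t \<longleftrightarrow> 0 \<le> t"
  using grid.even_le_pos[of 0 t] by (simp add: grid_def)

lemma cell_mono: "t \<le> u \<Longrightarrow> cell t \<le> cell u"
  unfolding cell_def using grid.pos_mono nat_mono by blast

lemma cell_max_0: "cell (max 0 t) = cell t"
proof (cases "0 \<le> t")
  case False
  have "pos grid 0 = 0" using grid.pos_knot[of 0] by (simp add: knot_def grid_def)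
  then show ?thesis using False pos_nonneg_iff[of t] by (simp add: cell_def)
qed simp

lemma \<theta>_knot: "\<theta> (knot grid mid (pos grid t)) = \<theta> t"
  using crit by (intro grid.locally_constant_eq_knot) (simp add: grid_def[abs_def])

lemma \<theta>_eq_layer: "0 \<le> t \<Longrightarrow> \<theta> t = layer (cell t)"
  using \<theta>_knot[of t] pos_nonneg_iff[of t] by (simp add: layer_def cell_def)

lemma eventually_cell: "\<forall>\<^sub>F s in nhds t. cell_adj (cell s) (cell t)"
  using grid.eventually_pos[of t]
proof eventually_elim
  case (elim s)
  have "cell_adj (nat p) (nat q)" if pq: "zigzag_arrow p q" for p q
  proof (cases "0 \<le> p")
    case True
    then have "0 < p" "0 \<le> q" "even q" using pq by (auto simp: zigzag_arrow_def order_le_less)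
    then show ?thesis using pq by (auto simp: cell_adj_def zigzag_arrow_def even_nat_iff)
  next
    case False
    then show ?thesis using pq by (auto simp: cell_adj_def zigzag_arrow_def)
  qed
  then show ?case using elim by (auto simp: cell_def cell_adj_def)
qed

lemma layer_coarsened:
  assumes "cell_adj n m"
  shows "coarsened_by (layer n) (layer m)"
proof (cases "n = m")
  case True
  then show ?thesis by (auto simp: coarsened_by_def)
next
  case False
  then have "zigzag_arrow (int n) (int m)"
    using assms by (auto simp: cell_adj_def zigzag_arrow_def)
  from grid.exists_near_knot[OF this near]
  obtain t where "pos grid t = int n" "coarsened_by (\<theta> t) (layer m)" by (auto simp: layer_def)
  then show ?thesis using \<theta>_knot[of t] by (simp add: layer_def)
qed

lemma block_functions_layer_mono:
  "cell_adj n m \<Longrightarrow> block_functions X (layer m) \<subseteq> block_functions X (layer n)"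
  by (rule block_functions_antimono[OF layer_coarsened])

lemma cells_of_window:
  assumes "0 \<le> y" "x \<le> y"
  shows "n \<in> {cell x..cell y} \<longleftrightarrow> (\<exists>u\<in>{x..y}. 0 \<le> u \<and> cell u = n)"
proof
  assume n: "n \<in> {cell x..cell y}"
  show "\<exists>u\<in>{x..y}. 0 \<le> u \<and> cell u = n"
  proof (cases "n = cell x \<or> n = cell y")
    case True
    then show ?thesis
      using assms cell_max_0[of x] by (intro bexI[of _ "if n = cell y then y else max 0 x"]) auto
  next
    case False
    define u where "u = knot grid mid (int n)"
    have cu: "cell u = n" "0 \<le> u" using pos_nonneg_iff[of u] by (simp_all add: u_def cell_def)
    then have "x \<le> u" "u \<le> y" using n False cell_mono[of u x] cell_mono[of y u] by (auto simp: not_le intro: leI)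
    then show ?thesis using cu by auto
  qed
next
  assume "\<exists>u\<in>{x..y}. 0 \<le> u \<and> cell u = n"
  then show "n \<in> {cell x..cell y}" using cell_mono by auto
qed

lemma smoothing_before:
  assumes "t + \<epsilon> < 0"
  shows "smoothing \<epsilon> \<theta> t = {}"
  unfolding smoothing_def using assms neg by (intro common_coarsening_empty) auto

text \<open>
  By \<open>common_coarsening_partition\<close>; the partitions in the window are the layers at the cells between
  those of its two ends.
\<close>

lemma smoothing_after:
  assumes "0 \<le> \<epsilon>" "0 \<le> t + \<epsilon>"
  shows "partition_on X (smoothing \<epsilon> \<theta> t)"
    and "block_functions X (smoothing \<epsilon> \<theta> t) = (\<Inter>n\<in>{cell (t - \<epsilon>)..cell (t + \<epsilon>)}. block_functions X (layer n))"
proof -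
  let ?W = "\<theta> ` {t - \<epsilon>..t + \<epsilon>}"
  have W: "P = {} \<or> partition_on X P" if "P \<in> ?W" for P
    using that neg part by (metis imageE not_le)
  have last: "\<theta> (t + \<epsilon>) \<in> ?W" "partition_on X (\<theta> (t + \<epsilon>))" using assms part by auto
  show "partition_on X (smoothing \<epsilon> \<theta> t)"
    unfolding smoothing_def by (rule common_coarsening_partition[OF W last])
  have "block_functions X (smoothing \<epsilon> \<theta> t) = (\<Inter>P\<in>?W. block_functions X P)"
    unfolding smoothing_def by (rule common_coarsening_partition[OF W last])
  also have "\<dots> = (\<Inter>n\<in>{cell (t - \<epsilon>)..cell (t + \<epsilon>)}. block_functions X (layer n))"
  proof (intro equalityI subsetI INT_I)
    fix g n assume g: "g \<in> (\<Inter>P\<in>?W. block_functions X P)" and "n \<in> {cell (t - \<epsilon>)..cell (t + \<epsilon>)}"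
    then obtain u where u: "u \<in> {t - \<epsilon>..t + \<epsilon>}" "0 \<le> u" "cell u = n"
      using cells_of_window[of "t + \<epsilon>" "t - \<epsilon>" n] assms by auto
    then have "g \<in> block_functions X (\<theta> u)" using g by blast
    then show "g \<in> block_functions X (layer n)" using \<theta>_eq_layer[OF u(2)] u(3) by simp
  next
    fix g P assume g: "g \<in> (\<Inter>n\<in>{cell (t - \<epsilon>)..cell (t + \<epsilon>)}. block_functions X (layer n))" and "P \<in> ?W"
    then obtain u where u: "u \<in> {t - \<epsilon>..t + \<epsilon>}" "P = \<theta> u" by blast
    show "g \<in> block_functions X P"
    proof (cases "0 \<le> u")
      case True
      then have "cell u \<in> {cell (t - \<epsilon>)..cell (t + \<epsilon>)}" using u cell_mono by auto
      then show ?thesis using g u True \<theta>_eq_layer[of u] by auto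
    next
      case False
      have "g \<in> block_functions X (layer (cell (t + \<epsilon>)))" using g assms(1) cell_mono[of "t - \<epsilon>" "t + \<epsilon>"] by auto
      then show ?thesis using block_functionsD(1) u(2) neg False by (intro block_functionsI) auto
    qed
  qed
  finally show "block_functions X (smoothing \<epsilon> \<theta> t) =
    (\<Inter>n\<in>{cell (t - \<epsilon>)..cell (t + \<epsilon>)}. block_functions X (layer n))" .
qed

lemma smoothing_partition:
  assumes "0 \<le> \<epsilon>"
  shows "finite (smoothing \<epsilon> \<theta> t)" "partition_on (\<Union>(smoothing \<epsilon> \<theta> t)) (smoothing \<epsilon> \<theta> t)"
proof -
  have "smoothing \<epsilon> \<theta> t = {} \<or> partition_on X (smoothing \<epsilon> \<theta> t)"
    using smoothing_before[of t \<epsilon>] smoothing_after(1)[OF assms, of t] by (meson not_le)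
  then show "finite (smoothing \<epsilon> \<theta> t)" "partition_on (\<Union>(smoothing \<epsilon> \<theta> t)) (smoothing \<epsilon> \<theta> t)"
    using finite_elements[OF finite_X] partition_onD1 by (auto simp: partition_on_empty)
qed

lemma smoothing_near:
  assumes "0 \<le> \<epsilon>"
  shows "\<forall>\<^sub>F s in nhds t. coarsened_by (smoothing \<epsilon> \<theta> s) (smoothing \<epsilon> \<theta> t)"
proof -
  obtain d1 where d1: "d1 > 0" "\<And>u. dist u (t - \<epsilon>) < d1 \<Longrightarrow> coarsened_by (\<theta> u) (\<theta> (t - \<epsilon>))"
    using near[of "t - \<epsilon>"] unfolding eventually_nhds_metric by blast
  obtain d2 where d2: "d2 > 0" "\<And>u. dist u (t + \<epsilon>) < d2 \<Longrightarrow> coarsened_by (\<theta> u) (\<theta> (t + \<epsilon>))"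
    using near[of "t + \<epsilon>"] unfolding eventually_nhds_metric by blast
  have "coarsened_by (smoothing \<epsilon> \<theta> s) (smoothing \<epsilon> \<theta> t)" if s: "dist s t < min d1 d2" for s
    unfolding smoothing_def
  proof (rule common_coarsening_mono)
    fix P assume "P \<in> \<theta> ` {s - \<epsilon>..s + \<epsilon>}"
    then obtain u where u: "s - \<epsilon> \<le> u" "u \<le> s + \<epsilon>" "P = \<theta> u" by auto
    consider "u < t - \<epsilon>" | "t + \<epsilon> < u" | "u \<in> {t - \<epsilon>..t + \<epsilon>}" by fastforce
    then have "\<exists>v\<in>{t - \<epsilon>..t + \<epsilon>}. coarsened_by (\<theta> u) (\<theta> v)"
    proof cases
      case 1
      then have "dist u (t - \<epsilon>) < d1" using u s by (simp add: dist_real_def)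
      then show ?thesis using d1(2) assms by (intro bexI[of _ "t - \<epsilon>"]) auto
    next
      case 2
      then have "dist u (t + \<epsilon>) < d2" using u s by (simp add: dist_real_def)
      then show ?thesis using d2(2) assms by (intro bexI[of _ "t + \<epsilon>"]) auto
    next
      case 3
      then show ?thesis by (intro bexI[of _ u]) (auto simp: coarsened_by_def)
    qed
    then show "\<exists>Q\<in>\<theta> ` {t - \<epsilon>..t + \<epsilon>}. coarsened_by P Q" using u(3) by blast
  qed
  then show ?thesis using d1(1) d2(1) unfolding eventually_nhds_metric by (intro exI[of _ "min d1 d2"]) auto
qed

lemma upper_partitions_smoothing: "0 \<le> \<epsilon> \<Longrightarrow> upper_partitions (smoothing \<epsilon> \<theta>)"
  unfolding upper_partitions_def using smoothing_partition smoothing_near by blast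

lemma smoothing_cong:
  assumes "0 \<le> \<epsilon>" "pos grid (s - \<epsilon>) = pos grid (t - \<epsilon>)" "pos grid (s + \<epsilon>) = pos grid (t + \<epsilon>)"
  shows "smoothing \<epsilon> \<theta> s = smoothing \<epsilon> \<theta> t"
proof -
  have img: "\<theta> ` {x..y} = (\<lambda>k. \<theta> (knot grid mid k)) ` {pos grid x..pos grid y}" if xy: "x \<le> y" for x y
  proof (intro equalityI subsetI)
    fix P assume "P \<in> \<theta> ` {x..y}"
    then obtain u where "u \<in> {x..y}" "P = \<theta> (knot grid mid (pos grid u))" using \<theta>_knot by auto
    then show "P \<in> (\<lambda>k. \<theta> (knot grid mid k)) ` {pos grid x..pos grid y}" using grid.pos_mono by auto
  next
    fix P assume "P \<in> (\<lambda>k. \<theta> (knot grid mid k)) ` {pos grid x..pos grid y}"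
    then obtain k where k: "pos grid x \<le> k" "k \<le> pos grid y" "P = \<theta> (knot grid mid k)" by auto
    have "\<exists>u\<in>{x..y}. pos grid u = k"
    proof (cases "k = pos grid x \<or> k = pos grid y")
      case True
      then show ?thesis using xy by auto
    next
      case False
      define u where "u = knot grid mid k"
      have pu: "pos grid u = k" by (simp add: u_def)
      then have "\<not> u \<le> x" "\<not> y \<le> u" using k False grid.pos_mono[of u x] grid.pos_mono[of y u] by auto
      then show ?thesis using pu by (intro bexI[of _ u]) auto
    qed
    then show "P \<in> \<theta> ` {x..y}" using k(3) \<theta>_knot by (metis imageI)
  qed
  show ?thesis unfolding smoothing_def using img assms by simp
qed

end

section \<open>The bars of a smoothing\<close>

context grounded_partitions
begin

text \<open>
  The bar \<open>(b, g)\<close> is alive in the smoothing at \<open>t\<close> if its lifetime contains the cells of the whole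
  window around \<open>t\<close>. With \<open>\<epsilon> = 0\<close> these are the bars of \<open>\<theta>\<close> itself.
\<close>

definition bars ::
    "(nat \<Rightarrow> ('v \<Rightarrow> 'f::field) set) \<Rightarrow> real \<Rightarrow> real \<Rightarrow> (nat \<times> ('v \<Rightarrow> 'f)) set" where
  "bars B \<epsilon> t = {(b, g). 0 \<le> t + \<epsilon> \<and> b \<le> cell (t - \<epsilon>) \<and> g \<in> B b \<and>
                       (\<forall>n\<in>{b..cell (t + \<epsilon>)}. g \<in> block_functions X (layer n))}"

text \<open>
  The properties of the families provided by \<open>zigzag_basis\<close> for the spaces of functions on the layers.
\<close>

definition adapted :: "(nat \<Rightarrow> ('v \<Rightarrow> 'f::field) set) \<Rightarrow> bool" where
  "adapted B \<longleftrightarrow>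
     (\<forall>b. B b \<subseteq> block_functions X (layer b)) \<and>
     (\<forall>b. B (Suc b) \<inter> block_functions X (layer b) = {}) \<and>
     (\<forall>m j. m \<le> j \<longrightarrow> (let T = {(b, g). b \<le> m \<and> g \<in> B b \<and> (\<forall>n\<in>{b..j}. g \<in> block_functions X (layer n))} in
        inj_on snd T \<and> fs.independent (snd ` T) \<and>
        fs.span (snd ` T) = (\<Inter>n\<in>{m..j}. block_functions X (layer n))))"

lemma adapted_exists: "\<exists>B :: nat \<Rightarrow> ('v \<Rightarrow> 'f::field) set. adapted B"
proof -
  obtain G :: "('v \<Rightarrow> 'f) set" where G: "finite G" "\<And>P. block_functions X P \<subseteq> fs.span G"
    using block_functions_spanned[OF finite_X] by blast
  show ?thesis
    by (rule fs.zigzag_basis[OF G(1), of "\<lambda>n. block_functions X (layer n)"])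
      (use subspace_block_functions G(2) in \<open>auto simp: adapted_def Let_def\<close>)
qed

lemma bars_basis:
  assumes B: "adapted B" and \<epsilon>: "0 \<le> \<epsilon>" and t: "0 \<le> t + \<epsilon>"
  shows "inj_on snd (bars B \<epsilon> t)" "fs.independent (snd ` bars B \<epsilon> t)"
    "fs.span (snd ` bars B \<epsilon> t) = block_functions X (smoothing \<epsilon> \<theta> t)"
proof -
  have eq: "bars B \<epsilon> t = {(b, g). b \<le> cell (t - \<epsilon>) \<and> g \<in> B b \<and>
      (\<forall>n\<in>{b..cell (t + \<epsilon>)}. g \<in> block_functions X (layer n))}"
    using t by (simp add: bars_def)
  have "cell (t - \<epsilon>) \<le> cell (t + \<epsilon>)" using \<epsilon> by (intro cell_mono) simp
  then show "inj_on snd (bars B \<epsilon> t)" "fs.independent (snd ` bars B \<epsilon> t)"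
    "fs.span (snd ` bars B \<epsilon> t) = block_functions X (smoothing \<epsilon> \<theta> t)"
    using B unfolding adapted_def Let_def eq smoothing_after(2)[OF \<epsilon> t] by blast+
qed

lemma finite_bars:
  fixes B :: "nat \<Rightarrow> ('v \<Rightarrow> 'f::field) set"
  assumes "adapted B" "0 \<le> \<epsilon>"
  shows "finite (bars B \<epsilon> t)"
proof (cases "0 \<le> t + \<epsilon>")
  case True
  note b = bars_basis[OF assms True]
  obtain G :: "('v \<Rightarrow> 'f) set" where G: "finite G" "\<And>P. block_functions X P \<subseteq> fs.span G"
    using block_functions_spanned[OF finite_X] by blast
  have "snd ` bars B \<epsilon> t \<subseteq> fs.span G"
    using G(2) fs.span_superset[of "snd ` bars B \<epsilon> t"] unfolding b(3) by blast
  then have "finite (snd ` bars B \<epsilon> t)" using fs.independent_span_bound[OF G(1) b(2)] by blast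
  then show ?thesis using b(1) by (rule finite_imageD)
next
  case False
  then have "bars B \<epsilon> t = {}" by (auto simp: bars_def)
  then show ?thesis by simp
qed

lemma bars_convex:
  assumes "t \<le> u" "u \<le> v" "i \<in> bars B \<epsilon> t" "i \<in> bars B \<epsilon> v"
  shows "i \<in> bars B \<epsilon> u"
proof -
  obtain b g where i: "i = (b, g)" by (cases i)
  have "cell (t - \<epsilon>) \<le> cell (u - \<epsilon>)" "cell (u + \<epsilon>) \<le> cell (v + \<epsilon>)"
    using assms(1,2) by (auto intro: cell_mono)
  then show ?thesis using assms unfolding bars_def i by auto
qed

text \<open>
  The lifetime of a bar is open in the half-line from time 0, since the spaces at even positions are contained in the
  neighbouring ones: a function present at an even position was there one step earlier and is still there
  one step later. Hence a bar alive at \<open>t\<close> is alive at all nearby times that are late enough,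
  which is what naturality of the coordinates requires.
\<close>

lemma bars_locally_open:
  assumes B: "adapted B" and \<epsilon>: "0 \<le> \<epsilon>" and i: "i \<in> bars B \<epsilon> t" and s: "0 \<le> s + \<epsilon>"
    and adj: "cell_adj (cell (s - \<epsilon>)) (cell (t - \<epsilon>))" "cell_adj (cell (s + \<epsilon>)) (cell (t + \<epsilon>))"
  shows "i \<in> bars B \<epsilon> s"
proof -
  obtain b g where bg: "i = (b, g)" by (cases i)
  have t: "b \<le> cell (t - \<epsilon>)" "g \<in> B b"
    and life: "\<And>n. b \<le> n \<Longrightarrow> n \<le> cell (t + \<epsilon>) \<Longrightarrow> g \<in> block_functions X (layer n)"
    using i unfolding bars_def bg by auto
  \<comment> \<open>At an even position every function extends to the left, so births there happen only at 0.\<close>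
  have birth: "b = 0" if "even b"
  proof (rule ccontr)
    assume "b \<noteq> 0"
    then obtain a where a: "b = Suc a" using not0_implies_Suc by blast
    then have "cell_adj a b" using that by (simp add: cell_adj_def)
    moreover have "g \<in> block_functions X (layer b)" using B t(2) unfolding adapted_def by blast
    ultimately have "g \<in> block_functions X (layer a)" using block_functions_layer_mono by blast
    then show False using B t(2) a unfolding adapted_def by blast
  qed
  have "b \<le> cell (s - \<epsilon>)"
  proof (cases "b = cell (t - \<epsilon>)")
    case True
    then show ?thesis using adj(1) birth unfolding cell_adj_def by auto
  next
    case False
    then show ?thesis using adj(1) t(1) unfolding cell_adj_def by auto
  qed
  moreover have "g \<in> block_functions X (layer n)" if n: "b \<le> n" "n \<le> cell (s + \<epsilon>)" for n
  proof (cases "n \<le> cell (t + \<epsilon>)")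
    case True
    then show ?thesis using life n by blast
  next
    case False
    then have "cell_adj n (cell (t + \<epsilon>))" using adj(2) n unfolding cell_adj_def by auto
    moreover have "b \<le> cell (t + \<epsilon>)" using t(1) cell_mono[of "t - \<epsilon>" "t + \<epsilon>"] \<epsilon> by simp
    ultimately show ?thesis using life block_functions_layer_mono by blast
  qed
  ultimately show ?thesis using s t(2) unfolding bars_def bg by auto
qed

text \<open>
  A lifetime is convex, so it contains a window if it contains both ends.
\<close>

lemma bars_smoothing_iff:
  assumes "0 \<le> \<epsilon>"
  shows "i \<in> bars B \<epsilon> t \<longleftrightarrow> 0 \<le> t + \<epsilon> \<and> i \<in> bars B 0 (max 0 (t - \<epsilon>)) \<and> i \<in> bars B 0 (t + \<epsilon>)"
proof -
  obtain b g where i: "i = (b, g)" by (cases i)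
  have "cell (t - \<epsilon>) \<le> cell (t + \<epsilon>)" using assms by (intro cell_mono) simp
  then show ?thesis unfolding i bars_def by (auto simp: cell_max_0)
qed

lemma smoothing_decomposes:
  assumes B: "adapted B" and \<epsilon>: "0 \<le> \<epsilon>"
  shows "decomposes (smoothing \<epsilon> \<theta>) (bars B \<epsilon>) (\<lambda>t. bar_coordinates (smoothing \<epsilon> \<theta> t) (bars B \<epsilon> t))"
proof -
  let ?S = "smoothing \<epsilon> \<theta>" and ?T = "bars B \<epsilon>"
  have iso: "linear_between (free_space (?S t)) (free_space (?T t)) (bar_coordinates (?S t) (?T t)) \<and>
             bij_betw (bar_coordinates (?S t) (?T t)) (free_space (?S t)) (free_space (?T t))" for t
  proof (cases "0 \<le> t + \<epsilon>")
    case True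
    show ?thesis
      using bar_coordinates_iso[OF smoothing_partition(1)[OF \<epsilon>] smoothing_after(1)[OF \<epsilon> True]
          finite_bars[OF B \<epsilon>] bars_basis[OF B \<epsilon> True]] by blast
  next
    case False
    then have "?S t = {}" "?T t = {}" using smoothing_before[of t \<epsilon>] by (auto simp: bars_def)
    then show ?thesis
      by (simp add: free_space_empty linear_between_def bij_betw_def bar_coordinates_def)
  qed
  have nat: "\<forall>\<^sub>F s in nhds t. \<forall>x\<in>free_space (?S s).
      bar_coordinates (?S t) (?T t) (free_map (canonical_map (?S t)) x) =
      (\<lambda>i. if i \<in> ?T t then bar_coordinates (?S s) (?T s) x i else 0)" for t
  proof -
    have "filterlim (\<lambda>s. s - \<epsilon>) (nhds (t - \<epsilon>)) (nhds t)" "filterlim (\<lambda>s. s + \<epsilon>) (nhds (t + \<epsilon>)) (nhds t)"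
      by (intro tendsto_intros filterlim_ident)+
    then have "\<forall>\<^sub>F s in nhds t. cell_adj (cell (s - \<epsilon>)) (cell (t - \<epsilon>))"
      "\<forall>\<^sub>F s in nhds t. cell_adj (cell (s + \<epsilon>)) (cell (t + \<epsilon>))"
      using eventually_cell[of "t - \<epsilon>"] eventually_cell[of "t + \<epsilon>"] by (auto simp: filterlim_iff)
    then show ?thesis
      using smoothing_near[OF \<epsilon>, of t]
    proof eventually_elim
      case (elim s)
      show ?case
      proof (intro ballI bar_coordinates_natural)
        show "snd i \<in> block_functions X (?S t)" if i: "i \<in> ?T t" for i
        proof -
          have "0 \<le> t + \<epsilon>" using i by (auto simp: bars_def)
          from bars_basis(3)[OF B \<epsilon> this] show ?thesis using i fs.span_base[of "snd i" "snd ` ?T t"] by auto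
        qed
        show "?S s = {} \<or> ?T t \<subseteq> ?T s"
        proof (cases "0 \<le> s + \<epsilon>")
          case True
          then show ?thesis using bars_locally_open[OF B \<epsilon> _ True elim(1,2)] by blast
        next
          case False
          then show ?thesis using smoothing_before[of s \<epsilon>] by simp
        qed
      qed (use elim smoothing_partition[OF \<epsilon>] in auto)
    qed
  qed
  show ?thesis
    unfolding decomposes_def using iso nat finite_bars[OF B \<epsilon>] bars_convex by blast
qed

end

section \<open>The barcode of a smoothing\<close>

context grounded_partitions
begin

text \<open>
  The smoothing can change at \<open>i \<Delta> - \<epsilon>\<close> and \<open>i \<Delta> + \<epsilon>\<close>. Modulo \<open>\<Delta>\<close> these two progressions differ by
  \<open>2 \<epsilon>\<close>, and \<open>offset \<epsilon>\<close> is the remainder. If the progressions coincide, it is replaced by \<open>\<Delta> / 2\<close>: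
  further knots are harmless, and the merged sequence stays strictly increasing.
\<close>

definition offset :: "real \<Rightarrow> real" where
  "offset \<epsilon> = (let f = frac (2 * \<epsilon> / \<Delta>) in if f = 0 then \<Delta> / 2 else f * \<Delta>)"

definition merged_grid :: "real \<Rightarrow> int \<Rightarrow> real" where
  "merged_grid \<epsilon> i = of_int (i div 2) * \<Delta> - \<epsilon> + (if even i then 0 else offset \<epsilon>)"

lemma offset_bounds: "0 < offset \<epsilon>" "offset \<epsilon> < \<Delta>"
proof -
  let ?f = "frac (2 * \<epsilon> / \<Delta>)"
  have f: "0 \<le> ?f" "?f < 1" by (simp_all add: frac_lt_1)
  show "0 < offset \<epsilon>" using f \<Delta>_pos by (auto simp: offset_def Let_def order_le_less)
  have "?f * \<Delta> < 1 * \<Delta>" using f \<Delta>_pos by (intro mult_strict_right_mono) auto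
  then show "offset \<epsilon> < \<Delta>" using \<Delta>_pos by (auto simp: offset_def Let_def)
qed

lemma merged_grid_step: "merged_grid \<epsilon> i < merged_grid \<epsilon> (i + 1)"
proof (cases "even i")
  case True
  then show ?thesis using offset_bounds(1)[of \<epsilon>] by (simp add: merged_grid_def)
next
  case False
  then have "(i + 1) div 2 = i div 2 + 1" by presburger
  then show ?thesis using False offset_bounds(2)[of \<epsilon>] by (simp add: merged_grid_def algebra_simps)
qed

lemma knot_sequence_merged_grid: "knot_sequence (merged_grid \<epsilon>)"
proof (rule knot_sequence_if_linear_bounds[where d = "\<Delta> / 2" and e = "\<bar>\<epsilon>\<bar> + \<Delta>"])
  fix i :: int
  have "2 * (i div 2) \<le> i" "i - 1 \<le> 2 * (i div 2)" by presburger+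
  then have "real_of_int (2 * (i div 2)) \<le> of_int i" "real_of_int (i - 1) \<le> of_int (2 * (i div 2))"
    by (simp_all only: of_int_le_iff)
  then have "real_of_int (2 * (i div 2)) * (\<Delta> / 2) \<le> of_int i * (\<Delta> / 2)"
    "real_of_int (i - 1) * (\<Delta> / 2) \<le> real_of_int (2 * (i div 2)) * (\<Delta> / 2)"
    using \<Delta>_pos by (intro mult_right_mono; simp)+
  then have half: "real_of_int (i div 2) * \<Delta> \<le> of_int i * (\<Delta> / 2)"
    "of_int i * (\<Delta> / 2) - \<Delta> / 2 \<le> real_of_int (i div 2) * \<Delta>"
    by (simp_all add: algebra_simps)
  have "0 \<le> (if even i then 0 else offset \<epsilon>)" "(if even i then 0 else offset \<epsilon>) \<le> \<Delta>"
    using offset_bounds[of \<epsilon>] \<Delta>_pos by auto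
  then show "of_int i * (\<Delta> / 2) - (\<bar>\<epsilon>\<bar> + \<Delta>) \<le> merged_grid \<epsilon> i" "merged_grid \<epsilon> i \<le> of_int i * (\<Delta> / 2) + (\<bar>\<epsilon>\<bar> + \<Delta>)"
    using half \<Delta>_pos unfolding merged_grid_def by linarith+
qed (use merged_grid_step \<Delta>_pos in auto)

lemma grid_subset_merged_grid:
  "range (\<lambda>i. grid i + - \<epsilon>) \<subseteq> range (merged_grid \<epsilon>)" "range (\<lambda>i. grid i + \<epsilon>) \<subseteq> range (merged_grid \<epsilon>)"
proof -
  have "grid i + - \<epsilon> = merged_grid \<epsilon> (2 * i)" for i by (simp add: grid_def merged_grid_def)
  then show "range (\<lambda>i. grid i + - \<epsilon>) \<subseteq> range (merged_grid \<epsilon>)" by auto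
  have "grid i + \<epsilon> \<in> range (merged_grid \<epsilon>)" for i
  proof -
    \<comment> \<open>With \<open>2 * \<epsilon> = (m + f) * \<Delta>\<close> the knot \<open>i * \<Delta> + \<epsilon>\<close> is \<open>(i + m) * \<Delta> - \<epsilon> + f * \<Delta>\<close>.\<close>
    define m where "m = \<lfloor>2 * \<epsilon> / \<Delta>\<rfloor>"
    let ?f = "frac (2 * \<epsilon> / \<Delta>)"
    have "2 * \<epsilon> / \<Delta> = of_int m + ?f" by (simp add: m_def frac_def)
    then have "2 * \<epsilon> = (of_int m + ?f) * \<Delta>" using \<Delta>_pos by (simp add: field_simps)
    then have "grid i + \<epsilon> = of_int (i + m) * \<Delta> - \<epsilon> + ?f * \<Delta>" by (simp add: grid_def algebra_simps)
    also have "\<dots> = merged_grid \<epsilon> (if ?f = 0 then 2 * (i + m) else 2 * (i + m) + 1)"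
      by (simp add: merged_grid_def offset_def Let_def)
    finally show ?thesis by blast
  qed
  then show "range (\<lambda>i. grid i + \<epsilon>) \<subseteq> range (merged_grid \<epsilon>)" by auto
qed

lemma pos_merged_grid_determines:
  assumes "pos (merged_grid \<epsilon>) s = pos (merged_grid \<epsilon>) t"
  shows "pos grid (s - \<epsilon>) = pos grid (t - \<epsilon>)" "pos grid (s + \<epsilon>) = pos grid (t + \<epsilon>)"
proof -
  note refine = knot_sequence.pos_refine[OF knot_sequence_shifted_grid knot_sequence_merged_grid _ assms]
  show "pos grid (s - \<epsilon>) = pos grid (t - \<epsilon>)"
    using refine[OF grid_subset_merged_grid(2)] by (simp only: pos_shift)
  show "pos grid (s + \<epsilon>) = pos grid (t + \<epsilon>)"
    using refine[OF grid_subset_merged_grid(1)] unfolding pos_shift by simp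
qed

lemma knots_smoothing:
  assumes \<epsilon>: "0 \<le> \<epsilon>"
  shows "knots (smoothing \<epsilon> \<theta>) (merged_grid \<epsilon>) (\<lambda>i. (merged_grid \<epsilon> i + merged_grid \<epsilon> (i + 1)) / 2)"
proof -
  interpret knot_sequence "merged_grid \<epsilon>" by (rule knot_sequence_merged_grid)
  have "crit (smoothing \<epsilon> \<theta>) \<subseteq> range (merged_grid \<epsilon>)"
  proof
    fix t assume t: "t \<in> crit (smoothing \<epsilon> \<theta>)"
    show "t \<in> range (merged_grid \<epsilon>)"
    proof (rule ccontr)
      assume t_new: "t \<notin> range (merged_grid \<epsilon>)"
      have odd: "odd (pos (merged_grid \<epsilon>) t)"
      proof
        assume "even (pos (merged_grid \<epsilon>) t)"
        then have "merged_grid \<epsilon> (pos (merged_grid \<epsilon>) t div 2) = t"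
          using le_pos_iff[of "pos (merged_grid \<epsilon>) t" t] le_pos_iff[of "pos (merged_grid \<epsilon>) t + 1" t]
          by (auto simp: order_le_less)
        then show False using t_new by (metis rangeI)
      qed
      have "\<forall>\<^sub>F s in nhds t. smoothing \<epsilon> \<theta> s = smoothing \<epsilon> \<theta> t"
        using eventually_pos[of t]
      proof eventually_elim
        case (elim s)
        then have "pos (merged_grid \<epsilon>) s = pos (merged_grid \<epsilon>) t" using odd by (auto simp: zigzag_arrow_def)
        then show ?case using smoothing_cong[OF \<epsilon>] pos_merged_grid_determines by blast
      qed
      then show False using t by (simp add: crit_def)
    qed
  qed
  then show ?thesis
    unfolding knots_def using mono top bot merged_grid_step by (simp add: field_simps)
qed

lemma smoothing_barcode:
  fixes B :: "nat \<Rightarrow> ('v \<Rightarrow> 'f::field) set"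
  assumes B: "adapted B" and \<epsilon>: "0 \<le> \<epsilon>"
  shows "dgm TYPE('f) (smoothing \<epsilon> \<theta>) =
         (\<lambda>R. card {i \<in> (\<Union>t. bars B \<epsilon> t). {t. i \<in> bars B \<epsilon> t} = R})"
proof (intro dgm_eq upper_partitions_smoothing[OF \<epsilon>]
    is_barcode_if_decomposes[OF knots_smoothing[OF \<epsilon>] smoothing_decomposes[OF B \<epsilon>]])
  fix t u assume "pos (merged_grid \<epsilon>) t = pos (merged_grid \<epsilon>) u"
  note p = pos_merged_grid_determines[OF this]
  then have "cell (t - \<epsilon>) = cell (u - \<epsilon>)" "cell (t + \<epsilon>) = cell (u + \<epsilon>)" by (simp_all add: cell_def)
  moreover have "0 \<le> t + \<epsilon> \<longleftrightarrow> 0 \<le> u + \<epsilon>"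
    using p pos_nonneg_iff[of "t + \<epsilon>"] pos_nonneg_iff[of "u + \<epsilon>"] by simp
  ultimately have "bars B \<epsilon> t = bars B \<epsilon> u" by (auto simp: bars_def)
  then show "bars B \<epsilon> t = bars B \<epsilon> u \<and>
      bar_coordinates (smoothing \<epsilon> \<theta> t) (bars B \<epsilon> t) = bar_coordinates (smoothing \<epsilon> \<theta> u) (bars B \<epsilon> u)"
    using smoothing_cong[OF \<epsilon> p] by simp
qed

end

section \<open>The matching\<close>

text \<open>
  If two barcodes are indexed by the bars of one family, matching along the common index bounds their
  distance.
\<close>

lemma bottleneck_dist_of_families:
  fixes I :: "'i \<Rightarrow> real set" and J :: "'i \<Rightarrow> real set"
  assumes fin: "\<And>R. finite {i \<in> S. I i = R}" "\<And>R. finite {i \<in> T. J i = R}"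
    and ST: "S \<subseteq> T" and r: "0 \<le> r"
    and close: "\<And>i. i \<in> S \<Longrightarrow> end_dist (left_end (I i)) (left_end (J i)) \<le> ereal r \<and>
                            end_dist (right_end (I i)) (right_end (J i)) \<le> ereal r"
    and short: "\<And>i. i \<in> T - S \<Longrightarrow> right_end (J i) - left_end (J i) \<le> ereal (2 * r)"
  shows "bottleneck_dist (\<lambda>R. card {i \<in> S. I i = R}) (\<lambda>R. card {i \<in> T. J i = R}) \<le> ereal r"
proof -
  let ?A = "\<lambda>R. card {i \<in> S. I i = R}" and ?B = "\<lambda>R. card {i \<in> T. J i = R}"
  obtain \<alpha> where \<alpha>: "bij_betw \<alpha> S (copies ?A)" "\<And>i. i \<in> S \<Longrightarrow> fst (\<alpha> i) = I i"
    using family_bij_copies[of S I, OF fin(1)] by metis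
  obtain \<beta> where \<beta>: "bij_betw \<beta> T (copies ?B)" "\<And>i. i \<in> T \<Longrightarrow> fst (\<beta> i) = J i"
    using family_bij_copies[of T J, OF fin(2)] by metis
  have inj: "i = j" if "i \<in> S" "j \<in> S" "\<alpha> i = \<alpha> j" for i j
    using that \<alpha>(1) by (auto simp: bij_betw_def inj_on_def)
  have inj': "i = j" if "i \<in> T" "j \<in> T" "\<beta> i = \<beta> j" for i j
    using that \<beta>(1) by (auto simp: bij_betw_def inj_on_def)
  define m where "m = (\<lambda>i. (\<alpha> i, \<beta> i)) ` S"
  have "partial_matching (copies ?A) (copies ?B) m"
    unfolding partial_matching_def
  proof (intro conjI)
    show "m \<subseteq> copies ?A \<times> copies ?B"
      using \<alpha>(1) \<beta>(1) ST by (auto simp: m_def bij_betw_def)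
    show "single_valued m"
      unfolding single_valued_def m_def using inj by blast
    show "single_valued (m\<inverse>)"
      unfolding single_valued_def m_def using inj' ST by blast
  qed
  moreover have matched: "end_dist (left_end (fst p)) (left_end (fst q)) \<le> ereal r \<and>
      end_dist (right_end (fst p)) (right_end (fst q)) \<le> ereal r" if "(p, q) \<in> m" for p q
    using that close \<alpha>(2) \<beta>(2) ST by (auto simp: m_def)
  moreover have "Domain m = copies ?A"
    using \<alpha>(1) by (auto simp: m_def bij_betw_def Domain_fst image_image)
  moreover have unmatched: "right_end (fst q) - left_end (fst q) \<le> ereal (2 * r)" if q: "q \<in> copies ?B - Range m" for q
  proof -
    obtain i where i: "i \<in> T" "q = \<beta> i" using q \<beta>(1) by (auto simp: bij_betw_def)
    then have "i \<notin> S" using q by (auto simp: m_def)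
    then show ?thesis using i short \<beta>(2) by auto
  qed
  ultimately have "r_matching r ?A ?B m"
    unfolding r_matching_def
  proof (intro conjI)
    show "\<forall>((R, i), (R', j))\<in>m. end_dist (left_end R) (left_end R') \<le> ereal r \<and>
        end_dist (right_end R) (right_end R') \<le> ereal r"
    proof clarify
      fix R i R' j assume "((R, i), (R', j)) \<in> m"
      from matched[OF this] show "end_dist (left_end R) (left_end R') \<le> ereal r \<and>
        end_dist (right_end R) (right_end R') \<le> ereal r" by simp
    qed
    show "\<forall>(R, j)\<in>copies ?B - Range m. right_end R - left_end R \<le> ereal (2 * r)"
    proof (rule ballI)
      fix q assume "q \<in> copies ?B - Range m"
      from unmatched[OF this] show "case q of (R, j) \<Rightarrow> right_end R - left_end R \<le> ereal (2 * r)"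
        by (simp add: case_prod_beta)
    qed
  qed simp_all
  then show ?thesis unfolding bottleneck_dist_def using r by (intro Inf_lower) auto
qed

text \<open>
  If \<open>t\<close> is in \<open>I'\<close>, then \<open>t + \<epsilon>\<close> is in \<open>I\<close>. Conversely, starting from a point \<open>t\<^sub>0\<close> of \<open>I'\<close> and a point \<open>x\<close>
  of \<open>I\<close>, the times \<open>min t\<^sub>0 (x + \<epsilon>)\<close> and \<open>max t\<^sub>0 (x - \<epsilon>)\<close> are in \<open>I'\<close>.
\<close>

lemma smoothed_interval_ends:
  fixes I :: "real set"
  assumes I: "is_interval I" "I \<subseteq> {0..}" and \<epsilon>: "0 \<le> \<epsilon>"
    and I': "I' = {t. 0 \<le> t + \<epsilon> \<and> max 0 (t - \<epsilon>) \<in> I \<and> t + \<epsilon> \<in> I}" "I' \<noteq> {}"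
  shows "end_dist (left_end I') (left_end I) \<le> ereal \<epsilon>"
    and "end_dist (right_end I') (right_end I) \<le> ereal \<epsilon>"
proof -
  have between: "z \<in> I" if "x \<in> I" "y \<in> I" "x \<le> z" "z \<le> y" for x y z
    using I(1) that unfolding is_interval_1 by blast
  have nonneg: "0 \<le> x" if "x \<in> I" for x using that I(2) by auto
  obtain t0 where t0: "0 \<le> t0 + \<epsilon>" "max 0 (t0 - \<epsilon>) \<in> I" "t0 + \<epsilon> \<in> I" using I' by auto
  have left_le: "\<exists>t\<in>I'. t \<le> x + \<epsilon>" if x: "x \<in> I" for x
  proof (cases "t0 \<le> x + \<epsilon>")
    case True
    then show ?thesis using t0 I'(1) by auto
  next
    case False
    have "x + 2 * \<epsilon> \<in> I" by (rule between[OF x t0(3)]) (use False \<epsilon> in auto)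
    then have "x + \<epsilon> \<in> I'" using x nonneg[OF x] \<epsilon> unfolding I'(1) by (auto simp: algebra_simps)
    then show ?thesis by blast
  qed
  have right_ge: "\<exists>t\<in>I'. x - \<epsilon> \<le> t" if x: "x \<in> I" for x
  proof (cases "x - \<epsilon> \<le> t0")
    case True
    then show ?thesis using t0 I'(1) by auto
  next
    case False
    have "max 0 (x - 2 * \<epsilon>) \<in> I"
      by (rule between[OF t0(2) x]) (use False \<epsilon> nonneg[OF x] in auto)
    then have "x - \<epsilon> \<in> I'" using x nonneg[OF x] \<epsilon> unfolding I'(1) by (auto simp: algebra_simps)
    then show ?thesis by blast
  qed
  have upper: "t + \<epsilon> \<in> I" if "t \<in> I'" for t using that I'(1) by auto
  have L1: "left_end I \<le> left_end I' + ereal \<epsilon>"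
  proof -
    have "left_end I - ereal \<epsilon> \<le> left_end I'"
      unfolding left_end_def[of I']
    proof (rule Inf_greatest, clarify)
      fix t assume "t \<in> I'"
      then have "left_end I \<le> ereal (t + \<epsilon>)" unfolding left_end_def using upper by (intro Inf_lower) auto
      then show "left_end I - ereal \<epsilon> \<le> ereal t" by (simp add: ereal_minus_le)
    qed
    then show ?thesis by (simp add: ereal_minus_le)
  qed
  have L2: "left_end I' \<le> left_end I + ereal \<epsilon>"
  proof -
    have "left_end I' - ereal \<epsilon> \<le> left_end I"
      unfolding left_end_def[of I]
    proof (rule Inf_greatest, clarify)
      fix x assume "x \<in> I"
      then obtain t where t: "t \<in> I'" "t \<le> x + \<epsilon>" using left_le by blast
      have "left_end I' \<le> ereal t" unfolding left_end_def using t(1) by (intro Inf_lower) auto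
      also have "\<dots> \<le> ereal (x + \<epsilon>)" using t(2) by simp
      finally show "left_end I' - ereal \<epsilon> \<le> ereal x" by (simp add: ereal_minus_le)
    qed
    then show ?thesis by (simp add: ereal_minus_le)
  qed
  have R1: "right_end I' \<le> right_end I + ereal \<epsilon>"
    unfolding right_end_def[of I']
  proof (rule Sup_least, clarify)
    fix t assume "t \<in> I'"
    then have "ereal (t + \<epsilon>) \<le> right_end I" unfolding right_end_def using upper by (intro Sup_upper) auto
    moreover have "ereal t \<le> ereal (t + \<epsilon>) + ereal \<epsilon>" using \<epsilon> by simp
    ultimately show "ereal t \<le> right_end I + ereal \<epsilon>" by (meson add_right_mono order_trans)
  qed
  have R2: "right_end I \<le> right_end I' + ereal \<epsilon>"
    unfolding right_end_def[of I]
  proof (rule Sup_least, clarify)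
    fix x assume "x \<in> I"
    then obtain t where t: "t \<in> I'" "x - \<epsilon> \<le> t" using right_ge by blast
    have "ereal t \<le> right_end I'" unfolding right_end_def using t(1) by (intro Sup_upper) auto
    moreover have "ereal x \<le> ereal t + ereal \<epsilon>" using t(2) by simp
    ultimately show "ereal x \<le> right_end I' + ereal \<epsilon>" by (meson add_right_mono order_trans)
  qed
  have close: "end_dist a b \<le> ereal \<epsilon>" if "a \<le> b + ereal \<epsilon>" "b \<le> a + ereal \<epsilon>" for a b
    using that \<epsilon> by (cases a; cases b) (auto simp: end_dist_def)
  show "end_dist (left_end I') (left_end I) \<le> ereal \<epsilon>" using close[OF L2 L1] .
  show "end_dist (right_end I') (right_end I) \<le> ereal \<epsilon>" using close[OF R1 R2] .
qed

text \<open>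
  If two points of \<open>I\<close> were more than \<open>2 \<epsilon>\<close> apart, the window around their midpoint would lie in \<open>I\<close>.
\<close>

lemma smoothed_interval_empty:
  fixes I :: "real set"
  assumes I: "is_interval I" "I \<subseteq> {0..}" "I \<noteq> {}" and \<epsilon>: "0 \<le> \<epsilon>"
    and empty: "\<And>t. \<not> (0 \<le> t + \<epsilon> \<and> max 0 (t - \<epsilon>) \<in> I \<and> t + \<epsilon> \<in> I)"
  shows "right_end I - left_end I \<le> ereal (2 * \<epsilon>)"
proof -
  have diff: "y - x \<le> 2 * \<epsilon>" if xy: "x \<in> I" "y \<in> I" for x y
  proof (rule ccontr)
    assume "\<not> y - x \<le> 2 * \<epsilon>"
    then have l: "2 * \<epsilon> < y - x" by simp
    define t where "t = (x + y) / 2"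
    have t: "x \<le> t - \<epsilon>" "t + \<epsilon> \<le> y" using l by (auto simp: t_def field_simps)
    have x0: "0 \<le> x" using xy(1) I(2) by auto
    have "z \<in> I" if "x \<le> z" "z \<le> y" for z
      using I(1) xy that unfolding is_interval_1 by blast
    then have "t - \<epsilon> \<in> I" "t + \<epsilon> \<in> I" using t \<epsilon> by auto
    then show False using empty[of t] t x0 \<epsilon> by (simp add: max_absorb2)
  qed
  have "right_end I \<le> left_end I + ereal (2 * \<epsilon>)"
    unfolding right_end_def
  proof (rule Sup_least, clarify)
    fix y assume y: "y \<in> I"
    have "ereal y - ereal (2 * \<epsilon>) \<le> left_end I"
      unfolding left_end_def
    proof (rule Inf_greatest, clarify)
      fix x assume "x \<in> I"
      then show "ereal y - ereal (2 * \<epsilon>) \<le> ereal x" using diff[of x y] y by simp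
    qed
    then show "ereal y \<le> left_end I + ereal (2 * \<epsilon>)" by (cases "left_end I") auto
  qed
  moreover have "0 \<le> left_end I"
    unfolding left_end_def using I(2) by (intro Inf_greatest) auto
  moreover obtain x where "x \<in> I" using I(3) by blast
  then have "left_end I \<le> ereal x" unfolding left_end_def by (intro Inf_lower) auto
  ultimately show ?thesis
    by (cases "left_end I"; cases "right_end I") auto
qed

context grounded_partitions
begin

lemma finite_bar_fibers:
  assumes "adapted B" "0 \<le> \<epsilon>"
  shows "finite {i \<in> (\<Union>t. bars B \<epsilon> t). {t. i \<in> bars B \<epsilon> t} = R}"
proof (cases "R = {}")
  case True
  then have "{i \<in> (\<Union>t. bars B \<epsilon> t). {t. i \<in> bars B \<epsilon> t} = R} = {}" by auto
  then show ?thesis by (simp only: finite.emptyI)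
next
  case False
  then obtain t where "t \<in> R" by blast
  then have "{i \<in> (\<Union>t. bars B \<epsilon> t). {t. i \<in> bars B \<epsilon> t} = R} \<subseteq> bars B \<epsilon> t" by auto
  then show ?thesis using finite_bars[OF assms] finite_subset by blast
qed

lemma smoothing_0: "smoothing 0 \<theta> = \<theta>"
proof
  fix t
  have "partition_on {} (\<theta> t) \<or> partition_on X (\<theta> t)"
    using neg[of t] part[of t] by (cases "t < 0") (auto simp: partition_on_empty)
  then have "common_coarsening {\<theta> t} = \<theta> t" using common_coarsening_single by blast
  then show "smoothing 0 \<theta> t = \<theta> t" by (simp add: smoothing_def)
qed

theorem smoothing_stable:
  assumes \<epsilon>: "0 \<le> \<epsilon>"
  shows "bottleneck_dist (dgm TYPE('f::field) (smoothing \<epsilon> \<theta>)) (dgm TYPE('f) \<theta>) \<le> ereal \<epsilon>"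
proof -
  obtain B :: "nat \<Rightarrow> ('v \<Rightarrow> 'f) set" where B: "adapted B" using adapted_exists by blast
  define life where "life e i = {t. i \<in> bars B e t}" for e i
  have life_smooth: "life \<epsilon> i = {t. 0 \<le> t + \<epsilon> \<and> max 0 (t - \<epsilon>) \<in> life 0 i \<and> t + \<epsilon> \<in> life 0 i}" for i
    unfolding life_def using bars_smoothing_iff[OF \<epsilon>] by blast
  have life_ivl: "is_interval (life 0 i)" for i
    unfolding life_def is_interval_1 using bars_convex by blast
  have life_pos: "life 0 i \<subseteq> {0..}" for i by (auto simp: life_def bars_def)
  have "bottleneck_dist (\<lambda>R. card {i \<in> (\<Union>t. bars B \<epsilon> t). life \<epsilon> i = R})
                        (\<lambda>R. card {i \<in> (\<Union>t. bars B 0 t). life 0 i = R}) \<le> ereal \<epsilon>"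
  proof (rule bottleneck_dist_of_families[OF _ _ _ \<epsilon>])
    show "finite {i \<in> (\<Union>t. bars B \<epsilon> t). life \<epsilon> i = R}" "finite {i \<in> (\<Union>t. bars B 0 t). life 0 i = R}" for R
      unfolding life_def using finite_bar_fibers[OF B] \<epsilon> by auto
    show "(\<Union>t. bars B \<epsilon> t) \<subseteq> (\<Union>t. bars B 0 t)" using bars_smoothing_iff[OF \<epsilon>] by blast
    fix i assume "i \<in> (\<Union>t. bars B \<epsilon> t)"
    then have "life \<epsilon> i \<noteq> {}" by (auto simp: life_def)
    then show "end_dist (left_end (life \<epsilon> i)) (left_end (life 0 i)) \<le> ereal \<epsilon> \<and>
        end_dist (right_end (life \<epsilon> i)) (right_end (life 0 i)) \<le> ereal \<epsilon>"
      using smoothed_interval_ends[OF life_ivl life_pos \<epsilon> life_smooth] by blast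
  next
    fix i assume i: "i \<in> (\<Union>t. bars B 0 t) - (\<Union>t. bars B \<epsilon> t)"
    then have "life 0 i \<noteq> {}" "life \<epsilon> i = {}" by (auto simp: life_def)
    then show "right_end (life 0 i) - left_end (life 0 i) \<le> ereal (2 * \<epsilon>)"
      using life_smooth[of i] by (intro smoothed_interval_empty[OF life_ivl life_pos _ \<epsilon>]) auto
  qed
  then show ?thesis
    using smoothing_barcode[OF B \<epsilon>] smoothing_barcode[OF B order_refl]
    by (simp add: life_def smoothing_0)
qed

end

section \<open>Dynamic Bayesian graphs\<close>

text \<open>
  The one-sided comparison of partitions in the definition of a formigram is turned into a comparison
  on a neighbourhood.
\<close>

lemma grounded_partitions_dbg:
  fixes N :: "('v, 's) dbn"
  assumes N: "is_dbn N" and \<Delta>: "0 < \<Delta>"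
  shows "grounded_partitions (dbn_vars N) (pi0 (dbg N \<eta> \<Delta>)) \<Delta>"
proof
  let ?\<theta> = "pi0 (dbg N \<eta> \<Delta>)"
  show "finite (dbn_vars N)" using N by (simp add: is_dbn_def)
  show "0 < \<Delta>" by fact
  show "?\<theta> t = {}" if "t < 0" for t using that by (simp add: pi0_def dbg_def)
  show "partition_on (dbn_vars N) (?\<theta> t)" if "0 \<le> t" for t
    using that partition_on_quotient[OF equiv_connectivity] by (auto simp: pi0_def dbg_def)
  show "crit ?\<theta> \<subseteq> range (\<lambda>i::int. of_int i * \<Delta>)"
  proof
    fix t assume "t \<in> crit ?\<theta>"
    then obtain k where "t = real k * \<Delta>"
      using pi0_dbg_locally_constant[OF \<Delta>] unfolding crit_def by blast
    then show "t \<in> range (\<lambda>i::int. of_int i * \<Delta>)" by (intro image_eqI[of _ _ "int k"]) auto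
  qed
  show "\<forall>\<^sub>F s in nhds t. coarsened_by (?\<theta> s) (?\<theta> t)" for t
  proof -
    have "\<forall>\<^sub>F e in at_right 0. coarsened_by (?\<theta> (t - e)) (?\<theta> t) \<and> coarsened_by (?\<theta> (t + e)) (?\<theta> t)"
      using pi0_dbg_formigram[OF \<Delta>, of N \<eta>] unfolding formigram_def by blast
    then obtain b where b: "0 < b" "\<And>e. 0 < e \<Longrightarrow> e < b \<Longrightarrow>
        coarsened_by (?\<theta> (t - e)) (?\<theta> t) \<and> coarsened_by (?\<theta> (t + e)) (?\<theta> t)"
      unfolding eventually_at_right_field by auto
    have "coarsened_by (?\<theta> s) (?\<theta> t)" if s: "dist s t < b" for s
    proof -
      consider "s = t" | "s < t" | "t < s" by linarith
      then show ?thesis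
      proof cases
        case 1
        then show ?thesis by (auto simp: coarsened_by_def)
      next
        case 2
        then show ?thesis using b(2)[of "t - s"] s by (simp add: dist_real_def)
      next
        case 3
        then show ?thesis using b(2)[of "s - t"] s by (simp add: dist_real_def)
      qed
    qed
    then show ?thesis using b(1) unfolding eventually_nhds_metric by blast
  qed
qed

theorem proposition4p13:
  fixes N :: "('v, 's) dbn" and \<eta> \<Delta> \<epsilon> :: real
  assumes "is_dbn N" and "0 < \<Delta>" and "0 \<le> \<epsilon>"
  shows "bottleneck_dist
           (dgm TYPE('f::field) (smoothing \<epsilon> (pi0 (dbg N \<eta> \<Delta>))))
           (dgm TYPE('f) (pi0 (dbg N \<eta> \<Delta>)))
         \<le> ereal \<epsilon>"
  using grounded_partitions.smoothing_stable[OF grounded_partitions_dbg[OF assms(1,2)] assms(3)] .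

end
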